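(* Let $(\mathcal{M},\mathbf{c},K)$ be a conformal optical geometry with congruence of null geodesics $\mathcal{K}$. Then locally, there is a (non-empty) subclass $\mathbf{c}_{\mathrm{n.e.}}$ of metrics in $\mathbf{c}$ with the property that whenever $g$ is in $\mathbf{c}_{\mathrm{n.e.}}$, the congruence $\mathcal{K}$ is non-expanding, i.e. for any $k\in\Gamma(K)$ with $\kappa=g(k,\cdot)$, $\kappa\,\mathrm{div}\,k-\nabla_k\kappa=0$. Any two metrics in $\mathbf{c}_{\mathrm{n.e.}}$ differ by a factor constant along $K$. The conformal subclass $\mathbf{c}_{\mathrm{n.e.}}$ induces a conformal subclass $(\mathbf{c}_{\mathrm{n.e.}})_K$ of $\mathbf{c}_K$ on the screen bundle.
   Context: A conformal optical geometry $(\mathcal{M},\mathbf{c},K)$ is an oriented and time-oriented Lorentzian conformal manifold of dimension $n+2$ (metrics in $\mathbf{c}$ being related by $\widehat g=e^{2\varphi}g$, $\varphi$ smooth) with a null line distribution $K\subset T\mathcal{M}$. $\mathcal{K}$ is the foliation by curves tangent to $K$; it is a congruence of null geodesics if $\nabla_kk\in\Gamma(K)$ for $k\in\Gamma(K)$, with $\nabla$ the Levi-Civita connection of one (equivalently any) $g\in\mathbf{c}$. For each $g\in\mathbf{c}$, $\nabla$ and $\mathrm{div}$ in the displayed condition are those of $g$. The screen bundle is $H_K=K^\perp/K$, each $g\in\mathbf{c}$ induces a bundle metric $h(v+K,w+K)=g(v,w)$ on it, and $\mathbf{c}_K$ is the resulting conformal class; $(\mathbf{c}_{\mathrm{n.e.}})_K$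 consists of the bundle metrics induced by the metrics in $\mathbf{c}_{\mathrm{n.e.}}$. *)

theory Defs
  imports "HOL-Analysis.Analysis"
begin

section \<open>Smooth maps\<close>

text \<open>For open \<open>S\<close>: \<open>f\<close> is of class \<open>C\<^sup>k\<close> on \<open>S\<close>.  Asking every directional derivative
  to be of class \<open>C\<^sup>k\<close> is the usual recursion because the domains used below are
  finite-dimensional.\<close>

fun Ck_on :: "nat \<Rightarrow> 'x::real_normed_vector set \<Rightarrow> ('x \<Rightarrow> 'y::real_normed_vector) \<Rightarrow> bool" where
  "Ck_on 0 S f \<longleftrightarrow> continuous_on S f"
| "Ck_on (Suc k) S f \<longleftrightarrow>
     (\<forall>x\<in>S. f differentiable (at x)) \<and> (\<forall>v. Ck_on k S (\<lambda>x. frechet_derivative f (at x) v))"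

definition smooth_on :: "'x::real_normed_vector set \<Rightarrow> ('x \<Rightarrow> 'y::real_normed_vector) \<Rightarrow> bool" where
  "smooth_on S f \<longleftrightarrow> (\<forall>k. Ck_on k S f)"

section \<open>Manifolds and fields on them\<close>

text \<open>A chart is a pair of its domain and its coordinate map; the values of the
  coordinate map outside the domain are irrelevant.\<close>

type_synonym ('a, 'm) chart = "'a set \<times> ('a \<Rightarrow> real ^ 'm)"

definition inv_chart :: "('a, 'm) chart \<Rightarrow> real ^ 'm \<Rightarrow> 'a" where
  "inv_chart c = inv_into (fst c) (snd c)"

definition is_chart :: "('a::topological_space, 'm::finite) chart \<Rightarrow> bool" where
  "is_chart c \<longleftrightarrow> open (fst c) \<and> open (snd c ` fst c) \<and>
     homeomorphism (fst c) (snd c ` fst c) (snd c) (inv_chart c)"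

text \<open>The atlas need not be maximal.  The manifold it describes is the open set \<open>carrier A\<close>;
  the Hausdorff and countability axioms are imposed on the type of points.\<close>

definition smooth_atlas ::
    "('a::{t2_space,second_countable_topology}, 'm::finite) chart set \<Rightarrow> bool" where
  "smooth_atlas A \<longleftrightarrow> (\<forall>c\<in>A. is_chart c) \<and>
     (\<forall>c\<in>A. \<forall>c'\<in>A. smooth_on (snd c ` (fst c \<inter> fst c')) (snd c' \<circ> inv_chart c))"

definition carrier :: "('a, 'm) chart set \<Rightarrow> 'a set" where
  "carrier A = (\<Union>c\<in>A. fst c)"

text \<open>Jacobian matrix at \<open>p\<close> of the change of coordinates from \<open>c\<close> to \<open>c'\<close>.\<close>

definition jacobian ::
    "('a, 'm::finite) chart \<Rightarrow> ('a, 'm) chart \<Rightarrow> 'a \<Rightarrow> real ^ 'm ^ 'm" where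
  "jacobian c c' p = matrix (frechet_derivative (snd c' \<circ> inv_chart c) (at (snd c p)))"

text \<open>Tensors are given by their components in all charts of the atlas, subject to the
  transformation law of the respective kind: \<open>F c p\<close> are the components in the chart \<open>c\<close> at the
  point \<open>p\<close>.  Values for \<open>p\<close> outside of the domain of \<open>c\<close>, or outside of the open set \<open>W\<close> on
  which the field lives, are irrelevant.\<close>

type_synonym ('a, 'm, 'b) field = "('a, 'm) chart \<Rightarrow> 'a \<Rightarrow> 'b"

definition smooth_components ::
    "('a, 'm::finite) chart set \<Rightarrow> 'a set \<Rightarrow> ('a, 'm, 'b::real_normed_vector) field \<Rightarrow> bool" where
  "smooth_components A W F \<longleftrightarrow>
     (\<forall>c\<in>A. smooth_on (snd c ` (fst c \<inter> W)) (F c \<circ> inv_chart c))"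

definition smooth_fun :: "('a, 'm::finite) chart set \<Rightarrow> 'a set \<Rightarrow> ('a \<Rightarrow> real) \<Rightarrow> bool" where
  "smooth_fun A W f \<longleftrightarrow> smooth_components A W (\<lambda>c. f)"

definition vector_field ::
    "('a, 'm::finite) chart set \<Rightarrow> 'a set \<Rightarrow> ('a, 'm, real ^ 'm) field \<Rightarrow> bool" where
  "vector_field A W X \<longleftrightarrow> smooth_components A W X \<and>
     (\<forall>c\<in>A. \<forall>c'\<in>A. \<forall>p\<in>fst c \<inter> fst c' \<inter> W. X c' p = jacobian c c' p *v X c p)"

text \<open>Derivative of (the components of) a field at \<open>p\<close> in direction of the tangent vector whose
  components in the chart \<open>c\<close> are \<open>v\<close>.\<close>

definition chart_deriv ::
    "('a, 'm::finite) chart \<Rightarrow> ('a \<Rightarrow> 'b::real_normed_vector) \<Rightarrow> 'a \<Rightarrow> real ^ 'm \<Rightarrow> 'b" where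
  "chart_deriv c F p v = frechet_derivative (F \<circ> inv_chart c) (at (snd c p)) v"

text \<open>An orientation is a continuous choice of orientation of the tangent spaces; it is encoded
  by the sign telling whether the coordinate frame of \<open>c\<close> is positively oriented at \<open>p\<close>.\<close>

definition orientation ::
    "('a::topological_space, 'm::finite) chart set \<Rightarrow> ('a, 'm, real) field \<Rightarrow> bool" where
  "orientation A s \<longleftrightarrow>
     (\<forall>c\<in>A. continuous_on (fst c) (s c) \<and> (\<forall>p\<in>fst c. s c p \<in> {-1, 1})) \<and>
     (\<forall>c\<in>A. \<forall>c'\<in>A. \<forall>p\<in>fst c \<inter> fst c'. s c' p = sgn (det (jacobian c c' p)) * s c p)"

section \<open>Lorentzian metrics\<close>

type_synonym ('a, 'm) metric = "('a, 'm, real ^ 'm ^ 'm) field"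

definition ip :: "real ^ 'm ^ 'm \<Rightarrow> real ^ 'm::finite \<Rightarrow> real ^ 'm \<Rightarrow> real" where
  "ip G v w = v \<bullet> (G *v w)"

text \<open>Signature convention: one minus sign, i.e. timelike vectors have negative square.\<close>

definition lorentzian_form :: "real ^ 'm ^ 'm::finite \<Rightarrow> bool" where
  "lorentzian_form G \<longleftrightarrow> transpose G = G \<and>
     (\<exists>(e :: 'm \<Rightarrow> real ^ 'm) i0. \<forall>i j.
        ip G (e i) (e j) = (if i \<noteq> j then 0 else if i = i0 then - 1 else 1))"

definition lorentz_metric ::
    "('a, 'm::finite) chart set \<Rightarrow> 'a set \<Rightarrow> ('a, 'm) metric \<Rightarrow> bool" where
  "lorentz_metric A W g \<longleftrightarrow> smooth_components A W g \<and>
     (\<forall>c\<in>A. \<forall>p\<in>fst c \<inter> W. lorentzian_form (g c p)) \<and>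
     (\<forall>c\<in>A. \<forall>c'\<in>A. \<forall>p\<in>fst c \<inter> fst c' \<inter> W.
        g c p = transpose (jacobian c c' p) ** g c' p ** jacobian c c' p)"

text \<open>Levi-Civita connection.  \<open>christoffel g c p k i j\<close> is the Christoffel symbol
  \<open>\<Gamma>\<^sup>k\<^sub>i\<^sub>j\<close>; in \<open>cov_deriv\<close> and \<open>cov_deriv_form\<close> the vector \<open>v\<close> is the direction of
  differentiation at \<open>p\<close>.\<close>

definition christoffel ::
    "('a, 'm) metric \<Rightarrow> ('a, 'm) chart \<Rightarrow> 'a \<Rightarrow> 'm \<Rightarrow> 'm \<Rightarrow> 'm::finite \<Rightarrow> real" where
  "christoffel g c p k i j = 1 / 2 * (\<Sum>l\<in>UNIV. matrix_inv (g c p) $ k $ l *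
     (chart_deriv c (g c) p (axis i 1) $ j $ l + chart_deriv c (g c) p (axis j 1) $ i $ l
       - chart_deriv c (g c) p (axis l 1) $ i $ j))"

text \<open>The two properties characterizing the Levi-Civita connection: vanishing torsion and
  \<open>\<nabla>g = 0\<close>.\<close>

lemma christoffel_sym:
  assumes "\<And>v. transpose (chart_deriv c (g c) p v) = chart_deriv c (g c) p v"
  shows "christoffel g c p k i j = christoffel g c p k j i"
proof -
  have "chart_deriv c (g c) p v $ i $ j = chart_deriv c (g c) p v $ j $ i" for v i j
    using arg_cong[OF assms[of v], of "\<lambda>M. M $ j $ i"] by (simp add: transpose_def)
  then show ?thesis
    unfolding christoffel_def by (simp only: add.commute)
qed

lemma christoffel_metric:
  assumes inv: "invertible (g c p)" and sym: "transpose (g c p) = g c p"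
    and dsym: "\<And>v. transpose (chart_deriv c (g c) p v) = chart_deriv c (g c) p v"
  shows "chart_deriv c (g c) p (axis i 1) $ j $ k =
    (\<Sum>l\<in>UNIV. christoffel g c p l i j * g c p $ l $ k) +
    (\<Sum>l\<in>UNIV. christoffel g c p l i k * g c p $ j $ l)"
proof -
  define D where "D i j l = chart_deriv c (g c) p (axis i 1) $ j $ l" for i j l
  define E where "E i j m = D i j m + D j i m - D m i j" for i j m
  have G: "g c p $ a $ b = g c p $ b $ a" for a b
    using arg_cong[OF sym, of "\<lambda>M. M $ b $ a"] by (simp add: transpose_def)
  have Ds: "D i j l = D i l j" for i j l
    unfolding D_def using arg_cong[OF dsym, of "\<lambda>M. M $ l $ j"] by (simp add: transpose_def)
  have "g c p ** matrix_inv (g c p) = mat 1"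
    using someI_ex[OF inv[unfolded invertible_def]] unfolding matrix_inv_def by blast
  then have one: "(\<Sum>l\<in>UNIV. g c p $ a $ l * matrix_inv (g c p) $ l $ b) = (if a = b then 1 else 0)"
    for a b
  proof -
    have "(\<Sum>l\<in>UNIV. g c p $ a $ l * matrix_inv (g c p) $ l $ b)
        = (g c p ** matrix_inv (g c p)) $ a $ b"
      by (simp add: matrix_matrix_mult_def)
    then show ?thesis
      unfolding \<open>g c p ** matrix_inv (g c p) = mat 1\<close> by (simp add: mat_def)
  qed
  have low: "(\<Sum>l\<in>UNIV. christoffel g c p l i j * g c p $ a $ l) = E i j a / 2" for i j a
  proof -
    have "(\<Sum>l\<in>UNIV. christoffel g c p l i j * g c p $ a $ l)
        = (\<Sum>l\<in>UNIV. \<Sum>m\<in>UNIV. (g c p $ a $ l * matrix_inv (g c p) $ l $ m) * (E i j m / 2))"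
      unfolding christoffel_def E_def D_def
      by (intro sum.cong refl) (simp add: sum_distrib_left sum_distrib_right mult_ac)
    also have "\<dots> = (\<Sum>m\<in>UNIV. (\<Sum>l\<in>UNIV. g c p $ a $ l * matrix_inv (g c p) $ l $ m) * (E i j m / 2))"
      unfolding sum_distrib_right by (rule sum.swap)
    also have "\<dots> = E i j a / 2"
      unfolding one by (simp add: if_distrib[of "\<lambda>x. x * _"] flip: sum_divide_distrib cong: if_cong)
    finally show ?thesis .
  qed
  have "(\<Sum>l\<in>UNIV. christoffel g c p l i j * g c p $ l $ k) = E i j k / 2"
    unfolding low[symmetric] by (intro sum.cong refl) (simp only: G[of k])
  moreover have "D i j k = E i j k / 2 + E i k j / 2"
    unfolding E_def using Ds[of i j k] Ds[of j i k] Ds[of k i j] by (simp add: field_simps)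
  ultimately show ?thesis using low[of i k j] by (simp add: D_def)
qed

definition cov_deriv ::
    "('a, 'm) metric \<Rightarrow> ('a, 'm, real ^ 'm) field \<Rightarrow> ('a, 'm) chart \<Rightarrow> 'a
      \<Rightarrow> real ^ 'm \<Rightarrow> real ^ 'm::finite" where
  "cov_deriv g Y c p v = chart_deriv c (Y c) p v +
     (\<chi> k. \<Sum>i\<in>UNIV. \<Sum>j\<in>UNIV. christoffel g c p k i j * v $ i * Y c p $ j)"

definition cov_deriv_form ::
    "('a, 'm) metric \<Rightarrow> ('a, 'm, real ^ 'm) field \<Rightarrow> ('a, 'm) chart \<Rightarrow> 'a
      \<Rightarrow> real ^ 'm \<Rightarrow> real ^ 'm::finite" where
  "cov_deriv_form g \<alpha> c p v = chart_deriv c (\<alpha> c) p v -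
     (\<chi> j. \<Sum>i\<in>UNIV. \<Sum>k\<in>UNIV. christoffel g c p k i j * v $ i * \<alpha> c p $ k)"

definition divergence ::
    "('a, 'm) metric \<Rightarrow> ('a, 'm::finite, real ^ 'm) field \<Rightarrow> ('a, 'm) chart \<Rightarrow> 'a \<Rightarrow> real" where
  "divergence g X c p = trace (matrix (cov_deriv g X c p))"

text \<open>The one-form \<open>g(X, \<sqdot>)\<close>.\<close>

definition flat ::
    "('a, 'm) metric \<Rightarrow> ('a, 'm::finite, real ^ 'm) field \<Rightarrow> ('a, 'm, real ^ 'm) field" where
  "flat g X c p = (\<chi> j. ip (g c p) (X c p) (axis j 1))"

section \<open>Conformal classes\<close>

definition conf_class ::
    "('a, 'm::finite) chart set \<Rightarrow> 'a set \<Rightarrow> ('a, 'm) metric \<Rightarrow> ('a, 'm) metric set" where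
  "conf_class A W g = {g'. \<exists>\<phi>. smooth_fun A W \<phi> \<and>
     (\<forall>c\<in>A. \<forall>p\<in>fst c \<inter> W. g' c p = exp (2 * \<phi> p) *\<^sub>R g c p)}"

definition lorentz_conformal_structure ::
    "('a, 'm::finite) chart set \<Rightarrow> ('a, 'm) metric set \<Rightarrow> bool" where
  "lorentz_conformal_structure A C \<longleftrightarrow>
     (\<exists>g. lorentz_metric A (carrier A) g \<and> C = conf_class A (carrier A) g)"

text \<open>The conformal structure which \<open>C\<close> induces on the open submanifold \<open>W\<close>.\<close>

definition restrict_class ::
    "('a, 'm::finite) chart set \<Rightarrow> 'a set \<Rightarrow> ('a, 'm) metric set \<Rightarrow> ('a, 'm) metric set" where
  "restrict_class A W C = (\<Union>g\<in>C. conf_class A W g)"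

text \<open>A time-orientation is represented by a timelike vector field, which singles out the
  future cones.\<close>

definition time_orientation ::
    "('a, 'm::finite) chart set \<Rightarrow> ('a, 'm) metric set \<Rightarrow> ('a, 'm, real ^ 'm) field \<Rightarrow> bool" where
  "time_orientation A C T \<longleftrightarrow> vector_field A (carrier A) T \<and>
     (\<forall>g\<in>C. \<forall>c\<in>A. \<forall>p\<in>fst c. ip (g c p) (T c p) (T c p) < 0)"

section \<open>Conformal optical geometries\<close>

text \<open>A distribution is given by the subspaces of \<open>real ^ 'm\<close> that represent its fibres in the
  individual charts.\<close>

type_synonym ('a, 'm) distribution = "('a, 'm, (real ^ 'm) set) field"

definition line_distribution ::
    "('a::topological_space, 'm::finite) chart set \<Rightarrow> ('a, 'm) distribution \<Rightarrow> bool" where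
  "line_distribution A K \<longleftrightarrow>
     (\<forall>c\<in>A. \<forall>p\<in>fst c. subspace (K c p) \<and> dim (K c p) = 1) \<and>
     (\<forall>c\<in>A. \<forall>c'\<in>A. \<forall>p\<in>fst c \<inter> fst c'. K c' p = (*v) (jacobian c c' p) ` K c p) \<and>
     (\<forall>p\<in>carrier A. \<exists>V k. open V \<and> p \<in> V \<and> V \<subseteq> carrier A \<and> vector_field A V k \<and>
        (\<forall>c\<in>A. \<forall>q\<in>fst c \<inter> V. K c q = span {k c q}))"

definition sections ::
    "('a, 'm::finite) chart set \<Rightarrow> 'a set \<Rightarrow> ('a, 'm) distribution
      \<Rightarrow> ('a, 'm, real ^ 'm) field set" where
  "sections A W K = {k. vector_field A W k \<and> (\<forall>c\<in>A. \<forall>p\<in>fst c \<inter> W. k c p \<in> K c p)}"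

definition conformal_optical_geometry ::
    "('a::{t2_space,second_countable_topology}, 'm::finite) chart set \<Rightarrow> ('a, 'm, real) field
      \<Rightarrow> ('a, 'm, real ^ 'm) field \<Rightarrow> ('a, 'm) metric set \<Rightarrow> ('a, 'm) distribution \<Rightarrow> bool" where
  "conformal_optical_geometry A s T C K \<longleftrightarrow>
     smooth_atlas A \<and> orientation A s \<and> lorentz_conformal_structure A C \<and>
     time_orientation A C T \<and> line_distribution A K \<and>
     (\<forall>g\<in>C. \<forall>c\<in>A. \<forall>p\<in>fst c. \<forall>v\<in>K c p. ip (g c p) v v = 0)"

text \<open>The condition does not depend on the metric in the conformal class.\<close>

definition null_geodesic_congruence ::
    "('a, 'm::finite) chart set \<Rightarrow> ('a, 'm) metric set \<Rightarrow> ('a, 'm) distribution \<Rightarrow> bool" where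
  "null_geodesic_congruence A C K \<longleftrightarrow>
     (\<exists>g\<in>C. \<forall>k\<in>sections A (carrier A) K.
        (\<lambda>c p. cov_deriv g k c p (k c p)) \<in> sections A (carrier A) K)"

definition non_expanding ::
    "('a, 'm::finite) chart set \<Rightarrow> 'a set \<Rightarrow> ('a, 'm) distribution \<Rightarrow> ('a, 'm) metric \<Rightarrow> bool" where
  "non_expanding A W K g \<longleftrightarrow>
     (\<forall>k\<in>sections A W K. \<forall>c\<in>A. \<forall>p\<in>fst c \<inter> W.
        divergence g k c p *\<^sub>R flat g k c p - cov_deriv_form g (flat g k) c p (k c p) = 0)"

definition constant_along ::
    "('a, 'm::finite) chart set \<Rightarrow> 'a set \<Rightarrow> ('a, 'm) distribution \<Rightarrow> ('a \<Rightarrow> real) \<Rightarrow> bool" where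
  "constant_along A W K f \<longleftrightarrow>
     smooth_fun A W f \<and> (\<forall>c\<in>A. \<forall>p\<in>fst c \<inter> W. \<forall>v\<in>K c p. chart_deriv c f p v = 0)"

section \<open>The screen bundle\<close>

definition perp ::
    "('a, 'm) metric \<Rightarrow> ('a, 'm) distribution \<Rightarrow> ('a, 'm) chart \<Rightarrow> 'a \<Rightarrow> (real ^ 'm::finite) set" where
  "perp g K c p = {v. \<forall>w\<in>K c p. ip (g c p) v w = 0}"

text \<open>The fibre of \<open>K\<^sup>\<bottom> / K\<close>, as a set of cosets.\<close>

definition screen ::
    "('a, 'm) metric \<Rightarrow> ('a, 'm) distribution \<Rightarrow> ('a, 'm) chart \<Rightarrow> 'a
      \<Rightarrow> (real ^ 'm::finite) set set" where
  "screen g K c p = {(+) v ` K c p | v. v \<in> perp g K c p}"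

type_synonym ('a, 'm) screen_metric =
  "('a, 'm, (real ^ 'm) set \<Rightarrow> (real ^ 'm) set \<Rightarrow> real) field"

text \<open>The bundle metric \<open>h(v + K, w + K) = g(v, w)\<close>, extended by zero to arguments that are not in
  the screen space.\<close>

definition induced_screen_metric ::
    "('a, 'm) distribution \<Rightarrow> ('a, 'm::finite) metric \<Rightarrow> ('a, 'm) screen_metric" where
  "induced_screen_metric K g c p a b =
     (if a \<in> screen g K c p \<and> b \<in> screen g K c p
      then THE r. \<forall>v\<in>a. \<forall>w\<in>b. r = ip (g c p) v w else 0)"

end

theory Submission
  imports Defs
begin

text \<open>A global section \<open>k\<close> of \<open>K\<close> is normalised by \<open>g(k, T) = - 1\<close> with the time-orientation \<open>T\<close>,
  which is possible since a null vector is never orthogonal to a timelike one.  Geodesicity reads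
  \<open>\<nabla>\<^sub>k k = \<gamma> k\<close>, so \<open>\<kappa> div k - \<nabla>\<^sub>k \<kappa> = (div k - \<gamma>) \<kappa>\<close>.  This expression is quadratic
  in \<open>k\<close>, and under \<open>g \<mapsto> e\<^sup>2\<^sup>\<phi> g\<close> the factor \<open>div k - \<gamma>\<close> changes by \<open>n k(\<phi>)\<close>.  Hence
  \<open>e\<^sup>2\<^sup>\<phi> g\<close> is non-expanding iff \<open>n k(\<phi>) = \<gamma> - div k\<close>: this transport equation has smooth
  local solutions, and two solutions differ by a function constant along \<open>K\<close>.\<close>

section \<open>Calculus of smooth maps\<close>

text \<open>The number n is a balance: under rescaling, \<open>div k\<close> gains (n + 2) k(\<phi>)
  and \<gamma> gains 2 k(\<phi>). For a section f k the derivative k(f) enters both terms alike and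
  cancels; no division by f occurs, so sections with zeros are covered as well. The normalisation is
  a condition in each fibre with exactly one solution, so the resulting \<open>k\<close> exists in
  all charts at once and the transport equation has to be solved in one chart only.

  The analytic obstacle is that the integral curves must depend smoothly on their starting point.
  They are reparametrised to the fixed unit interval, with the travel time as a factor in the
  integral equation, and become fixed points of a contraction in the Banach space of bounded
  continuous curves. Lipschitz dependence comes from the contraction, differentiability from
  inverting the linearised equation. The derivative again solves a linear fixed point equation,
  whose coefficients are as regular as the curves themselves, so a bootstrap reaches every
  order.\<close>

lemma Ck_on_imp_continuous_on: "Ck_on k S f \<Longrightarrow> continuous_on S f"
  by (cases k) (auto simp: differentiable_on_def intro!: differentiable_imp_continuous_on
      differentiable_at_imp_differentiable_on)

lemma Ck_on_SucD: "Ck_on (Suc k) S f \<Longrightarrow> Ck_on k S f"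
proof (induction k arbitrary: f)
  case 0
  then show ?case by (simp add: Ck_on_imp_continuous_on del: Ck_on.simps(2))
next
  case (Suc k)
  then show ?case by (subst Ck_on.simps(2)) (metis Ck_on.simps(2))
qed

lemma Ck_on_subset: "Ck_on k S f \<Longrightarrow> T \<subseteq> S \<Longrightarrow> Ck_on k T f"
  by (induction k arbitrary: f) (auto intro: continuous_on_subset)

text \<open>Derivatives are taken \<open>at x\<close> and not within \<open>S\<close>, so apart from
  continuity every clause of \<open>Ck_on\<close> is already pointwise; open neighbourhoods settle
  continuity.\<close>

lemma Ck_on_local:
  assumes "\<And>x. x \<in> S \<Longrightarrow> \<exists>T. open T \<and> x \<in> T \<and> Ck_on k T f"
  shows "Ck_on k S f"
  using assms
proof (induction k arbitrary: f)
  case 0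
  then show ?case
    by (simp add: continuous_on_eq_continuous_within)
      (metis continuous_at_imp_continuous_at_within continuous_on_eq_continuous_at
        continuous_on_eq_continuous_within)
next
  case (Suc k)
  show ?case
  proof (subst Ck_on.simps(2), intro conjI ballI allI)
    show "f differentiable at x" if "x \<in> S" for x
      using Suc.prems[OF that] by auto
    show "Ck_on k S (\<lambda>x. frechet_derivative f (at x) v)" for v
      using Suc.prems by (intro Suc.IH) (metis Ck_on.simps(2))
  qed
qed

lemma has_derivative_Ck_on:
  "Ck_on (Suc k) S f \<Longrightarrow> x \<in> S \<Longrightarrow> (f has_derivative frechet_derivative f (at x)) (at x)"
  by (simp add: frechet_derivative_works[symmetric])

lemma Ck_on_cong:
  assumes "open S" "\<And>x. x \<in> S \<Longrightarrow> f x = g x" "Ck_on k S f"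
  shows "Ck_on k S g"
  using assms(2,3)
proof (induction k arbitrary: f g)
  case 0
  then show ?case using continuous_on_cong by (metis Ck_on.simps(1))
next
  case (Suc k)
  have *: "(g has_derivative frechet_derivative f (at x)) (at x)" if "x \<in> S" for x
    using has_derivative_transform_within_open[OF has_derivative_Ck_on[OF Suc.prems(2) that] \<open>open S\<close> that]
      Suc.prems(1) by blast
  show ?case
  proof (subst Ck_on.simps(2), intro conjI ballI allI)
    show "g differentiable at x" if "x \<in> S" for x
      using *[OF that] differentiableI by blast
    show "Ck_on k S (\<lambda>x. frechet_derivative g (at x) v)" for v
    proof (rule Suc.IH)
      show "frechet_derivative f (at x) v = frechet_derivative g (at x) v" if "x \<in> S" for x
        using frechet_derivative_at[OF *[OF that]] by simp
    qed (use Suc.prems in auto)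
  qed
qed

lemma Ck_on_SucI:
  assumes "open S" "\<And>x. x \<in> S \<Longrightarrow> (f has_derivative f' x) (at x)"
    "\<And>v. Ck_on k S (\<lambda>x. f' x v)"
  shows "Ck_on (Suc k) S f"
proof (subst Ck_on.simps(2), intro conjI ballI allI)
  show "f differentiable at x" if "x \<in> S" for x
    using assms(2)[OF that] differentiableI by blast
  show "Ck_on k S (\<lambda>x. frechet_derivative f (at x) v)" for v
    by (rule Ck_on_cong[OF assms(1) _ assms(3)[of v]])
      (simp add: frechet_derivative_at[OF assms(2)])
qed

lemma Ck_on_const: "open S \<Longrightarrow> Ck_on k S (\<lambda>x. c)"
  by (induction k arbitrary: c) auto

lemma Ck_on_bounded_linear:
  assumes "bounded_linear h" "open S" "Ck_on k S f"
  shows "Ck_on k S (\<lambda>x. h (f x))"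
  using assms(3)
proof (induction k arbitrary: f)
  case 0
  then show ?case using bounded_linear.continuous_on[OF assms(1)] by simp
next
  case (Suc k)
  show ?case
  proof (rule Ck_on_SucI[OF \<open>open S\<close>])
    show "((\<lambda>x. h (f x)) has_derivative (\<lambda>v. h (frechet_derivative f (at x) v))) (at x)"
      if "x \<in> S" for x
      by (rule bounded_linear.has_derivative[OF assms(1) has_derivative_Ck_on[OF Suc.prems that]])
  qed (use Suc in auto)
qed

lemma Ck_on_add:
  assumes "open S" "Ck_on k S f" "Ck_on k S g"
  shows "Ck_on k S (\<lambda>x. f x + g x)"
  using assms(2,3)
proof (induction k arbitrary: f g)
  case 0
  then show ?case by (simp add: continuous_on_add)
next
  case (Suc k)
  show ?case
  proof (rule Ck_on_SucI[OF \<open>open S\<close>])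
    show "((\<lambda>x. f x + g x) has_derivative
        (\<lambda>v. frechet_derivative f (at x) v + frechet_derivative g (at x) v)) (at x)"
      if "x \<in> S" for x
      by (intro has_derivative_add has_derivative_Ck_on[OF _ that]) (use Suc.prems in auto)
  qed (use Suc in auto)
qed

lemma Ck_on_sum:
  assumes "open S" "\<And>i. i \<in> I \<Longrightarrow> Ck_on k S (f i)"
  shows "Ck_on k S (\<lambda>x. \<Sum>i\<in>I. f i x)"
  using assms(2)
  by (induction I rule: infinite_finite_induct) (auto intro!: Ck_on_add Ck_on_const assms(1))

lemma Ck_on_bounded_bilinear:
  assumes "bounded_bilinear B" "open S" "Ck_on k S f" "Ck_on k S g"
  shows "Ck_on k S (\<lambda>x. B (f x) (g x))"
  using assms(3,4)
proof (induction k arbitrary: f g)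
  case 0
  then show ?case using bounded_bilinear.continuous_on[OF assms(1)] by simp
next
  case (Suc k)
  note Ck = Suc.prems[THEN Ck_on_SucD]
  show ?case
  proof (rule Ck_on_SucI[OF \<open>open S\<close>])
    show "((\<lambda>x. B (f x) (g x)) has_derivative
        (\<lambda>v. B (f x) (frechet_derivative g (at x) v) + B (frechet_derivative f (at x) v) (g x))) (at x)"
      if "x \<in> S" for x
      by (intro bounded_bilinear.FDERIV[OF assms(1)] has_derivative_Ck_on[OF _ that])
        (use Suc.prems in auto)
    show "Ck_on k S (\<lambda>x. B (f x) (frechet_derivative g (at x) v) + B (frechet_derivative f (at x) v) (g x))"
      for v
      using Suc by (intro Ck_on_add[OF \<open>open S\<close>] Suc.IH Ck) auto
  qed
qed

lemma Ck_on_prod: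
  fixes f :: "'i \<Rightarrow> 'x::real_normed_vector \<Rightarrow> real"
  assumes "open S" "\<And>i. i \<in> I \<Longrightarrow> Ck_on k S (f i)"
  shows "Ck_on k S (\<lambda>x. \<Prod>i\<in>I. f i x)"
  using assms(2)
  by (induction I rule: infinite_finite_induct)
    (auto intro!: Ck_on_bounded_bilinear[OF bounded_bilinear_mult] Ck_on_const assms(1))

text \<open>The derivative of \<open>1 / f\<close> is a product of \<open>1 / f\<close> twice and
  the derivative of \<open>f\<close>, so class C^k of \<open>1 / f\<close> already yields class
  C^(k+1). Hence the induction keeps \<open>f\<close> fixed.\<close>

lemma Ck_on_inverse:
  fixes f :: "'x::real_normed_vector \<Rightarrow> real"
  assumes "open S" "Ck_on k S f" "\<And>x. x \<in> S \<Longrightarrow> f x \<noteq> 0"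
  shows "Ck_on k S (\<lambda>x. inverse (f x))"
  using assms(2)
proof (induction k)
  case 0
  then show ?case using assms(3) by (auto intro!: continuous_on_inverse)
next
  case (Suc k)
  note inv = Suc.IH[OF Ck_on_SucD[OF Suc.prems]]
  show ?case
  proof (rule Ck_on_SucI[OF \<open>open S\<close>])
    show "((\<lambda>x. inverse (f x)) has_derivative
        (\<lambda>v. - (inverse (f x) * frechet_derivative f (at x) v * inverse (f x)))) (at x)"
      if "x \<in> S" for x
      by (intro Deriv.has_derivative_inverse has_derivative_Ck_on[OF _ that])
        (use Suc.prems assms(3) that in auto)
    show "Ck_on k S (\<lambda>x. - (inverse (f x) * frechet_derivative f (at x) v * inverse (f x)))" for v
      using Suc.prems
      by (intro Ck_on_bounded_linear[OF bounded_linear_minus[OF bounded_linear_ident] \<open>open S\<close>]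
          Ck_on_bounded_bilinear[OF bounded_bilinear_mult \<open>open S\<close>] inv) auto
  qed
qed

lemma Ck_on_ident: "open S \<Longrightarrow> Ck_on k S (\<lambda>x. x)"
  by (cases k) (auto intro: Ck_on_SucI[where f' = "\<lambda>_ v. v"] Ck_on_const)

lemma linear_eq_sum_Basis:
  fixes f :: "'x::euclidean_space \<Rightarrow> 'y::real_vector"
  assumes "linear f"
  shows "f w = (\<Sum>b\<in>Basis. (w \<bullet> b) *\<^sub>R f b)"
proof -
  have "f (\<Sum>b\<in>Basis. (w \<bullet> b) *\<^sub>R b) = (\<Sum>b\<in>Basis. (w \<bullet> b) *\<^sub>R f b)"
    using assms by (simp only: linear_sum linear_scale)
  then show ?thesis unfolding euclidean_representation .
qed

text \<open>By the chain rule the derivative is a finite sum of components of the derivative of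
  \<open>g\<close> times partial derivatives of \<open>f\<close> composed with \<open>g\<close>. The
  expansion in \<open>Basis\<close> restores the shape of a composition with the same
  \<open>g\<close>, so the induction varies \<open>f\<close> only.\<close>

lemma Ck_on_compose:
  fixes f :: "'y::euclidean_space \<Rightarrow> 'z::real_normed_vector"
  assumes "open S" "Ck_on k T f" "Ck_on k S g" "g ` S \<subseteq> T"
  shows "Ck_on k S (\<lambda>x. f (g x))"
  using assms(2,3)
proof (induction k arbitrary: f)
  case 0
  then show ?case using assms(4) by (auto intro: continuous_on_compose2)
next
  case (Suc k)
  have d: "((\<lambda>x. f (g x)) has_derivative
      (\<lambda>v. frechet_derivative f (at (g x)) (frechet_derivative g (at x) v))) (at x)"
    if "x \<in> S" for x
    using diff_chain_at[OF has_derivative_Ck_on[OF Suc.prems(2) that]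
        has_derivative_Ck_on[OF Suc.prems(1), of "g x"]] that assms(4)
    by (auto simp: o_def)
  have eq: "frechet_derivative f (at (g x)) w
      = (\<Sum>b\<in>Basis. (w \<bullet> b) *\<^sub>R frechet_derivative f (at (g x)) b)" if "x \<in> S" for x w
    using Suc.prems(1) that assms(4) by (intro linear_eq_sum_Basis linear_frechet_derivative) auto
  show ?case
  proof (rule Ck_on_SucI[OF \<open>open S\<close>])
    show "((\<lambda>x. f (g x)) has_derivative (\<lambda>v. \<Sum>b\<in>Basis. (frechet_derivative g (at x) v \<bullet> b) *\<^sub>R
        frechet_derivative f (at (g x)) b)) (at x)" if "x \<in> S" for x
      using d[OF that] by (simp only: eq[OF that, symmetric])
    show "Ck_on k S (\<lambda>x. \<Sum>b\<in>Basis. (frechet_derivative g (at x) v \<bullet> b) *\<^sub>R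
        frechet_derivative f (at (g x)) b)" for v
      using Suc.prems Ck_on_SucD[OF Suc.prems(2)]
      by (intro Ck_on_sum Ck_on_bounded_bilinear[OF bounded_bilinear_scaleR]
          Ck_on_bounded_linear[OF bounded_linear_inner_left] Suc.IH \<open>open S\<close>) auto
  qed
qed

section \<open>Maps that are differentiable to all orders\<close>

lemma smooth_on_subset: "smooth_on S f \<Longrightarrow> T \<subseteq> S \<Longrightarrow> smooth_on T f"
  by (auto simp: smooth_on_def intro: Ck_on_subset)

lemma smooth_on_cong:
  "open S \<Longrightarrow> smooth_on S f \<Longrightarrow> (\<And>x. x \<in> S \<Longrightarrow> f x = g x) \<Longrightarrow> smooth_on S g"
  by (auto simp: smooth_on_def intro: Ck_on_cong)

lemma smooth_on_local:
  "(\<And>x. x \<in> S \<Longrightarrow> \<exists>T. open T \<and> x \<in> T \<and> smooth_on T f) \<Longrightarrow> smooth_on S f"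
  unfolding smooth_on_def by (intro allI Ck_on_local) blast

lemma smooth_on_const: "open S \<Longrightarrow> smooth_on S (\<lambda>x. c)"
  by (auto simp: smooth_on_def Ck_on_const)

lemma smooth_on_ident: "open S \<Longrightarrow> smooth_on S (\<lambda>x. x)"
  by (auto simp: smooth_on_def Ck_on_ident)

lemma smooth_on_bounded_linear:
  "bounded_linear h \<Longrightarrow> open S \<Longrightarrow> smooth_on S f \<Longrightarrow> smooth_on S (\<lambda>x. h (f x))"
  by (auto simp: smooth_on_def Ck_on_bounded_linear)

lemma smooth_on_bounded_bilinear:
  "bounded_bilinear B \<Longrightarrow> open S \<Longrightarrow> smooth_on S f \<Longrightarrow> smooth_on S g \<Longrightarrow>
    smooth_on S (\<lambda>x. B (f x) (g x))"
  by (auto simp: smooth_on_def Ck_on_bounded_bilinear)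

lemma smooth_on_add:
  "open S \<Longrightarrow> smooth_on S f \<Longrightarrow> smooth_on S g \<Longrightarrow> smooth_on S (\<lambda>x. f x + g x)"
  by (auto simp: smooth_on_def Ck_on_add)

lemma smooth_on_sum:
  "open S \<Longrightarrow> (\<And>i. i \<in> I \<Longrightarrow> smooth_on S (f i)) \<Longrightarrow> smooth_on S (\<lambda>x. \<Sum>i\<in>I. f i x)"
  by (auto simp: smooth_on_def Ck_on_sum)

lemma smooth_on_minus: "open S \<Longrightarrow> smooth_on S f \<Longrightarrow> smooth_on S (\<lambda>x. - f x)"
  using smooth_on_bounded_linear[OF bounded_linear_minus[OF bounded_linear_ident]] .

lemma smooth_on_diff:
  "open S \<Longrightarrow> smooth_on S f \<Longrightarrow> smooth_on S g \<Longrightarrow> smooth_on S (\<lambda>x. f x - g x)"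
  using smooth_on_add[of S f "\<lambda>x. - g x"] smooth_on_minus[of S g] by simp

lemma smooth_on_prod:
  fixes f :: "'i \<Rightarrow> 'x::real_normed_vector \<Rightarrow> real"
  shows "open S \<Longrightarrow> (\<And>i. i \<in> I \<Longrightarrow> smooth_on S (f i)) \<Longrightarrow> smooth_on S (\<lambda>x. \<Prod>i\<in>I. f i x)"
  by (auto simp: smooth_on_def Ck_on_prod)

lemma smooth_on_inverse:
  fixes f :: "'x::real_normed_vector \<Rightarrow> real"
  shows "open S \<Longrightarrow> smooth_on S f \<Longrightarrow> (\<And>x. x \<in> S \<Longrightarrow> f x \<noteq> 0) \<Longrightarrow> smooth_on S (\<lambda>x. inverse (f x))"
  by (auto simp: smooth_on_def Ck_on_inverse)

lemma smooth_on_compose: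
  fixes f :: "'y::euclidean_space \<Rightarrow> 'z::real_normed_vector"
  shows "open S \<Longrightarrow> smooth_on T f \<Longrightarrow> smooth_on S g \<Longrightarrow> g ` S \<subseteq> T \<Longrightarrow> smooth_on S (\<lambda>x. f (g x))"
  unfolding smooth_on_def using Ck_on_compose by blast

lemmas smooth_on_mult = smooth_on_bounded_bilinear[OF bounded_bilinear_mult]
  and smooth_on_scaleR = smooth_on_bounded_bilinear[OF bounded_bilinear_scaleR]

lemma smooth_on_imp_differentiable: "smooth_on S f \<Longrightarrow> x \<in> S \<Longrightarrow> f differentiable at x"
  unfolding smooth_on_def by (metis Ck_on.simps(2))

lemma has_derivative_smooth_on:
  "smooth_on S f \<Longrightarrow> x \<in> S \<Longrightarrow> (f has_derivative frechet_derivative f (at x)) (at x)"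
  using smooth_on_imp_differentiable frechet_derivative_works by blast

lemma smooth_on_frechet_derivative:
  "smooth_on S f \<Longrightarrow> smooth_on S (\<lambda>x. frechet_derivative f (at x) v)"
  unfolding smooth_on_def by (metis Ck_on.simps(2))

lemma smooth_on_imp_continuous_on: "smooth_on S f \<Longrightarrow> continuous_on S f"
  unfolding smooth_on_def using Ck_on_imp_continuous_on by blast

lemma smooth_on_exp:
  assumes "open S" "smooth_on S f"
  shows "smooth_on S (\<lambda>x. exp (f x :: real))"
proof -
  have "Ck_on k UNIV (exp :: real \<Rightarrow> real)" for k
  proof (induction k)
    case (Suc k)
    have "Ck_on k UNIV (\<lambda>x::real. exp x * v)" for v
      using Suc by (intro Ck_on_bounded_bilinear[OF bounded_bilinear_mult] Ck_on_const) auto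
    then show ?case
      by (intro Ck_on_SucI[where f' = "\<lambda>x v. exp x * v"])
        (auto intro!: derivative_eq_intros DERIV_exp[THEN has_field_derivative_imp_has_derivative])
  qed (auto intro: continuous_intros)
  then have "smooth_on UNIV (exp :: real \<Rightarrow> real)" by (simp add: smooth_on_def)
  then show ?thesis using assms smooth_on_compose[of S UNIV exp f] by auto
qed

lemma smooth_on_vec_lambda:
  fixes f :: "'i::finite \<Rightarrow> 'x::real_normed_vector \<Rightarrow> 'y::real_normed_vector"
  assumes "open S" "\<And>i. smooth_on S (f i)"
  shows "smooth_on S (\<lambda>x. \<chi> i. f i x)"
proof -
  have ax: "bounded_linear (\<lambda>y::'y. axis i y)" for i :: 'i
  proof
    show "\<exists>K. \<forall>x::'y. norm (axis i x) \<le> norm x * K"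
    proof (intro exI allI)
      show "norm (axis i x) \<le> norm x * 1" for x :: 'y
        unfolding norm_vec_def
        by (rule order_trans[OF L2_set_le_sum]) (auto simp: axis_def if_distrib[of norm] cong: if_cong)
    qed
  qed (auto simp: axis_def vec_eq_iff)
  have "(\<lambda>x. \<chi> i. f i x) = (\<lambda>x. \<Sum>i\<in>UNIV. axis i (f i x))"
    by (auto simp: vec_eq_iff axis_def fun_eq_iff)
  then show ?thesis
    using assms by (simp add: smooth_on_sum smooth_on_bounded_linear[OF ax])
qed

text \<open>A product rule for a merely continuous \<open>g\<close>: the term with the derivative of
  \<open>g\<close> would carry the factor \<open>f x = 0\<close>. It serves to derive
  differentiability of a solution from its continuity alone.\<close>

lemma has_derivative_bilinear_vanishing:
  assumes B: "bounded_bilinear B" and f: "(f has_derivative f') (at x)" "f x = 0"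
    and g: "isCont g x"
  shows "((\<lambda>y. B (f y) (g y)) has_derivative (\<lambda>v. B (f' v) (g x))) (at x)"
proof -
  interpret B: bounded_bilinear B by fact
  have f'[simp]: "f' 0 = 0"
    using has_derivative_bounded_linear[OF f(1)] by (simp add: linear_simps)
  have 1: "((\<lambda>y. B (f y) (g x)) has_derivative (\<lambda>v. B (f' v) (g x))) (at x)"
    by (rule bounded_linear.has_derivative[OF B.bounded_linear_left f(1)])
  obtain K where K: "K \<ge> 0" "\<And>a b. norm (B a b) \<le> norm a * norm b * K"
    using B.nonneg_bounded by blast
  obtain L where L: "L > 0" "\<And>v. norm (f' v) \<le> norm v * L"
    using bounded_linear.pos_bounded[OF has_derivative_bounded_linear[OF f(1)]] by blast
  \<comment> \<open>After splitting \<open>g y\<close> into \<open>g x\<close> and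
    \<open>g y - g x\<close>, the remainder is of order \<open>norm (y - x)\<close> times a quantity
    that tends to 0.\<close>
  have 2: "((\<lambda>y. B (f y) (g y - g x)) has_derivative (\<lambda>v. 0)) (at x)"
    unfolding has_derivative_at_alt
  proof (intro conjI allI impI)
    fix e :: real assume "e > 0"
    \<comment> \<open>Chosen for \<open>(L + 1) * d * K \<le> e\<close>, where \<open>L + 1\<close>
      will bound the growth of \<open>f\<close> near \<open>x\<close>; the summand 1 keeps the
      denominator positive for \<open>K = 0\<close>.\<close>
    define d where "d = e / ((L + 1) * K + 1)"
    have "(L + 1) * K + 1 > 0" using K L by (simp add: add_nonneg_pos)
    then have d: "d > 0" "(L + 1) * d * K \<le> e"
      using \<open>e > 0\<close> K L by (auto simp: d_def field_simps)
    have "\<forall>\<^sub>F y in at x. dist (g y) (g x) < d"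
      using g[unfolded isCont_def] d(1) by (rule tendstoD)
    then obtain d1 where d1: "d1 > 0" "\<And>y. norm (y - x) < d1 \<Longrightarrow> norm (g y - g x) \<le> d"
      unfolding eventually_at using d(1) by (force simp: dist_norm)
    obtain d2 where d2: "d2 > 0" "\<And>y. norm (y - x) < d2 \<Longrightarrow> norm (f y - f x - f' (y - x)) \<le> 1 * norm (y - x)"
      using f(1) unfolding has_derivative_at_alt by (metis zero_less_one)
    show "\<exists>d>0. \<forall>y. norm (y - x) < d \<longrightarrow>
        norm (B (f y) (g y - g x) - B (f x) (g x - g x) - 0) \<le> e * norm (y - x)"
    proof (intro exI conjI allI impI)
      show "min d1 d2 > 0" using d1 d2 by simp
      fix y assume y: "norm (y - x) < min d1 d2"
      have "norm (f y) \<le> norm (f y - f x - f' (y - x)) + norm (f' (y - x))"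
        using norm_triangle_sub[of "f y" "f' (y - x)"] f(2) by simp
      also have "\<dots> \<le> (L + 1) * norm (y - x)"
        using d2(2)[of y] L(2)[of "y - x"] y by (simp add: algebra_simps)
      finally have "norm (f y) * norm (g y - g x) * K \<le> ((L + 1) * norm (y - x)) * d * K"
        using d1(2)[of y] y K d L by (intro mult_right_mono mult_mono) auto
      also have "\<dots> = ((L + 1) * d * K) * norm (y - x)" by simp
      also have "\<dots> \<le> e * norm (y - x)"
        using d(2) by (rule mult_right_mono) simp
      finally show "norm (B (f y) (g y - g x) - B (f x) (g x - g x) - 0) \<le> e * norm (y - x)"
        using K(2)[of "f y" "g y - g x"] by (simp add: B.zero_right)
    qed
  qed simp
  show ?thesis
    using has_derivative_add[OF 1 2] by (simp add: B.diff_right)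
qed

text \<open>Being small compared with the distance survives composition with a map that satisfies a
  Lipschitz estimate at \<open>x\<close>. It is meant for the remainder of a linearisation,
  evaluated along a family of curves not yet known to be differentiable.\<close>

lemma has_derivative_zero_compose:
  assumes h: "(h has_derivative (\<lambda>_. 0)) (at (f x) within T)"
    and f: "open S" "x \<in> S" "\<And>y. y \<in> S \<Longrightarrow> f y \<in> T" "\<And>y. y \<in> S \<Longrightarrow> norm (f y - f x) \<le> C * norm (y - x)"
  shows "((\<lambda>y. h (f y)) has_derivative (\<lambda>_. 0)) (at x)"
  unfolding has_derivative_at_alt
proof (intro conjI allI impI)
  fix e :: real assume "e > 0"
  define D where "D = max C 0 + 1"
  have D: "D > 0" "C \<le> D" by (auto simp: D_def)
  have fD: "norm (f y - f x) \<le> D * norm (y - x)" if "y \<in> S" for y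
    using f(4)[OF that] D(2) by (meson mult_right_mono norm_ge_zero order_trans)
  obtain d where d: "d > 0" "\<And>z. z \<in> T \<Longrightarrow> norm (z - f x) < d \<Longrightarrow>
      norm (h z - h (f x)) \<le> (e / D) * norm (z - f x)"
    using h \<open>e > 0\<close> D unfolding has_derivative_within_alt by (auto dest!: spec[of _ "e / D"])
  obtain d1 where d1: "d1 > 0" "ball x d1 \<subseteq> S" using f(1,2) open_contains_ball by blast
  show "\<exists>d>0. \<forall>y. norm (y - x) < d \<longrightarrow> norm (h (f y) - h (f x) - 0) \<le> e * norm (y - x)"
  proof (intro exI conjI allI impI)
    show "min d1 (d / D) > 0" using d1 d D by simp
    fix y assume y: "norm (y - x) < min d1 (d / D)"
    then have "y \<in> S" using d1 by (auto simp: dist_norm norm_minus_commute)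
    note fy = fD[OF this]
    also have "D * norm (y - x) < d" using y D by (simp add: field_simps)
    finally have "norm (h (f y) - h (f x)) \<le> (e / D) * norm (f y - f x)"
      using d(2) f(3) \<open>y \<in> S\<close> by blast
    also have "\<dots> \<le> (e / D) * (D * norm (y - x))"
      using fy \<open>e > 0\<close> D by (intro mult_left_mono) auto
    finally show "norm (h (f y) - h (f x) - 0) \<le> e * norm (y - x)" using D by simp
  qed
qed simp

section \<open>Linear transport equations\<close>

text \<open>\<open>Sol\<close> is the inverse of the identity minus \<open>L\<close>, obtained from
  the contraction principle; the bound 2 is \<open>1 / (1 - 1/2)\<close>. Its linearity follows from
  uniqueness of the fixed point.\<close>

lemma linear_fixpoint_solution:
  fixes L :: "'e::{real_normed_vector,complete_space} \<Rightarrow> 'e"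
  assumes "linear L" and half: "\<And>e. norm (L e) \<le> norm e / 2"
  obtains Sol where "bounded_linear Sol" "\<And>b z. z = b + L z \<longleftrightarrow> z = Sol b"
    "\<And>b. norm (Sol b) \<le> 2 * norm b"
proof -
  interpret linear L by fact
  have ex: "\<exists>!z. b + L z = z" for b
  proof (rule banach_fix_type[where c = "1/2"])
    show "\<forall>x y. dist (b + L x) (b + L y) \<le> 1/2 * dist x y"
      using half by (auto simp: dist_norm diff[symmetric])
  qed auto
  define Sol where "Sol b = (THE z. b + L z = z)" for b
  have Sol: "z = b + L z \<longleftrightarrow> z = Sol b" for b z
    using theI'[OF ex[of b]] ex[of b] unfolding Sol_def by metis
  then have SolE: "Sol b = b + L (Sol b)" for b by blast
  have le: "norm (Sol b) \<le> 2 * norm b" for b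
    using norm_triangle_ineq[of b "L (Sol b)"] half[of "Sol b"] SolE[of b] by simp
  have "bounded_linear Sol"
  proof (rule bounded_linear_intro)
    show "Sol (x + y) = Sol x + Sol y" for x y
    proof -
      have "Sol x + Sol y = (x + L (Sol x)) + (y + L (Sol y))"
        by (rule arg_cong2[where f = "(+)"]; rule SolE)
      also have "\<dots> = (x + y) + L (Sol x + Sol y)"
        by (simp only: add ac_simps)
      finally have "Sol x + Sol y = (x + y) + L (Sol x + Sol y)" .
      then show ?thesis using Sol by metis
    qed
    show "Sol (r *\<^sub>R x) = r *\<^sub>R Sol x" for r x
    proof -
      have "r *\<^sub>R Sol x = r *\<^sub>R (x + L (Sol x))" by (rule arg_cong[OF SolE])
      also have "\<dots> = r *\<^sub>R x + L (r *\<^sub>R Sol x)" by (simp only: scale scaleR_add_right)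
      finally have "r *\<^sub>R Sol x = r *\<^sub>R x + L (r *\<^sub>R Sol x)" .
      then show ?thesis using Sol by metis
    qed
    show "norm (Sol x) \<le> norm x * 2" for x using le[of x] by simp
  qed
  with Sol le that show ?thesis by blast
qed

text \<open>Writing the equation at \<open>y\<close> as \<open>w y = Sol\<^sub>x (b y + \<Sum>i. T\<^sub>i (a\<^sub>i y - a\<^sub>i x) (w y))\<close>, with the
  solution operator at \<open>x\<close>, gives continuity and differentiability of \<open>w\<close> at \<open>x\<close>; the derivative
  solves an equation of the same form.\<close>

lemma Ck_on_linear_fixpoint:
  fixes T :: "'i \<Rightarrow> 'a::real_normed_vector \<Rightarrow> 'e::{real_normed_vector,complete_space} \<Rightarrow> 'e"
    and w :: "'x::real_normed_vector \<Rightarrow> 'e"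
  assumes T: "\<And>i. bounded_bilinear (T i)" and "open S"
    and half: "\<And>x e. x \<in> S \<Longrightarrow> norm (\<Sum>i\<in>I. T i (a i x) e) \<le> norm e / 2"
    and eq: "\<And>x. x \<in> S \<Longrightarrow> w x = b x + (\<Sum>i\<in>I. T i (a i x) (w x))"
    and a: "\<And>i. i \<in> I \<Longrightarrow> Ck_on k S (a i)" and b: "Ck_on k S b"
  shows "Ck_on k S w"
  using eq a b
proof (induction k arbitrary: w b)
  case (0 w b)
  have "(w \<longlongrightarrow> w x) (at x)" if x: "x \<in> S" for x
  proof -
    \<comment> \<open>The factor 2 arises because \<open>w y - w x\<close> occurs on the right as
      well, with norm at most one half, and is absorbed.\<close>
    define h where "h y = 2 * norm ((b y - b x) + (\<Sum>i\<in>I. T i (a i y - a i x) (w x)))" for y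
    have [simp]: "T i 0 e = 0" for i e using T[of i] by (rule bounded_bilinear.zero_left)
    have "(b \<longlongrightarrow> b x) (at x)" and at: "\<And>i. i \<in> I \<Longrightarrow> (a i \<longlongrightarrow> a i x) (at x)"
      using 0(2,3) x \<open>open S\<close> by (auto simp: continuous_on_eq_continuous_at isCont_def)
    then have "(h \<longlongrightarrow> 2 * norm ((b x - b x) + (\<Sum>i\<in>I. T i (a i x - a i x) (w x)))) (at x)"
      unfolding h_def by (intro tendsto_intros bounded_bilinear.tendsto[OF T]) auto
    then have h0: "(h \<longlongrightarrow> 0) (at x)" by simp
    have "norm (w y - w x) \<le> h y" if y: "y \<in> S" for y
    proof -
      have "w y - w x = ((b y - b x) + (\<Sum>i\<in>I. T i (a i y - a i x) (w x)))
          + (\<Sum>i\<in>I. T i (a i y) (w y - w x))"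
      proof -
        have "w y - w x = (b y + (\<Sum>i\<in>I. T i (a i y) (w y))) - (b x + (\<Sum>i\<in>I. T i (a i x) (w x)))"
          by (rule arg_cong2[where f = "(-)"]; rule 0(1)[OF y] 0(1)[OF x])
        also have "\<dots> = ((b y - b x) + (\<Sum>i\<in>I. T i (a i y - a i x) (w x)))
          + (\<Sum>i\<in>I. T i (a i y) (w y - w x))"
          by (simp add: bounded_bilinear.diff_left[OF T] bounded_bilinear.diff_right[OF T] sum_subtractf)
        finally show ?thesis .
      qed
      then show ?thesis unfolding h_def
        using half[OF y, of "w y - w x"]
          norm_triangle_ineq[of "(b y - b x) + (\<Sum>i\<in>I. T i (a i y - a i x) (w x))"
            "\<Sum>i\<in>I. T i (a i y) (w y - w x)"]
        by simp
    qed
    then have "\<forall>\<^sub>F y in at x. norm (w y - w x) \<le> h y"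
      using eventually_at_in_open[OF \<open>open S\<close> x] by (auto elim: eventually_mono)
    then have "((\<lambda>y. w y - w x) \<longlongrightarrow> 0) (at x)"
      using h0 by (rule Lim_null_comparison)
    then show ?thesis using LIM_zero_iff by blast
  qed
  then show ?case using \<open>open S\<close> by (simp add: continuous_on_eq_continuous_at isCont_def)
next
  case (Suc k w b)
  \<comment> \<open>The equation for the derivative has \<open>w\<close> in its inhomogeneous term,
    so class C^k of \<open>w\<close> itself must come first.\<close>
  have wk: "Ck_on k S w"
    using Suc.prems by (intro Suc.IH[OF Suc.prems(1)]) (auto intro: Ck_on_SucD)
  have ex: "\<exists>w'. (w has_derivative w') (at x) \<and> (\<forall>v. w' v =
      (frechet_derivative b (at x) v + (\<Sum>i\<in>I. T i (frechet_derivative (a i) (at x) v) (w x)))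
        + (\<Sum>i\<in>I. T i (a i x) (w' v)))" if x: "x \<in> S" for x
  proof -
    have "linear (\<lambda>e. \<Sum>i\<in>I. T i (a i x) e)"
      by (intro linear_compose_sum ballI bounded_linear.linear bounded_bilinear.bounded_linear_right T)
    then obtain Sol where Sol: "bounded_linear Sol"
        "\<And>b z. z = b + (\<Sum>i\<in>I. T i (a i x) z) \<longleftrightarrow> z = Sol b" "\<And>b. norm (Sol b) \<le> 2 * norm b"
      using linear_fixpoint_solution[OF _ half[OF x]] by blast
    define w' where "w' v = Sol (frechet_derivative b (at x) v
        + (\<Sum>i\<in>I. T i (frechet_derivative (a i) (at x) v) (w x)))" for v
    have wS: "w y = Sol (b y + (\<Sum>i\<in>I. T i (a i y - a i x) (w y)))" if y: "y \<in> S" for y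
    proof -
      have "w y = (b y + (\<Sum>i\<in>I. T i (a i y - a i x) (w y))) + (\<Sum>i\<in>I. T i (a i x) (w y))"
        by (rule trans[OF Suc.prems(1)[OF y]])
          (simp add: bounded_bilinear.diff_left[OF T] sum_subtractf)
      then show ?thesis using Sol(2) by blast
    qed
    have "isCont w x"
      using Ck_on_imp_continuous_on[OF wk] \<open>open S\<close> x by (simp add: continuous_on_eq_continuous_at)
    \<comment> \<open>These coefficient differences vanish at \<open>x\<close>, so the product rule
      below works with \<open>w\<close> merely continuous.\<close>
    have da: "((\<lambda>y. a i y - a i x) has_derivative frechet_derivative (a i) (at x)) (at x)" if "i \<in> I" for i
      using has_derivative_diff[OF has_derivative_Ck_on[OF Suc.prems(2)[OF that] x] has_derivative_const]
      by simp
    have "((\<lambda>y. Sol (b y + (\<Sum>i\<in>I. T i (a i y - a i x) (w y)))) has_derivative w') (at x)"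
      unfolding w'_def
      by (intro bounded_linear.has_derivative[OF Sol(1)] has_derivative_add has_derivative_sum
          has_derivative_Ck_on[OF Suc.prems(3) x] has_derivative_bilinear_vanishing[OF T da]
          \<open>isCont w x\<close>) auto
    then have "(w has_derivative w') (at x)"
      by (rule has_derivative_transform_within_open[OF _ \<open>open S\<close> x]) (metis wS)
    moreover have "w' v = (frechet_derivative b (at x) v
        + (\<Sum>i\<in>I. T i (frechet_derivative (a i) (at x) v) (w x))) + (\<Sum>i\<in>I. T i (a i x) (w' v))" for v
      unfolding Sol(2) by (simp add: w'_def)
    ultimately show ?thesis by blast
  qed
  show ?case
  proof (subst Ck_on.simps(2), intro conjI ballI allI)
    show "w differentiable at x" if "x \<in> S" for x
      using ex[OF that] differentiableI by blast
    show "Ck_on k S (\<lambda>x. frechet_derivative w (at x) v)" for v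
    proof (rule Suc.IH)
      show "frechet_derivative w (at x) v = (frechet_derivative b (at x) v
          + (\<Sum>i\<in>I. T i (frechet_derivative (a i) (at x) v) (w x)))
          + (\<Sum>i\<in>I. T i (a i x) (frechet_derivative w (at x) v))" if x: "x \<in> S" for x
      proof -
        obtain w' where w': "(w has_derivative w') (at x)" "\<forall>v. w' v =
            (frechet_derivative b (at x) v + (\<Sum>i\<in>I. T i (frechet_derivative (a i) (at x) v) (w x)))
            + (\<Sum>i\<in>I. T i (a i x) (w' v))"
          using ex[OF x] by blast
        show ?thesis using w'(2) unfolding frechet_derivative_at[OF w'(1)] by blast
      qed
      show "Ck_on k S (a i)" if "i \<in> I" for i using Suc.prems(2)[OF that] by (rule Ck_on_SucD)
      show "Ck_on k S (\<lambda>x. frechet_derivative b (at x) v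
          + (\<Sum>i\<in>I. T i (frechet_derivative (a i) (at x) v) (w x)))"
        using Suc.prems by (intro Ck_on_add Ck_on_sum Ck_on_bounded_bilinear[OF T] wk \<open>open S\<close>) auto
    qed
  qed
qed

section \<open>Integration of bounded continuous curves over the unit interval\<close>

definition unit_clamp :: "real \<Rightarrow> real" where
  "unit_clamp s = max 0 (min 1 s)"

lemma unit_clamp_bounds [simp]: "0 \<le> unit_clamp s" "unit_clamp s \<le> 1"
  and unit_clamp_idem [simp]: "unit_clamp (unit_clamp s) = unit_clamp s"
  and unit_clamp_eq [simp]: "s \<in> {0..1} \<Longrightarrow> unit_clamp s = s"
  by (auto simp: unit_clamp_def)

lemma continuous_on_unit_clamp [continuous_intros]: "continuous_on S unit_clamp"
  unfolding unit_clamp_def by (intro continuous_intros)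

text \<open>The type of bounded continuous maps has all of \<open>real\<close> as domain, so a curve
  on the unit interval is continued by constants through \<open>unit_clamp\<close>. Length 1 of the
  interval gives the integration operator norm at most 1.\<close>

definition primitive :: "(real \<Rightarrow>\<^sub>C 'y::euclidean_space) \<Rightarrow> (real \<Rightarrow>\<^sub>C 'y)" where
  "primitive w = Bcontfun (\<lambda>s. integral {0..unit_clamp s} w)"

lemma norm_integral_unit_clamp:
  fixes w :: "real \<Rightarrow>\<^sub>C 'y::euclidean_space"
  shows "norm (integral {0..unit_clamp s} w) \<le> norm w"
proof -
  have "norm (integral {0..unit_clamp s} w) \<le> norm w * (unit_clamp s - 0)"
    by (rule integral_bound) (auto simp: norm_bounded)
  also have "\<dots> \<le> norm w * 1" by (rule mult_left_mono) auto
  finally show ?thesis by simp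
qed

lemma primitive_apply: "apply_bcontfun (primitive w) s = integral {0..unit_clamp s} w"
proof -
  have "continuous_on {0..1} (\<lambda>s. integral {0..s} w)"
    by (rule indefinite_integral_continuous_1) (auto intro: integrable_continuous_real)
  then have "continuous_on UNIV (\<lambda>s. integral {0..unit_clamp s} w)"
    by (rule continuous_on_compose2) (auto intro: continuous_intros)
  then have "(\<lambda>s. integral {0..unit_clamp s} w) \<in> bcontfun"
    by (rule bcontfun_normI) (rule norm_integral_unit_clamp)
  then show ?thesis unfolding primitive_def by (simp add: Bcontfun_inverse)
qed

lemma norm_primitive: "norm (primitive w) \<le> norm w"
  by (rule norm_bound) (simp add: primitive_apply norm_integral_unit_clamp)

lemma bounded_linear_primitive: "bounded_linear primitive"
proof (rule bounded_linear_intro)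
  show "primitive (x + y) = primitive x + primitive y" for x y :: "real \<Rightarrow>\<^sub>C 'a"
    by (rule bcontfun_eqI)
      (auto simp: primitive_apply intro!: integral_add integrable_continuous_real)
  show "primitive (r *\<^sub>R x) = r *\<^sub>R primitive x" for r and x :: "real \<Rightarrow>\<^sub>C 'a"
    by (rule bcontfun_eqI) (simp add: primitive_apply)
  show "norm (primitive x) \<le> norm x * 1" for x :: "real \<Rightarrow>\<^sub>C 'a" by (simp add: norm_primitive)
qed

lemma bounded_linear_apply_bcontfun: "bounded_linear (\<lambda>w. apply_bcontfun w s)"
  by (rule bounded_linear_intro[where K = 1]) (auto simp: norm_bounded)

section \<open>Superposition (Nemytskii) operators on bounded continuous curves\<close>

definition superpose :: "('x \<Rightarrow> 'y) \<Rightarrow> ('t::topological_space \<Rightarrow>\<^sub>C 'x::metric_space)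
    \<Rightarrow> ('t \<Rightarrow>\<^sub>C 'y::metric_space)" where
  "superpose H u = Bcontfun (\<lambda>s. H (apply_bcontfun u s))"

text \<open>Values in a compact \<open>B\<close> on which \<open>H\<close> is continuous make the
  composite bounded and continuous, so that \<open>Bcontfun\<close> really represents it.\<close>

lemma superpose_apply:
  fixes u :: "'t::topological_space \<Rightarrow>\<^sub>C 'x::metric_space"
  assumes "continuous_on B H" "compact B" "u \<in> PiC UNIV (\<lambda>_. B)"
  shows "apply_bcontfun (superpose H u) s = H (u s)"
proof -
  have u: "u s \<in> B" for s using mem_PiCD[OF assms(3)] by auto
  have "continuous_on UNIV (\<lambda>s. H (u s))"
    by (rule continuous_on_compose2[OF assms(1) continuous_on_apply_bcontfun]) (use u in auto)
  moreover have "bounded (range (\<lambda>s. H (u s)))"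
    by (rule bounded_subset[OF compact_imp_bounded[OF compact_continuous_image[OF assms(1,2)]]])
      (use u in auto)
  ultimately have "(\<lambda>s. H (u s)) \<in> bcontfun" by (simp add: bcontfun_def)
  then show ?thesis by (simp add: superpose_def Bcontfun_inverse)
qed

text \<open>Compactness makes \<open>H\<close> uniformly continuous on \<open>B\<close>; one modulus
  of continuity then serves all parameters at once, as the supremum distance demands.\<close>

lemma continuous_on_superpose:
  fixes H :: "'x::metric_space \<Rightarrow> 'y::metric_space"
  assumes "continuous_on B H" "compact B"
  shows "continuous_on (PiC UNIV (\<lambda>_. B)) (superpose H :: ('t::topological_space \<Rightarrow>\<^sub>C 'x) \<Rightarrow> _)"
  unfolding continuous_on_iff
proof (intro ballI allI impI)
  fix u :: "'t \<Rightarrow>\<^sub>C 'x" and e :: real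
  assume u: "u \<in> PiC UNIV (\<lambda>_. B)" and "e > 0"
  obtain d where d: "d > 0" "\<And>x y. x \<in> B \<Longrightarrow> y \<in> B \<Longrightarrow> dist y x < d \<Longrightarrow> dist (H y) (H x) < e / 2"
    using compact_uniformly_continuous[OF assms] \<open>e > 0\<close> unfolding uniformly_continuous_on_def
    by (metis half_gt_zero)
  show "\<exists>d>0. \<forall>v\<in>PiC UNIV (\<lambda>_. B). dist v u < d \<longrightarrow> dist (superpose H v) (superpose H u) < e"
  proof (intro exI conjI ballI impI)
    fix v assume v: "v \<in> PiC UNIV (\<lambda>_. B)" "dist v u < d"
    have "dist (superpose H v) (superpose H u) \<le> e / 2"
    proof (rule dist_bound)
      fix s
      have "dist (v s) (u s) < d" using v(2) by (rule dist_fun_lt_imp_dist_val_lt)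
      then have "dist (H (v s)) (H (u s)) < e / 2"
        using mem_PiCD[OF v(1)] mem_PiCD[OF u] by (intro d(2)) auto
      then show "dist (superpose H v s) (superpose H u s) \<le> e / 2"
        by (simp add: superpose_apply[OF assms] u v(1))
    qed
    then show "dist (superpose H v) (superpose H u) < e" using \<open>e > 0\<close> by simp
  qed (rule d)
qed

text \<open>One summand of a derivative in direction \<open>w\<close>: the component of
  \<open>w\<close> along \<open>b\<close> times the curve \<open>h\<close> of partial derivatives.
  As a bounded bilinear operation on curves it obeys the product rule.\<close>

definition inner_scale :: "'x::real_inner \<Rightarrow> ('t::topological_space \<Rightarrow>\<^sub>C 'x)
    \<Rightarrow> ('t \<Rightarrow>\<^sub>C 'y::real_normed_vector) \<Rightarrow> ('t \<Rightarrow>\<^sub>C 'y)" where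
  "inner_scale b w h = Bcontfun (\<lambda>s. (apply_bcontfun w s \<bullet> b) *\<^sub>R apply_bcontfun h s)"

lemma norm_inner_scale_apply:
  "norm ((apply_bcontfun w s \<bullet> b) *\<^sub>R apply_bcontfun h s) \<le> norm w * norm h * norm b"
proof -
  have "norm ((apply_bcontfun w s \<bullet> b) *\<^sub>R apply_bcontfun h s) \<le> (norm (w s) * norm b) * norm (h s)"
    by (auto intro!: mult_right_mono Cauchy_Schwarz_ineq2)
  also have "\<dots> \<le> (norm w * norm b) * norm h"
    by (intro mult_mono norm_bounded) auto
  finally show ?thesis by (simp add: mult_ac)
qed

lemma inner_scale_apply:
  "apply_bcontfun (inner_scale b w h) s = (apply_bcontfun w s \<bullet> b) *\<^sub>R apply_bcontfun h s"
proof -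
  have "(\<lambda>s. (apply_bcontfun w s \<bullet> b) *\<^sub>R apply_bcontfun h s) \<in> bcontfun"
    by (rule bcontfun_normI[OF _ norm_inner_scale_apply]) (intro continuous_intros; simp)
  then show ?thesis by (simp add: inner_scale_def Bcontfun_inverse)
qed

lemma bounded_bilinear_inner_scale:
  "bounded_bilinear (inner_scale b :: ('t::topological_space \<Rightarrow>\<^sub>C 'x::real_inner) \<Rightarrow> ('t \<Rightarrow>\<^sub>C 'y::real_normed_vector) \<Rightarrow> _)"
proof
  fix w w' :: "'t::topological_space \<Rightarrow>\<^sub>C 'x::real_inner" and h h' :: "'t \<Rightarrow>\<^sub>C 'y::real_normed_vector" and r :: real
  show "inner_scale b (w + w') h = inner_scale b w h + inner_scale b w' h"
    by (rule bcontfun_eqI) (simp add: inner_scale_apply inner_add_left scaleR_add_left)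
  show "inner_scale b w (h + h') = inner_scale b w h + inner_scale b w h'"
    by (rule bcontfun_eqI) (simp add: inner_scale_apply scaleR_add_right)
  show "inner_scale b (r *\<^sub>R w) h = r *\<^sub>R inner_scale b w h"
    by (rule bcontfun_eqI) (simp add: inner_scale_apply)
  show "inner_scale b w (r *\<^sub>R h) = r *\<^sub>R inner_scale b w h"
    by (rule bcontfun_eqI) (simp add: inner_scale_apply mult.commute)
  show "\<exists>K. \<forall>w h. norm (inner_scale b w h :: 't \<Rightarrow>\<^sub>C 'y) \<le> norm w * norm h * K"
  proof (intro exI[of _ "norm b"] allI norm_bound)
    show "norm (apply_bcontfun (inner_scale b w h :: 't \<Rightarrow>\<^sub>C 'y) s) \<le> norm w * norm h * norm b"
      for w :: "'t \<Rightarrow>\<^sub>C 'x" and h s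
      unfolding inner_scale_apply by (rule norm_inner_scale_apply)
  qed
qed

text \<open>The derivative of \<open>u \<mapsto> H \<circ> u\<close>, expanded in a basis so that its coefficients are again of
  the form \<open>H' \<circ> u\<close> with values in the same space.\<close>

definition superpose_deriv :: "('x::euclidean_space \<Rightarrow> 'y::real_normed_vector)
    \<Rightarrow> ('t::topological_space \<Rightarrow>\<^sub>C 'x) \<Rightarrow> ('t \<Rightarrow>\<^sub>C 'x) \<Rightarrow> ('t \<Rightarrow>\<^sub>C 'y)" where
  "superpose_deriv H u w =
    (\<Sum>b\<in>Basis. inner_scale b w (superpose (\<lambda>x. frechet_derivative H (at x) b) u))"

lemma apply_bcontfun_sum: "apply_bcontfun (\<Sum>i\<in>I. f i) s = (\<Sum>i\<in>I. apply_bcontfun (f i) s)"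
  by (induction I rule: infinite_finite_induct) auto

lemma superpose_deriv_apply:
  fixes H :: "'x::euclidean_space \<Rightarrow> 'y::real_normed_vector" and u :: "'t::topological_space \<Rightarrow>\<^sub>C 'x"
  assumes H: "smooth_on S H" and B: "compact B" "B \<subseteq> S" and u: "u \<in> PiC UNIV (\<lambda>_. B)"
  shows "apply_bcontfun (superpose_deriv H u w) s = frechet_derivative H (at (u s)) (w s)"
proof -
  have "continuous_on B (\<lambda>x. frechet_derivative H (at x) b)" for b
    by (rule smooth_on_imp_continuous_on[OF smooth_on_frechet_derivative[OF smooth_on_subset[OF H B(2)]]])
  moreover have "u s \<in> S" using mem_PiCD[OF u] B(2) by auto
  then have "linear (frechet_derivative H (at (u s)))"
    by (intro linear_frechet_derivative smooth_on_imp_differentiable[OF H])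
  then have "frechet_derivative H (at (u s)) (w s)
      = (\<Sum>b\<in>Basis. (w s \<bullet> b) *\<^sub>R frechet_derivative H (at (u s)) b)"
    by (rule linear_eq_sum_Basis)
  ultimately show ?thesis
    by (simp add: superpose_deriv_def apply_bcontfun_sum inner_scale_apply superpose_apply[OF _ B(1) u])
qed

text \<open>The segment from \<open>u s\<close> to \<open>v s\<close> lies in the convex
  \<open>B\<close>, so the mean value inequality bounds the linearisation error at each parameter.
  Uniform continuity of the partial derivatives on the compact \<open>B\<close> makes this bound
  uniform in \<open>s\<close>.\<close>

lemma has_derivative_superpose:
  fixes H :: "'x::euclidean_space \<Rightarrow> 'y::real_normed_vector" and u :: "'t::topological_space \<Rightarrow>\<^sub>C 'x"
  assumes H: "smooth_on S H" and B: "compact B" "convex B" "B \<subseteq> S" and u: "u \<in> PiC UNIV (\<lambda>_. B)"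
  shows "(superpose H has_derivative superpose_deriv H u) (at u within PiC UNIV (\<lambda>_. B))"
  unfolding has_derivative_within_alt
proof (intro conjI allI impI)
  show "bounded_linear (superpose_deriv H u)"
    unfolding superpose_deriv_def
    by (intro bounded_linear_sum bounded_bilinear.bounded_linear_left[OF bounded_bilinear_inner_scale])
  fix e :: real assume "e > 0"
  define D where "D x = frechet_derivative H (at x)" for x
  \<comment> \<open>An error \<open>e / n\<close> in each basis direction adds up to
    \<open>e\<close> in operator norm.\<close>
  define n where "n = real DIM('x)"
  have n: "n > 0" by (simp add: n_def)
  have "\<exists>d>0. \<forall>x\<in>B. \<forall>y\<in>B. dist y x < d \<longrightarrow> dist (D y b) (D x b) < e / n" for b
  proof -
    have "continuous_on B (\<lambda>x. D x b)" unfolding D_def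
      by (rule smooth_on_imp_continuous_on[OF smooth_on_frechet_derivative[OF smooth_on_subset[OF H B(3)]]])
    then have "uniformly_continuous_on B (\<lambda>x. D x b)" using B(1) by (rule compact_uniformly_continuous)
    then show ?thesis using \<open>e > 0\<close> n unfolding uniformly_continuous_on_def by simp
  qed
  then obtain d where d: "\<And>b. d b > 0"
      "\<And>b x y. x \<in> B \<Longrightarrow> y \<in> B \<Longrightarrow> dist y x < d b \<Longrightarrow> dist (D y b) (D x b) < e / n"
    by metis
  define d0 where "d0 = Min (d ` Basis)"
  have d0: "d0 > 0" "\<And>b. b \<in> Basis \<Longrightarrow> d0 \<le> d b"
    using d(1) by (auto simp: d0_def)
  have lin: "linear (D x)" if "x \<in> B" for x
    unfolding D_def using that B(3) by (intro linear_frechet_derivative smooth_on_imp_differentiable[OF H]) auto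
  have close: "onorm (D y - D x) \<le> e" if "x \<in> B" "y \<in> B" "dist y x < d0" for x y
  proof (rule onorm_le)
    fix w
    have "(D y - D x) w = (\<Sum>b\<in>Basis. (w \<bullet> b) *\<^sub>R (D y b - D x b))"
      by (simp add: linear_eq_sum_Basis[OF lin, of _ w] that scaleR_diff_right sum_subtractf)
    also have "norm \<dots> \<le> (\<Sum>b\<in>(Basis :: 'x set). norm w * (e / n))"
    proof (rule sum_norm_le)
      fix b :: 'x assume b: "b \<in> Basis"
      have "norm (D y b - D x b) < e / n"
        using d(2)[OF that(1,2), of b] that(3) d0(2)[OF b] by (simp add: dist_norm)
      then show "norm ((w \<bullet> b) *\<^sub>R (D y b - D x b)) \<le> norm w * (e / n)"
        unfolding norm_scaleR using Basis_le_norm[OF b, of w] by (intro mult_mono) auto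
    qed
    also have "\<dots> = e * norm w" using n by (simp add: n_def)
    finally show "norm ((D y - D x) w) \<le> e * norm w" .
  qed
  have cont: "continuous_on B H"
    by (rule smooth_on_imp_continuous_on[OF smooth_on_subset[OF H B(3)]])
  show "\<exists>d>0. \<forall>v\<in>PiC UNIV (\<lambda>_. B). norm (v - u) < d \<longrightarrow>
      norm (superpose H v - superpose H u - superpose_deriv H u (v - u)) \<le> e * norm (v - u)"
  proof (intro exI conjI ballI impI)
    fix v assume v: "v \<in> PiC UNIV (\<lambda>_. B)" "norm (v - u) < d0"
    show "norm (superpose H v - superpose H u - superpose_deriv H u (v - u)) \<le> e * norm (v - u)"
    proof (rule norm_bound)
      fix s
      have us: "u s \<in> B" and vs: "v s \<in> B" using mem_PiCD[OF u] mem_PiCD[OF v(1)] by auto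
      have nvu: "norm (v s - u s) \<le> norm (v - u)" using norm_bounded[of "v - u" s] by simp
      have "norm (H (v s) - H (u s) - D (u s) (v s - u s)) \<le> norm (v s - u s) * e"
      proof (rule differentiable_bound_linearization)
        have *: "convex (B \<inter> ball (u s) d0)" using B(2) by (intro convex_Int) auto
        show "u s + t *\<^sub>R (v s - u s) \<in> B \<inter> ball (u s) d0" if "t \<in> {0..1}" for t
        proof -
          have "dist (u s) (v s) < d0"
            unfolding dist_norm norm_minus_commute[of "u s"] by (rule le_less_trans[OF nvu v(2)])
          then have "u s \<in> B \<inter> ball (u s) d0" "v s \<in> B \<inter> ball (u s) d0"
            using us vs d0(1) by simp_all
          then have "(1 - t) *\<^sub>R u s + t *\<^sub>R v s \<in> B \<inter> ball (u s) d0"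
            using that by (intro convexD_alt[OF *]) simp_all
          moreover have "(1 - t) *\<^sub>R u s + t *\<^sub>R v s = u s + t *\<^sub>R (v s - u s)"
            by (simp add: scaleR_diff_left scaleR_diff_right)
          ultimately show ?thesis by simp
        qed
        show "(H has_derivative D x) (at x within B \<inter> ball (u s) d0)" if "x \<in> B \<inter> ball (u s) d0" for x
          unfolding D_def using that B(3)
          by (auto intro: has_derivative_at_withinI[OF has_derivative_smooth_on[OF H]])
        show "onorm (D x - D (u s)) \<le> e" if "x \<in> B \<inter> ball (u s) d0" for x
          using that us by (intro close) (auto simp: dist_commute)
      qed (use us d0 in auto)
      also have "\<dots> \<le> e * norm (v - u)" using nvu \<open>e > 0\<close> by simp
      finally show "norm (apply_bcontfun (superpose H v - superpose H u - superpose_deriv H u (v - u)) s)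
          \<le> e * norm (v - u)"
        by (simp add: superpose_apply[OF cont B(1)] superpose_deriv_apply[OF H B(1,3)] u v(1) D_def)
    qed
  qed (rule d0)
qed

text \<open>The curves with values in \<open>B\<close> need not form a neighbourhood of
  \<open>u x\<close>, so \<open>superpose\<close> is differentiated only relative to them. As
  \<open>u\<close> maps the open \<open>W\<close> into this set, the composite still has an
  unrestricted derivative.\<close>

lemma has_derivative_superpose_compose:
  fixes H :: "'x::euclidean_space \<Rightarrow> 'y::real_normed_vector"
    and u :: "'w::real_normed_vector \<Rightarrow> ('t::topological_space \<Rightarrow>\<^sub>C 'x)"
  assumes H: "smooth_on S H" and B: "compact B" "convex B" "B \<subseteq> S" and W: "open W" "x \<in> W"
    and u: "\<And>x. x \<in> W \<Longrightarrow> u x \<in> PiC UNIV (\<lambda>_. B)" and u': "(u has_derivative u') (at x)"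
  shows "((\<lambda>x. superpose H (u x)) has_derivative (\<lambda>v. superpose_deriv H (u x) (u' v))) (at x)"
proof -
  have "((\<lambda>x. superpose H (u x)) has_derivative (\<lambda>v. superpose_deriv H (u x) (u' v))) (at x within W)"
  proof (rule has_derivative_in_compose[where f = u and g = "superpose H" and g' = "superpose_deriv H (u x)"])
    show "(superpose H has_derivative superpose_deriv H (u x)) (at (u x) within u ` W)"
      by (rule has_derivative_subset[OF has_derivative_superpose[OF H B u[OF W(2)]]]) (use u in auto)
  qed (rule has_derivative_at_withinI[OF u'])
  then show ?thesis using at_within_open[OF W(2,1)] by simp
qed

text \<open>The derivative is a sum of products of the derivative of \<open>u\<close> with
  superpositions of partial derivatives of \<open>H\<close>; hence the induction runs over all
  smooth \<open>H\<close> with \<open>u\<close> fixed.\<close>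

lemma Ck_on_superpose:
  fixes H :: "'x::euclidean_space \<Rightarrow> 'y::real_normed_vector"
    and u :: "'w::real_normed_vector \<Rightarrow> ('t::topological_space \<Rightarrow>\<^sub>C 'x)"
  assumes H: "smooth_on S H" and B: "compact B" "convex B" "B \<subseteq> S" and "open W"
    and u: "\<And>x. x \<in> W \<Longrightarrow> u x \<in> PiC UNIV (\<lambda>_. B)" and Ck: "Ck_on k W u"
  shows "Ck_on k W (\<lambda>x. superpose H (u x))"
  using H Ck
proof (induction k arbitrary: H)
  case (0 H)
  have "continuous_on (PiC UNIV (\<lambda>_. B)) (superpose H :: ('t \<Rightarrow>\<^sub>C 'x) \<Rightarrow> _)"
    by (rule continuous_on_superpose[OF smooth_on_imp_continuous_on[OF smooth_on_subset[OF 0(1) B(3)]] B(1)])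
  then show ?case using 0(2) u by (auto intro: continuous_on_compose2)
next
  case (Suc k H)
  show ?case
  proof (rule Ck_on_SucI[OF \<open>open W\<close>])
    show "((\<lambda>x. superpose H (u x)) has_derivative
        (\<lambda>v. superpose_deriv H (u x) (frechet_derivative u (at x) v))) (at x)" if x: "x \<in> W" for x
      by (rule has_derivative_superpose_compose[OF Suc.prems(1) B \<open>open W\<close> x u
            has_derivative_Ck_on[OF Suc.prems(2) x]])
    show "Ck_on k W (\<lambda>x. superpose_deriv H (u x) (frechet_derivative u (at x) v))" for v
      unfolding superpose_deriv_def using Suc.prems
      by (intro Ck_on_sum Ck_on_bounded_bilinear[OF bounded_bilinear_inner_scale] Suc.IH \<open>open W\<close>
          smooth_on_frechet_derivative Ck_on_SucD[OF Suc.prems(2)]) auto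
  qed
qed

lemma bounded_linear_const_bcontfun:
  "bounded_linear (const_bcontfun :: 'y::real_normed_vector \<Rightarrow> ('t::topological_space \<Rightarrow>\<^sub>C 'y))"
  by (rule bounded_linear_intro[where K = 1]) (auto intro!: bcontfun_eqI norm_bound)

text \<open>When the starting point moves along the normalised field, the travel time \<tau> grows
  at unit rate, so the point at time - s \<tau> moves along the field at rate 1 - s. The rate
  vanishes at s = 1, where the curve sits on the fixed hyperplane.\<close>

definition damp :: "(real \<Rightarrow>\<^sub>C 'y::real_normed_vector) \<Rightarrow> (real \<Rightarrow>\<^sub>C 'y)" where
  "damp h = Bcontfun (\<lambda>s. (1 - unit_clamp s) *\<^sub>R apply_bcontfun h s)"

lemma damp_apply: "apply_bcontfun (damp h) s = (1 - unit_clamp s) *\<^sub>R apply_bcontfun h s"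
proof -
  have "norm ((1 - unit_clamp s) *\<^sub>R apply_bcontfun h s) \<le> 1 * norm h" for s
    unfolding norm_scaleR by (intro mult_mono norm_bounded) auto
  then have "(\<lambda>s. (1 - unit_clamp s) *\<^sub>R apply_bcontfun h s) \<in> bcontfun"
    by (intro bcontfun_normI[of _ "1 * norm h"]) (auto intro!: continuous_intros)
  then show ?thesis by (simp add: damp_def Bcontfun_inverse)
qed

text \<open>Integration by parts along an integral curve \<open>v\<close> of \<open>- t X\<close>.\<close>

lemma damp_superpose:
  fixes H :: "'x::euclidean_space \<Rightarrow> 'y::euclidean_space" and v :: "real \<Rightarrow>\<^sub>C 'x"
  assumes H: "smooth_on S H" and X: "smooth_on S X" and B: "compact B" "B \<subseteq> S"
    and vB: "v \<in> PiC UNIV (\<lambda>_. B)" and v: "v = const_bcontfun x - t *\<^sub>R primitive (superpose X v)"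
  shows "damp (superpose H v) = (const_bcontfun (H x) - primitive (superpose H v))
    - t *\<^sub>R primitive (superpose_deriv H v (damp (superpose X v)))"
proof (rule bcontfun_eqI)
  fix s
  define c where "c = unit_clamp s"
  have c: "0 \<le> c" "c \<le> 1" by (simp_all add: c_def)
  have contB: "continuous_on B h" if "smooth_on S h" for h :: "'x \<Rightarrow> 'z::real_normed_vector"
    by (rule smooth_on_imp_continuous_on[OF smooth_on_subset[OF that B(2)]])
  note NH = superpose_apply[OF contB[OF H] B(1) vB] and NX = superpose_apply[OF contB[OF X] B(1) vB]
  have v_apply: "v r = x - t *\<^sub>R integral {0..unit_clamp r} (superpose X v)" for r
    using arg_cong[OF v, of "\<lambda>w. apply_bcontfun w r"] by (simp add: primitive_apply)
  \<comment> \<open>The equation for \<open>v\<close> makes it constant beyond the unit interval, so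
    clamping the parameter loses nothing.\<close>
  have vs: "v s = v c" and v0: "v 0 = x"
    unfolding v_apply by (simp_all add: c_def)
  have dv: "(v has_vector_derivative - (t *\<^sub>R X (v r))) (at r within {0..1})" if r: "r \<in> {0..1}" for r
  proof (rule has_vector_derivative_transform[OF r])
    have "((\<lambda>r. integral {0..r} (superpose X v)) has_vector_derivative superpose X v r) (at r within {0..1})"
      by (rule integral_has_vector_derivative[OF _ r]) simp
    then show "((\<lambda>r. x - t *\<^sub>R integral {0..r} (superpose X v)) has_vector_derivative
        - (t *\<^sub>R X (v r))) (at r within {0..1})"
      by (auto intro!: derivative_eq_intros simp: NX)
  qed (use v_apply in simp)
  define D where "D = superpose_deriv H v (damp (superpose X v))"
  have D: "D r = (1 - r) *\<^sub>R frechet_derivative H (at (v r)) (X (v r))" if "r \<in> {0..1}" for r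
  proof -
    have "linear (frechet_derivative H (at (v r)))"
      using mem_PiCD[OF vB] B(2) by (intro linear_frechet_derivative smooth_on_imp_differentiable[OF H]) auto
    then show ?thesis
      using that by (simp add: D_def superpose_deriv_apply[OF H B vB] damp_apply NX linear_scale)
  qed
  \<comment> \<open>One term comes from the factor \<open>1 - r\<close>, the other from the velocity
    \<open>- t X\<close> of the curve. Integrating this from 0 to \<open>c\<close> is the announced
    integration by parts.\<close>
  have dG: "((\<lambda>r. (1 - r) *\<^sub>R H (v r)) has_vector_derivative - superpose H v r - t *\<^sub>R D r)
      (at r within {0..c})" if r: "r \<in> {0..c}" for r
  proof -
    have r1: "r \<in> {0..1}" using r c by auto
    have vS: "v r \<in> S" using mem_PiCD[OF vB] B(2) by auto
    have "((\<lambda>r. H (v r)) has_derivative (\<lambda>h. frechet_derivative H (at (v r)) (h *\<^sub>R - (t *\<^sub>R X (v r)))))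
        (at r within {0..1})"
      using dv[OF r1] unfolding has_vector_derivative_def
      by (rule has_derivative_compose) (rule has_derivative_smooth_on[OF H vS])
    then have "((\<lambda>r. H (v r)) has_vector_derivative - (t *\<^sub>R frechet_derivative H (at (v r)) (X (v r))))
        (at r within {0..1})"
      using linear_frechet_derivative[OF smooth_on_imp_differentiable[OF H vS]]
      by (simp add: has_vector_derivative_def linear_scale linear_neg)
    then have "((\<lambda>r. H (v r)) has_vector_derivative - (t *\<^sub>R frechet_derivative H (at (v r)) (X (v r))))
        (at r within {0..c})"
      by (rule has_vector_derivative_within_subset) (use c in auto)
    then show ?thesis
      using r1 by (auto intro!: derivative_eq_intros simp: D NH)
  qed
  have "((\<lambda>r. - superpose H v r - t *\<^sub>R D r) has_integral (1 - c) *\<^sub>R H (v c) - (1 - 0) *\<^sub>R H (v 0)) {0..c}"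
    by (rule fundamental_theorem_of_calculus[OF c(1) dG])
  moreover have "((\<lambda>r. - superpose H v r - t *\<^sub>R D r) has_integral
      - integral {0..c} (superpose H v) - t *\<^sub>R integral {0..c} D) {0..c}"
    by (intro has_integral_diff has_integral_neg has_integral_cmul integrable_integral integrable_continuous_real) auto
  ultimately have "(1 - c) *\<^sub>R H (v c) - (1 - 0) *\<^sub>R H (v 0)
      = - integral {0..c} (superpose H v) - t *\<^sub>R integral {0..c} D"
    by (rule has_integral_unique)
  then have "(1 - c) *\<^sub>R H (v c) = H x - integral {0..c} (superpose H v) - t *\<^sub>R integral {0..c} D"
    by (simp add: v0 algebra_simps)
  then show "damp (superpose H v) s = apply_bcontfun ((const_bcontfun (H x) - primitive (superpose H v))
      - t *\<^sub>R primitive (superpose_deriv H v (damp (superpose X v)))) s"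
    by (simp add: damp_apply primitive_apply NH vs c_def[symmetric] D_def[symmetric])
qed

text \<open>For the flow \<open>\<Phi>\<close> of \<open>X\<close>, the curve \<open>u x\<close> is \<open>s \<mapsto> \<Phi> (- s \<tau>(x)) x\<close>, which runs from \<open>x\<close> to the
  hyperplane \<open>\<tau> = 0\<close> in unit time; \<open>\<phi> x\<close> is the integral of \<open>F\<close> along it.  The derivative of \<open>u\<close> in
  direction \<open>X\<close> is \<open>(1 - s) X(u x s)\<close>, since both solve the same linear integral equation.\<close>

lemma transport_equation_normalized:
  fixes X :: "'x::euclidean_space \<Rightarrow> 'x" and F :: "'x \<Rightarrow> real"
  assumes "open S" and x0: "x0 \<in> S" and X: "smooth_on S X" and F: "smooth_on S F"
    and aX: "\<And>y. y \<in> S \<Longrightarrow> a \<bullet> X y = 1"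
  obtains W \<phi> where "open W" "x0 \<in> W" "W \<subseteq> S" "smooth_on W \<phi>"
    "\<And>y. y \<in> W \<Longrightarrow> frechet_derivative \<phi> (at y) (X y) = F y"
proof -
  obtain r where r: "r > 0" "cball x0 r \<subseteq> S" using \<open>open S\<close> x0 open_contains_cball by blast
  define B where "B = cball x0 r"
  have B: "compact B" "convex B" "B \<subseteq> S" using r by (auto simp: B_def)
  define PB where "PB = PiC (UNIV :: real set) (\<lambda>_. B)"
  have contB: "continuous_on B H" if "smooth_on S H" for H :: "'x \<Rightarrow> 'c::real_normed_vector"
    by (rule smooth_on_imp_continuous_on[OF smooth_on_subset[OF that B(3)]])
  have bound: "\<exists>K\<ge>0. \<forall>y\<in>B. norm (H y) \<le> K" if H: "smooth_on S H" for H :: "'x \<Rightarrow> 'x"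
  proof -
    have "bounded (H ` B)" using compact_imp_bounded[OF compact_continuous_image[OF contB[OF H] B(1)]] .
    then show ?thesis unfolding bounded_pos by (metis imageI less_imp_le)
  qed
  obtain M where M: "M \<ge> 0" "\<And>y. y \<in> B \<Longrightarrow> norm (X y) \<le> M" using bound[OF X] by blast
  obtain P where P: "\<And>b. P b \<ge> 0" "\<And>b y. y \<in> B \<Longrightarrow> norm (frechet_derivative X (at y) b) \<le> P b"
    using bound[OF smooth_on_frechet_derivative[OF X]] by metis
  define L where "L = sum P Basis"
  have L: "L \<ge> 0" using P by (auto simp: L_def intro: sum_nonneg)
  have DX: "norm (frechet_derivative X (at y) w) \<le> L * norm w" if "y \<in> B" for y w
  proof -
    have "linear (frechet_derivative X (at y))"
      using that B by (intro linear_frechet_derivative smooth_on_imp_differentiable[OF X]) auto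
    then have "norm (frechet_derivative X (at y) w)
        = norm (\<Sum>b\<in>Basis. (w \<bullet> b) *\<^sub>R frechet_derivative X (at y) b)"
      by (simp only: linear_eq_sum_Basis[of _ w])
    also have "\<dots> \<le> (\<Sum>b\<in>Basis. norm w * P b)"
      unfolding norm_scaleR real_norm_def[symmetric]
      by (rule sum_norm_le) (auto intro!: mult_mono P that Basis_le_norm)
    finally show ?thesis unfolding L_def sum_distrib_left[symmetric]
      by (simp only: mult.commute)
  qed
  \<comment> \<open>The three bounds put \<open>W\<close> inside \<open>B\<close>, keep the curves
    inside \<open>B\<close> (they move at most \<open>norm a * d * M\<close> away from their start),
    and give the integral operator the contraction factor 1/2.\<close>
  define d where "d = min r (min (r / (1 + norm a * M)) (1 / (1 + 2 * norm a * L)))"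
  have pos: "1 + norm a * M > 0" "1 + 2 * norm a * L > 0"
    using M(1) L by (auto intro!: add_pos_nonneg)
  have d: "d > 0" "d \<le> r" using r pos by (auto simp: d_def)
  have dM: "d + (norm a * d) * M \<le> r"
  proof -
    have "d \<le> r / (1 + norm a * M)" by (simp add: d_def)
    then have "d * (1 + norm a * M) \<le> r" using pos(1) by (simp add: pos_le_divide_eq)
    then show ?thesis by (simp add: algebra_simps)
  qed
  have dL: "(norm a * d) * L \<le> 1 / 2"
  proof -
    have "d \<le> 1 / (1 + 2 * norm a * L)" by (simp add: d_def)
    then have "d * (1 + 2 * norm a * L) \<le> 1" using pos(2) by (simp add: pos_le_divide_eq)
    then show ?thesis using d(1) by (simp add: algebra_simps)
  qed
  define W where "W = ball x0 d"
  \<comment> \<open>By \<open>a \<bullet> X y = 1\<close> this function grows at unit rate along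
    \<open>X\<close>; its value is the travel time from the hyperplane through
    \<open>x0\<close>.\<close>
  define \<tau> where "\<tau> y = a \<bullet> (y - x0)" for y
  have W: "open W" "x0 \<in> W" "W \<subseteq> S" using d r by (auto simp: W_def)
  have \<tau>: "\<bar>\<tau> y\<bar> \<le> norm a * d" if "y \<in> W" for y
  proof -
    have "\<bar>\<tau> y\<bar> \<le> norm a * norm (y - x0)" unfolding \<tau>_def by (rule Cauchy_Schwarz_ineq2)
    also have "\<dots> \<le> norm a * d"
      using that by (auto intro!: mult_left_mono simp: W_def dist_norm norm_minus_commute)
    finally show ?thesis .
  qed
  note sapply = superpose_apply[OF contB B(1)]
  have NX_le: "norm (superpose X u) \<le> M" if "u \<in> PB" for u
    using mem_PiCD[OF that[unfolded PB_def]] M(2)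
    by (intro norm_bound) (auto simp: sapply[OF X that[unfolded PB_def]])
  have lipX: "norm (superpose X u - superpose X v) \<le> L * norm (u - v)" if "u \<in> PB" "v \<in> PB" for u v
  proof (rule norm_bound)
    fix s
    have uv: "u s \<in> B" "v s \<in> B" using that mem_PiCD unfolding PB_def by blast+
    have "norm (X (u s) - X (v s)) \<le> L * norm (u s - v s)"
    proof (rule differentiable_bound[OF B(2) _ _ uv])
      show "(X has_derivative frechet_derivative X (at x)) (at x within B)" if "x \<in> B" for x
        using that B(3) by (auto intro: has_derivative_at_withinI[OF has_derivative_smooth_on[OF X]])
      show "onorm (frechet_derivative X (at x)) \<le> L" if "x \<in> B" for x
        by (rule onorm_le) (rule DX[OF that])
    qed
    also have "\<dots> \<le> L * norm (u - v)"
      using norm_bounded[of "u - v" s] L by (intro mult_left_mono) auto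
    finally show "norm (apply_bcontfun (superpose X u - superpose X v) s) \<le> L * norm (u - v)"
      using that unfolding PB_def by (simp add: sapply[OF X])
  qed
  have half: "norm (\<tau> y *\<^sub>R primitive w) \<le> e / 2" if y: "y \<in> W" and w: "norm w \<le> L * e" "e \<ge> 0"
    for y e and w :: "real \<Rightarrow>\<^sub>C 'x"
  proof -
    have "norm (\<tau> y *\<^sub>R primitive w) \<le> (norm a * d) * (L * e)"
      unfolding norm_scaleR using \<tau>[OF y] order_trans[OF norm_primitive w(1)]
      by (intro mult_mono) auto
    also have "\<dots> = ((norm a * d) * L) * e" by simp
    also have "\<dots> \<le> (1 / 2) * e" using dL w(2) by (rule mult_right_mono)
    finally show ?thesis by simp
  qed
  \<comment> \<open>The integral equation of the curve starting at \<open>y\<close>. With the travel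
    time as a factor, all starting points share one complete space of curves, in which the
    contraction principle applies.\<close>
  have "\<exists>u\<in>PB. const_bcontfun y - \<tau> y *\<^sub>R primitive (superpose X u) = u" if y: "y \<in> W" for y
  proof -
    let ?f = "\<lambda>u. const_bcontfun y - \<tau> y *\<^sub>R primitive (superpose X u)"
    have "\<exists>!u\<in>PB. ?f u = u"
    proof (rule Banach_fix[where c = "1/2"])
      show "complete PB" unfolding PB_def complete_eq_closed
        by (rule closed_PiC) (simp add: B_def)
      have "const_bcontfun x0 \<in> PB" using r(1) by (auto simp: PB_def B_def mem_PiC_iff)
      then show "PB \<noteq> {}" by blast
      show "?f ` PB \<subseteq> PB"
      proof (rule image_subsetI)
        fix u assume u: "u \<in> PB"
        show "?f u \<in> PB" unfolding PB_def
        proof (intro mem_PiCI Pi_I)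
          fix s
          have "norm (\<tau> y *\<^sub>R primitive (superpose X u) s) \<le> (norm a * d) * M"
            unfolding norm_scaleR using \<tau>[OF y] M(1) d(1)
              order_trans[OF norm_bounded order_trans[OF norm_primitive NX_le[OF u]]]
            by (intro mult_mono) auto
          moreover have "norm (y - x0) \<le> d"
            using y by (simp add: W_def dist_norm norm_minus_commute)
          moreover have "norm (apply_bcontfun (?f u) s - x0) \<le>
              norm (y - x0) + norm (\<tau> y *\<^sub>R primitive (superpose X u) s)"
            using norm_triangle_ineq4[of "y - x0" "\<tau> y *\<^sub>R primitive (superpose X u) s"]
            by (simp add: algebra_simps)
          ultimately show "apply_bcontfun (?f u) s \<in> B"
            using dM unfolding B_def mem_cball dist_norm norm_minus_commute[of x0] by linarith
        qed
      qed
      show "dist (?f u) (?f v) \<le> 1 / 2 * dist u v" if "u \<in> PB" "v \<in> PB" for u v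
      proof -
        have "?f u - ?f v = - (\<tau> y *\<^sub>R primitive (superpose X u - superpose X v))"
          by (simp add: linear_diff[OF bounded_linear.linear[OF bounded_linear_primitive]] scaleR_diff_right)
        then show ?thesis using half[OF y lipX[OF that]] by (simp only: dist_norm norm_minus_cancel) simp
      qed
    qed auto
    then show ?thesis by blast
  qed
  then obtain u where uPB: "\<And>y. y \<in> W \<Longrightarrow> u y \<in> PB"
    and u: "\<And>y. y \<in> W \<Longrightarrow> u y = const_bcontfun y - \<tau> y *\<^sub>R primitive (superpose X (u y))"
    by metis

  interpret J: bounded_linear "primitive :: (real \<Rightarrow>\<^sub>C 'x) \<Rightarrow> _" by (rule bounded_linear_primitive)
  interpret J1: bounded_linear "primitive :: (real \<Rightarrow>\<^sub>C real) \<Rightarrow> _" by (rule bounded_linear_primitive)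
  interpret c: bounded_linear "const_bcontfun :: 'x \<Rightarrow> (real \<Rightarrow>\<^sub>C 'x)" by (rule bounded_linear_const_bcontfun)
  have \<tau>_diff: "\<tau> y - \<tau> x = a \<bullet> (y - x)" for x y by (simp add: \<tau>_def inner_diff_right)
  \<comment> \<open>Grouped so that the first bracket is of order \<open>norm (y - x)\<close> by the
    mere bound \<open>M\<close> on \<open>X\<close>, while the last term is at most half of the
    left-hand side.\<close>
  have u_diff: "u y - u x = (const_bcontfun (y - x) - (\<tau> y - \<tau> x) *\<^sub>R primitive (superpose X (u y)))
      - \<tau> x *\<^sub>R primitive (superpose X (u y) - superpose X (u x))" if "x \<in> W" "y \<in> W" for x y
  proof -
    have "u y - u x = (const_bcontfun y - \<tau> y *\<^sub>R primitive (superpose X (u y)))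
        - (const_bcontfun x - \<tau> x *\<^sub>R primitive (superpose X (u x)))"
      by (rule arg_cong2[where f = "(-)"]) (rule u[OF that(2)], rule u[OF that(1)])
    then show ?thesis by (simp add: c.diff J.diff scaleR_diff_left scaleR_diff_right)
  qed
  \<comment> \<open>Twice the bound for the first bracket of \<open>u_diff\<close>, since half of
    the increment is absorbed on the left.\<close>
  define Cu where "Cu = 2 * (1 + norm a * M)"
  have lip_u: "norm (u y - u x) \<le> Cu * norm (y - x)" if x: "x \<in> W" and y: "y \<in> W" for x y
  proof -
    have "norm (u y - u x) \<le> (norm (const_bcontfun (y - x) :: real \<Rightarrow>\<^sub>C 'x)
        + norm ((\<tau> y - \<tau> x) *\<^sub>R primitive (superpose X (u y))))
        + norm (\<tau> x *\<^sub>R primitive (superpose X (u y) - superpose X (u x)))"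
      unfolding u_diff[OF x y]
      by (rule order_trans[OF norm_triangle_ineq4 add_right_mono[OF norm_triangle_ineq4]])
    also have "norm (const_bcontfun (y - x) :: real \<Rightarrow>\<^sub>C 'x) \<le> norm (y - x)"
      by (rule norm_bound) simp
    also have "norm ((\<tau> y - \<tau> x) *\<^sub>R primitive (superpose X (u y))) \<le> (norm a * norm (y - x)) * M"
      unfolding norm_scaleR \<tau>_diff real_norm_def
      using order_trans[OF norm_primitive NX_le[OF uPB[OF y]]]
      by (intro mult_mono Cauchy_Schwarz_ineq2) auto
    also have "norm (\<tau> x *\<^sub>R primitive (superpose X (u y) - superpose X (u x))) \<le> norm (u y - u x) / 2"
      by (rule half[OF x lipX[OF uPB[OF y] uPB[OF x]]]) simp
    finally show ?thesis by (simp add: Cu_def algebra_simps)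
  qed
  note Ck_sup = Ck_on_superpose[OF _ B W(1) uPB[unfolded PB_def]]
  have cont_u: "continuous_on W u"
  proof (rule lipschitz_on_continuous_on)
    show "Cu-lipschitz_on W u"
      using lip_u M(1) by (intro lipschitz_onI) (auto simp: dist_norm Cu_def)
  qed
  have A_le: "norm (superpose_deriv X v w) \<le> L * norm w" if "v \<in> PB" for v w
  proof (rule norm_bound)
    fix s
    have "v s \<in> B" using mem_PiCD[OF that[unfolded PB_def]] by auto
    then have "norm (frechet_derivative X (at (v s)) (w s)) \<le> L * norm (w s)" by (rule DX)
    also have "\<dots> \<le> L * norm w" using L by (intro mult_left_mono norm_bounded)
    finally show "norm (superpose_deriv X v w s) \<le> L * norm w"
      using superpose_deriv_apply[OF X B(1,3) that[unfolded PB_def]] by simp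
  qed
  have A_lin: "bounded_linear (superpose_deriv H v)" for H :: "'x \<Rightarrow> 'z::real_normed_vector" and v :: "real \<Rightarrow>\<^sub>C 'x"
    unfolding superpose_deriv_def
    by (intro bounded_linear_sum bounded_bilinear.bounded_linear_left[OF bounded_bilinear_inner_scale])
  \<comment> \<open>Uniqueness for the linearised integral equation, by the same contraction factor;
    it will identify the derivative of \<open>u\<close> in direction \<open>X\<close>.\<close>
  have uniq: "w = z" if x: "x \<in> W" and w: "w = b - \<tau> x *\<^sub>R primitive (superpose_deriv X (u x) w)"
    and z: "z = b - \<tau> x *\<^sub>R primitive (superpose_deriv X (u x) z)" for x w z b
  proof -
    have "w - z = (b - \<tau> x *\<^sub>R primitive (superpose_deriv X (u x) w))
        - (b - \<tau> x *\<^sub>R primitive (superpose_deriv X (u x) z))"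
      by (rule arg_cong2[where f = "(-)"]; fact)
    also have "\<dots> = - (\<tau> x *\<^sub>R primitive (superpose_deriv X (u x) (w - z)))"
      by (simp add: J.diff bounded_linear.linear[OF A_lin, THEN linear_diff] scaleR_diff_right)
    finally have "norm (w - z) = norm (\<tau> x *\<^sub>R primitive (superpose_deriv X (u x) (w - z)))"
      by (metis norm_minus_cancel)
    also have "\<dots> \<le> norm (w - z) / 2"
      by (rule half[OF x A_le[OF uPB[OF x]] norm_ge_zero])
    finally have "norm (w - z) \<le> norm (w - z) / 2" .
    then show ?thesis by simp
  qed
  have deriv_u: "\<exists>w'. (u has_derivative w') (at x) \<and> (\<forall>v. w' v =
      (const_bcontfun v - (a \<bullet> v) *\<^sub>R primitive (superpose X (u x)))
        - \<tau> x *\<^sub>R primitive (superpose_deriv X (u x) (w' v)))" if x: "x \<in> W" for x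
  proof -
    define A where "A = superpose_deriv X (u x)"
    interpret A: bounded_linear A unfolding A_def by (rule A_lin)
    have "linear (\<lambda>w. - (\<tau> x *\<^sub>R primitive (A w)))"
      by (rule linearI) (simp_all add: A.add J.add A.scale J.scale scaleR_add_right)
    moreover have "norm (- (\<tau> x *\<^sub>R primitive (A w))) \<le> norm w / 2" for w
      using half[OF x A_le[OF uPB[OF x]], of w] by (simp add: A_def)
    ultimately obtain Sol where Sol: "bounded_linear Sol"
        "\<And>b z. z = b + - (\<tau> x *\<^sub>R primitive (A z)) \<longleftrightarrow> z = Sol b" "\<And>b. norm (Sol b) \<le> 2 * norm b"
      using linear_fixpoint_solution by blast
    \<comment> \<open>The linearisation error of \<open>superpose X\<close> at \<open>u x\<close>.
      Composed with the Lipschitz map \<open>u\<close> it has derivative 0 at \<open>x\<close>,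
      although \<open>u\<close> is not yet known to be differentiable.\<close>
    define \<rho> where "\<rho> q = superpose X q - superpose X (u x) - A (q - u x)" for q
    have "(\<rho> has_derivative (\<lambda>w. A w - 0 - A (w - 0))) (at (u x) within PB)"
      unfolding \<rho>_def PB_def A_def
      by (intro has_derivative_diff has_derivative_superpose[OF X B uPB[OF x, unfolded PB_def]]
          bounded_linear.has_derivative[OF A_lin] has_derivative_ident has_derivative_const)
    then have "(\<rho> has_derivative (\<lambda>_. 0)) (at (u x) within PB)" by simp
    then have \<rho>: "((\<lambda>y. \<rho> (u y)) has_derivative (\<lambda>_. 0)) (at x)"
      by (rule has_derivative_zero_compose[OF _ W(1) x uPB lip_u[OF x]])
    have "Ck_on 0 W (\<lambda>y. superpose X (u y))" using Ck_sup[OF X, where k = 0] cont_u by simp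
    then have "isCont (\<lambda>y. primitive (superpose X (u y))) x"
      using W(1) x by (intro J.isCont) (simp add: continuous_on_eq_continuous_at)
    moreover have "((\<lambda>y. \<tau> y - \<tau> x) has_derivative (\<lambda>v. a \<bullet> v)) (at x)"
      unfolding \<tau>_diff by (auto intro!: derivative_eq_intros)
    \<comment> \<open>Again the scalar factor vanishes at \<open>x\<close>, so continuity of the
      curve factor is enough.\<close>
    ultimately have 1: "((\<lambda>y. (\<tau> y - \<tau> x) *\<^sub>R primitive (superpose X (u y))) has_derivative
        (\<lambda>v. (a \<bullet> v) *\<^sub>R primitive (superpose X (u x)))) (at x)"
      by (intro has_derivative_bilinear_vanishing[OF bounded_bilinear_scaleR]) auto
    define w' where "w' v = Sol (const_bcontfun v - (a \<bullet> v) *\<^sub>R primitive (superpose X (u x)))" for v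
    \<comment> \<open>An exact identity: the part linear in the increment is moved to the left and
      inverted by \<open>Sol\<close>, and what remains inside \<open>Sol\<close> is differentiable
      at \<open>x\<close>.\<close>
    have uS: "u x + Sol (const_bcontfun (y - x) - (\<tau> y - \<tau> x) *\<^sub>R primitive (superpose X (u y))
        - \<tau> x *\<^sub>R primitive (\<rho> (u y))) = u y" if y: "y \<in> W" for y
    proof -
      have "u y - u x = (const_bcontfun (y - x) - (\<tau> y - \<tau> x) *\<^sub>R primitive (superpose X (u y))
          - \<tau> x *\<^sub>R primitive (\<rho> (u y))) + - (\<tau> x *\<^sub>R primitive (A (u y - u x)))"
        unfolding \<rho>_def J.diff[of _ "A _"] by (subst u_diff[OF x y]) (simp add: scaleR_diff_right)
      then show ?thesis unfolding Sol(2) by (simp add: algebra_simps)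
    qed
    have "((\<lambda>y. u x + Sol (const_bcontfun (y - x) - (\<tau> y - \<tau> x) *\<^sub>R primitive (superpose X (u y))
        - \<tau> x *\<^sub>R primitive (\<rho> (u y)))) has_derivative
        (\<lambda>v. 0 + Sol (const_bcontfun (v - 0) - (a \<bullet> v) *\<^sub>R primitive (superpose X (u x))
          - \<tau> x *\<^sub>R primitive 0))) (at x)"
      by (intro has_derivative_add has_derivative_diff has_derivative_const has_derivative_ident 1 \<rho>
          bounded_linear.has_derivative[OF Sol(1)] bounded_linear.has_derivative[OF bounded_linear_const_bcontfun]
          bounded_linear.has_derivative[OF bounded_linear_scaleR_right] J.has_derivative)
    then have "((\<lambda>y. u x + Sol (const_bcontfun (y - x) - (\<tau> y - \<tau> x) *\<^sub>R primitive (superpose X (u y))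
        - \<tau> x *\<^sub>R primitive (\<rho> (u y)))) has_derivative w') (at x)"
      by (simp add: w'_def[abs_def] J.zero)
    then have "(u has_derivative w') (at x)"
      by (rule has_derivative_transform_within_open[OF _ W(1) x]) (rule uS)
    moreover have "w' v = (const_bcontfun v - (a \<bullet> v) *\<^sub>R primitive (superpose X (u x)))
        - \<tau> x *\<^sub>R primitive (superpose_deriv X (u x) (w' v))" for v
      using Sol(2)[of "w' v"] by (simp add: w'_def A_def)
    ultimately show ?thesis by blast
  qed
  define u' where "u' x = frechet_derivative u (at x)" for x
  have u': "(u has_derivative u' x) (at x)" "u' x v =
      (const_bcontfun v - (a \<bullet> v) *\<^sub>R primitive (superpose X (u x)))
        - \<tau> x *\<^sub>R primitive (superpose_deriv X (u x) (u' x v))" if x: "x \<in> W" for x v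
  proof -
    obtain w' where w': "(u has_derivative w') (at x)" "\<And>v. w' v =
      (const_bcontfun v - (a \<bullet> v) *\<^sub>R primitive (superpose X (u x)))
        - \<tau> x *\<^sub>R primitive (superpose_deriv X (u x) (w' v))"
      using deriv_u[OF x] by blast
    have "u' x = w'" unfolding u'_def using frechet_derivative_at[OF w'(1)] by simp
    with w' show "(u has_derivative u' x) (at x)" "u' x v =
      (const_bcontfun v - (a \<bullet> v) *\<^sub>R primitive (superpose X (u x)))
        - \<tau> x *\<^sub>R primitive (superpose_deriv X (u x) (u' x v))" by simp_all
  qed
  have smooth_\<tau>: "smooth_on W \<tau>"
    unfolding \<tau>_def
    by (intro smooth_on_bounded_linear[OF bounded_linear_inner_right W(1)] smooth_on_diff[OF W(1)]
        smooth_on_ident[OF W(1)] smooth_on_const[OF W(1)])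
  \<comment> \<open>The linear operator in the equation for \<open>u'\<close> is split into bilinear
    operations \<open>T b\<close>, with its dependence on \<open>x\<close> isolated in the
    coefficient curves \<open>ab\<close>. This is the form that \<open>Ck_on_linear_fixpoint\<close>
    requires.\<close>
  define T where "T b h w = primitive (inner_scale b w h)" for b :: 'x and h w :: "real \<Rightarrow>\<^sub>C 'x"
  have T: "bounded_bilinear (T b)" for b
  proof -
    interpret I: bounded_bilinear "inner_scale b :: _ \<Rightarrow> _ \<Rightarrow> (real \<Rightarrow>\<^sub>C 'x)"
      by (rule bounded_bilinear_inner_scale)
    obtain K where "\<And>w h. norm (inner_scale b w h :: real \<Rightarrow>\<^sub>C 'x) \<le> norm w * norm h * K"
      using I.bounded by blast
    then have "norm (T b h w) \<le> norm h * norm w * K" for h w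
      unfolding T_def by (metis mult.commute norm_primitive order_trans)
    then show ?thesis
      by (intro bounded_bilinear.intro exI[of _ K] allI)
        (simp_all add: T_def I.add_left I.add_right I.scaleR_left I.scaleR_right J.add J.scale)
  qed
  define ab where "ab b x = (- \<tau> x) *\<^sub>R superpose (\<lambda>y. frechet_derivative X (at y) b) (u x)" for b x
  have T_sum: "(\<Sum>b\<in>Basis. T b (ab b x) w) = - (\<tau> x *\<^sub>R primitive (superpose_deriv X (u x) w))" for x w
    unfolding T_def ab_def superpose_deriv_def J.sum
    by (simp add: bounded_bilinear.scaleR_right[OF bounded_bilinear_inner_scale]
        bounded_bilinear.minus_right[OF bounded_bilinear_inner_scale] J.scale J.neg scaleR_sum_right sum_negf)
  \<comment> \<open>Bootstrap: class C^k of \<open>u\<close> passes to the coefficients and the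
    inhomogeneous term of the equation for \<open>u'\<close>, hence to \<open>u'\<close> itself,
    which raises the order of \<open>u\<close> by one.\<close>
  have Ck_u: "Ck_on k W u" for k
  proof (induction k)
    case 0
    show ?case using cont_u by simp
  next
    case (Suc k)
    show ?case
    proof (rule Ck_on_SucI[OF W(1) u'(1)])
      show "Ck_on k W (\<lambda>x. u' x v)" for v
      proof (rule Ck_on_linear_fixpoint[where T = T and I = Basis and a = ab])
        show "norm (\<Sum>b\<in>Basis. T b (ab b x) w) \<le> norm w / 2" if "x \<in> W" for x w
          unfolding T_sum using half[OF that A_le[OF uPB[OF that]], of w] by simp
        show "u' x v = (const_bcontfun v - (a \<bullet> v) *\<^sub>R primitive (superpose X (u x)))
            + (\<Sum>b\<in>Basis. T b (ab b x) (u' x v))" if "x \<in> W" for x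
          unfolding T_sum using u'(2)[OF that] by simp
        show "Ck_on k W (ab b)" for b
          unfolding ab_def using smooth_on_minus[OF W(1) smooth_\<tau>]
          by (intro Ck_on_bounded_bilinear[OF bounded_bilinear_scaleR W(1)]
              Ck_sup smooth_on_frechet_derivative[OF X] Suc) (auto simp: smooth_on_def)
        have "Ck_on k W (\<lambda>x. const_bcontfun v + (- (a \<bullet> v)) *\<^sub>R primitive (superpose X (u x)))"
          by (intro Ck_on_add Ck_on_const W(1) Ck_on_bounded_linear[OF bounded_linear_scaleR_right]
              Ck_on_bounded_linear[OF bounded_linear_primitive] Ck_sup[OF X] Suc)
        then show "Ck_on k W (\<lambda>x. const_bcontfun v - (a \<bullet> v) *\<^sub>R primitive (superpose X (u x)))"
          by simp
      qed (use T W in auto)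
    qed
  qed
  define ev where "ev w = apply_bcontfun w 1" for w :: "real \<Rightarrow>\<^sub>C real"
  interpret ev: bounded_linear ev unfolding ev_def by (rule bounded_linear_apply_bcontfun)
  \<comment> \<open>The value of the primitive at parameter 1 is the full integral over unit time;
    the factor \<tau> converts it to an integral over the travel time.\<close>
  define \<phi> where "\<phi> y = \<tau> y * ev (primitive (superpose F (u y)))" for y
  show ?thesis
  proof (rule that[OF W])
    have "smooth_on W (\<lambda>y. ev (primitive (superpose F (u y))))"
      unfolding smooth_on_def
      by (intro allI Ck_on_bounded_linear[OF ev.bounded_linear_axioms]
          Ck_on_bounded_linear[OF bounded_linear_primitive] Ck_sup[OF F] Ck_u W(1))
    then show "smooth_on W \<phi>" unfolding \<phi>_def by (intro smooth_on_mult W(1) smooth_\<tau>)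
    show "frechet_derivative \<phi> (at x) (X x) = F x" if x: "x \<in> W" for x
    proof -
      note vB = uPB[OF x, unfolded PB_def]
      have aX': "a \<bullet> X x = 1" using aX x W(3) by auto
      \<comment> \<open>By \<open>a \<bullet> X x = 1\<close>, the equation for \<open>u'\<close> in
        direction \<open>X x\<close> is the very equation that \<open>damp_superpose\<close> with
        \<open>H = X\<close> provides for the damped curve.\<close>
      have "u' x (X x) = damp (superpose X (u x))"
        by (rule uniq[OF x u'(2)[OF x, of "X x", unfolded aX' scaleR_one]
              damp_superpose[OF X X B(1,3) vB u[OF x]]])
      note damp = this
      have "(\<phi> has_derivative (\<lambda>v. \<tau> x * ev (primitive (superpose_deriv F (u x) (u' x v)))
          + (a \<bullet> v) * ev (primitive (superpose F (u x))))) (at x)"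
        unfolding \<phi>_def
      proof (rule has_derivative_mult)
        show "(\<tau> has_derivative (\<lambda>v. a \<bullet> v)) (at x)"
          unfolding \<tau>_def by (auto intro!: derivative_eq_intros)
        show "((\<lambda>y. ev (primitive (superpose F (u y)))) has_derivative
            (\<lambda>v. ev (primitive (superpose_deriv F (u x) (u' x v))))) (at x)"
          by (intro ev.has_derivative J1.has_derivative)
            (rule has_derivative_superpose_compose[OF F B W(1) x uPB[unfolded PB_def] u'(1)[OF x]])
      qed
      then have "frechet_derivative \<phi> (at x) (X x) = \<tau> x * ev (primitive (superpose_deriv F (u x)
          (damp (superpose X (u x))))) + ev (primitive (superpose F (u x)))"
        by (simp add: frechet_derivative_at[symmetric] damp aX')
      \<comment> \<open>\<open>damp_superpose\<close> with \<open>H = F\<close> expresses the two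
        integrals through \<open>F x\<close> and a damped curve, and damping kills the value at
        parameter 1.\<close>
      also have "\<dots> = F x - ev (damp (superpose F (u x)))"
        by (subst damp_superpose[OF F X B(1,3) vB u[OF x]]) (simp add: ev.diff ev.scale, simp add: ev_def)
      also have "\<dots> = F x" by (simp add: ev_def damp_apply)
      finally show ?thesis .
    qed
  qed
qed

text \<open>Field and right-hand side are divided by \<open>a \<bullet> X\<close> with
  \<open>a = X x0\<close>. At \<open>x0\<close> this product is the squared norm of
  \<open>X x0\<close>, hence not zero nearby, and linearity of the derivative removes the factor
  from the solved equation.\<close>

lemma transport_equation:
  fixes X :: "'x::euclidean_space \<Rightarrow> 'x" and F :: "'x \<Rightarrow> real"
  assumes S: "open S" "x0 \<in> S" and X: "smooth_on S X" and F: "smooth_on S F" and "X x0 \<noteq> 0"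
  obtains W \<phi> where "open W" "x0 \<in> W" "W \<subseteq> S" "smooth_on W \<phi>"
    "\<And>y. y \<in> W \<Longrightarrow> frechet_derivative \<phi> (at y) (X y) = F y"
proof -
  define a where "a = X x0"
  define S' where "S' = {y \<in> S. a \<bullet> X y \<noteq> 0}"
  have "S' = S \<inter> (\<lambda>y. a \<bullet> X y) -` (- {0})" by (auto simp: S'_def)
  moreover have "continuous_on S (\<lambda>y. a \<bullet> X y)"
    by (intro continuous_intros smooth_on_imp_continuous_on[OF X])
  ultimately have S': "open S'" "x0 \<in> S'" "S' \<subseteq> S"
    using S \<open>X x0 \<noteq> 0\<close> by (auto simp: S'_def a_def continuous_on_open_vimage intro: continuous_open_preimage)
  define q where "q y = inverse (a \<bullet> X y)" for y
  have q: "smooth_on S' q"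
    unfolding q_def using S' X
    by (intro smooth_on_inverse smooth_on_bounded_linear[OF bounded_linear_inner_right] smooth_on_subset[OF X])
      (auto simp: S'_def)
  have "smooth_on S' (\<lambda>y. q y *\<^sub>R X y)" "smooth_on S' (\<lambda>y. q y * F y)"
    by (intro smooth_on_scaleR smooth_on_mult S' q smooth_on_subset[OF X] smooth_on_subset[OF F])+
  moreover have "a \<bullet> q y *\<^sub>R X y = 1" if "y \<in> S'" for y using that by (simp add: q_def S'_def)
  ultimately obtain W \<phi> where W: "open W" "x0 \<in> W" "W \<subseteq> S'" "smooth_on W \<phi>"
    "\<And>y. y \<in> W \<Longrightarrow> frechet_derivative \<phi> (at y) (q y *\<^sub>R X y) = q y * F y"
    using transport_equation_normalized[OF S'(1,2)] by blast
  have "frechet_derivative \<phi> (at y) (X y) = F y" if y: "y \<in> W" for y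
  proof -
    have "q y \<noteq> 0" using y W(3) by (auto simp: q_def S'_def)
    moreover have "linear (frechet_derivative \<phi> (at y))"
      by (intro linear_frechet_derivative smooth_on_imp_differentiable[OF W(4) y])
    ultimately show ?thesis using W(5)[OF y] by (simp add: linear_scale)
  qed
  then show ?thesis using that[OF W(1,2) _ W(4)] W(3) S'(3) by blast
qed

section \<open>Linear algebra and second derivatives\<close>

lemma matrix_inv_right: "invertible A \<Longrightarrow> A ** matrix_inv A = mat 1"
  and matrix_inv_left: "invertible A \<Longrightarrow> matrix_inv A ** A = mat 1"
  unfolding matrix_inv_def invertible_def by (metis (mono_tags, lifting) someI_ex)+

lemma matrix_inv_unique:
  fixes A :: "real^'n^'n"
  assumes "A ** B = mat 1"
  shows "matrix_inv A = B"
proof -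
  have "invertible A" using assms invertible_right_inverse by blast
  then have "matrix_inv A = matrix_inv A ** (A ** B)" by (simp add: assms matrix_mul_rid)
  also have "\<dots> = (matrix_inv A ** A) ** B" by (simp only: matrix_mul_assoc)
  also have "\<dots> = B" using matrix_inv_left[OF \<open>invertible A\<close>] by (simp add: matrix_mul_lid)
  finally show ?thesis .
qed

lemma transpose_matrix_inv:
  fixes A :: "real^'n^'n"
  assumes "invertible A"
  shows "transpose (matrix_inv A) = matrix_inv (transpose A)"
proof (rule matrix_inv_unique[symmetric])
  show "transpose A ** transpose (matrix_inv A) = mat 1"
    unfolding matrix_transpose_mul[symmetric] matrix_inv_left[OF assms] by (rule transpose_mat)
qed

lemma bounded_bilinear_matrix_vector_mult: "bounded_bilinear ((*v) :: real^'n^'m \<Rightarrow> real^'n \<Rightarrow> real^'m)"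
  unfolding bilinear_conv_bounded_bilinear[symmetric] bilinear_def
  by (auto intro!: linearI simp: matrix_vector_mult_add_rdistrib matrix_vector_right_distrib
      scaleR_matrix_vector_assoc[symmetric] matrix_vector_mult_scaleR)

lemma bounded_bilinear_matrix_matrix_mult:
  "bounded_bilinear ((**) :: real^'n^'m \<Rightarrow> real^'k^'n \<Rightarrow> real^'k^'m)"
  unfolding bilinear_conv_bounded_bilinear[symmetric] bilinear_def
  by (auto intro!: linearI simp: matrix_matrix_mult_def vec_eq_iff algebra_simps sum.distrib sum_distrib_left)

lemma bounded_linear_transpose: "bounded_linear (transpose :: real^'n^'m \<Rightarrow> real^'m^'n)"
  unfolding linear_conv_bounded_linear[symmetric]
  by (auto intro!: linearI simp: transpose_def vec_eq_iff)

lemma bounded_linear_trace: "bounded_linear (trace :: real^'n^'n \<Rightarrow> real)"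
  unfolding linear_conv_bounded_linear[symmetric]
  by (auto intro!: linearI simp: trace_def sum.distrib sum_distrib_left)

lemma smooth_on_det:
  fixes G :: "'x::real_normed_vector \<Rightarrow> real^'n^'n"
  assumes "open S" "\<And>i j. smooth_on S (\<lambda>x. G x $ i $ j)"
  shows "smooth_on S (\<lambda>x. det (G x))"
  unfolding det_def using assms
  by (intro smooth_on_sum smooth_on_mult smooth_on_const smooth_on_prod) auto

lemma smooth_on_component:
  fixes G :: "'x::real_normed_vector \<Rightarrow> ('b::real_normed_vector)^'n"
  shows "open S \<Longrightarrow> smooth_on S G \<Longrightarrow> smooth_on S (\<lambda>x. G x $ i)"
  by (rule smooth_on_bounded_linear[OF bounded_linear_vec_nth])

text \<open>Cramer's rule makes each entry of the inverse a polynomial in the entries of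
  \<open>G\<close> divided by the determinant.\<close>

lemma smooth_on_matrix_inv:
  fixes G :: "'x::real_normed_vector \<Rightarrow> real^'n^'n"
  assumes S: "open S" and G: "smooth_on S G" and inv: "\<And>x. x \<in> S \<Longrightarrow> invertible (G x)"
  shows "smooth_on S (\<lambda>x. matrix_inv (G x))"
proof -
  define N where "N x k l = det (\<chi> i j. if j = k then axis l 1 $ i else G x $ i $ j)" for x and k l :: 'n
  have cr: "matrix_inv (G x) $ k $ l = N x k l * inverse (det (G x))" if x: "x \<in> S" for x k l
  proof -
    have "G x *v (matrix_inv (G x) *v axis l 1) = axis l 1"
      by (simp add: matrix_vector_mul_assoc matrix_inv_right[OF inv[OF x]])
    then have "matrix_inv (G x) *v axis l 1 = (\<chi> k. N x k l / det (G x))"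
      using cramer[of "G x"] inv[OF x] unfolding invertible_det_nz N_def by blast
    then have "(matrix_inv (G x) *v axis l 1) $ k = N x k l / det (G x)" by simp
    then show ?thesis
      by (simp add: matrix_vector_mul_component cart_eq_inner_axis[symmetric] divide_inverse)
  qed
  have comp: "smooth_on S (\<lambda>x. G x $ i $ j)" for i j
    by (intro smooth_on_component S G)
  have "smooth_on S (\<lambda>x. N x k l)" for k l
  proof -
    have "smooth_on S (\<lambda>x. if j = k then axis l 1 $ i else G x $ i $ j)" for i j
      by (cases "j = k") (simp_all add: comp smooth_on_const[OF S])
    then show ?thesis unfolding N_def by (intro smooth_on_det S) simp
  qed
  moreover have "smooth_on S (\<lambda>x. inverse (det (G x)))"
    using inv by (intro smooth_on_inverse smooth_on_det S comp) (simp add: invertible_det_nz)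
  ultimately have "smooth_on S (\<lambda>x. \<chi> k. \<chi> l. N x k l * inverse (det (G x)))"
    by (intro smooth_on_vec_lambda smooth_on_mult S)
  then show ?thesis
    by (rule smooth_on_cong[OF S]) (simp add: vec_eq_iff cr)
qed

lemma smooth_on_matrix:
  fixes f :: "'x::real_normed_vector \<Rightarrow> real^'n \<Rightarrow> real^'m"
  assumes "open S" "\<And>v. smooth_on S (\<lambda>x. f x v)"
  shows "smooth_on S (\<lambda>x. matrix (f x))"
  unfolding matrix_def using assms by (intro smooth_on_vec_lambda smooth_on_component)

lemma smooth_on_frechet_derivative_apply:
  fixes f :: "'x::euclidean_space \<Rightarrow> 'y::real_normed_vector"
  assumes S: "open S" and f: "smooth_on S f" and v: "smooth_on S v"
  shows "smooth_on S (\<lambda>x. frechet_derivative f (at x) (v x))"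
proof -
  have "smooth_on S (\<lambda>x. \<Sum>b\<in>Basis. (v x \<bullet> b) *\<^sub>R frechet_derivative f (at x) b)"
    by (intro smooth_on_sum smooth_on_scaleR S smooth_on_frechet_derivative[OF f]
        smooth_on_bounded_linear[OF bounded_linear_inner_left] v)
  then show ?thesis
    by (rule smooth_on_cong[OF S])
      (simp add: linear_eq_sum_Basis[symmetric] linear_frechet_derivative smooth_on_imp_differentiable[OF f])
qed

section \<open>Symmetry of second derivatives\<close>

lemma second_derivative_mean_value:
  fixes f :: "'x::real_normed_vector \<Rightarrow> real"
  assumes f: "smooth_on S f" and h: "h > 0"
    and S: "\<And>s t. 0 \<le> s \<Longrightarrow> s \<le> h \<Longrightarrow> 0 \<le> t \<Longrightarrow> t \<le> h \<Longrightarrow> x + s *\<^sub>R v + t *\<^sub>R w \<in> S"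
  obtains s t where "0 < s" "s < h" "0 < t" "t < h"
    "f (x + h *\<^sub>R v + h *\<^sub>R w) - f (x + h *\<^sub>R v) - f (x + h *\<^sub>R w) + f x =
      h * h * frechet_derivative (\<lambda>y. frechet_derivative f (at y) v) (at (x + s *\<^sub>R v + t *\<^sub>R w)) w"
proof -
  define D where "D y = frechet_derivative f (at y) v" for y
  have D: "smooth_on S D" unfolding D_def by (rule smooth_on_frechet_derivative[OF f])
  have dv: "((\<lambda>s. f (x + s *\<^sub>R v + t *\<^sub>R w)) has_real_derivative D (x + s *\<^sub>R v + t *\<^sub>R w)) (at s)"
    if "0 \<le> s" "s \<le> h" "0 \<le> t" "t \<le> h" for s t
  proof -
    have "((\<lambda>s. f (x + s *\<^sub>R v + t *\<^sub>R w)) has_derivative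
        (\<lambda>r. frechet_derivative f (at (x + s *\<^sub>R v + t *\<^sub>R w)) (r *\<^sub>R v))) (at s)"
      by (rule has_derivative_compose[of "\<lambda>s. x + s *\<^sub>R v + t *\<^sub>R w", OF _ has_derivative_smooth_on[OF f S[OF that]]])
        (auto intro!: derivative_eq_intros)
    then show ?thesis
      using linear_frechet_derivative[OF smooth_on_imp_differentiable[OF f S[OF that]]]
      by (auto intro: has_derivative_imp_has_field_derivative simp: D_def linear_scale)
  qed
  have dw: "((\<lambda>t. D (x + s *\<^sub>R v + t *\<^sub>R w)) has_real_derivative
      frechet_derivative D (at (x + s *\<^sub>R v + t *\<^sub>R w)) w) (at t)"
    if "0 \<le> s" "s \<le> h" "0 \<le> t" "t \<le> h" for s t
  proof -
    have "((\<lambda>t. D (x + s *\<^sub>R v + t *\<^sub>R w)) has_derivative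
        (\<lambda>r. frechet_derivative D (at (x + s *\<^sub>R v + t *\<^sub>R w)) (r *\<^sub>R w))) (at t)"
      by (rule has_derivative_compose[of "\<lambda>t. x + s *\<^sub>R v + t *\<^sub>R w", OF _ has_derivative_smooth_on[OF D S[OF that]]])
        (auto intro!: derivative_eq_intros)
    then show ?thesis
      using linear_frechet_derivative[OF smooth_on_imp_differentiable[OF D S[OF that]]]
      by (auto intro: has_derivative_imp_has_field_derivative simp: linear_scale)
  qed
  \<comment> \<open>The mean value theorem is applied to the increment in direction
    \<open>w\<close>, as a function of the step in direction \<open>v\<close>; a second application
    along \<open>w\<close> then produces the mixed derivative.\<close>
  have "\<exists>s>0. s < h \<and> (f (x + h *\<^sub>R v + h *\<^sub>R w) - f (x + h *\<^sub>R v + 0 *\<^sub>R w))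
      - (f (x + 0 *\<^sub>R v + h *\<^sub>R w) - f (x + 0 *\<^sub>R v + 0 *\<^sub>R w))
      = (h - 0) * (D (x + s *\<^sub>R v + h *\<^sub>R w) - D (x + s *\<^sub>R v + 0 *\<^sub>R w))"
    using h by (intro MVT2 DERIV_diff dv) auto
  then obtain s where s: "0 < s" "s < h"
      "f (x + h *\<^sub>R v + h *\<^sub>R w) - f (x + h *\<^sub>R v) - f (x + h *\<^sub>R w) + f x
        = h * (D (x + s *\<^sub>R v + h *\<^sub>R w) - D (x + s *\<^sub>R v + 0 *\<^sub>R w))"
    by auto
  have "\<exists>t>0. t < h \<and> D (x + s *\<^sub>R v + h *\<^sub>R w) - D (x + s *\<^sub>R v + 0 *\<^sub>R w)
      = (h - 0) * frechet_derivative D (at (x + s *\<^sub>R v + t *\<^sub>R w)) w"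
    using h s by (intro MVT2) (auto intro!: dw)
  then obtain t where "0 < t" "t < h" "D (x + s *\<^sub>R v + h *\<^sub>R w) - D (x + s *\<^sub>R v + 0 *\<^sub>R w)
      = h * frechet_derivative D (at (x + s *\<^sub>R v + t *\<^sub>R w)) w" by auto
  then show ?thesis using that[of s t] s unfolding D_def by simp
qed

text \<open>One and the same second difference equals \<open>h * h\<close> times either mixed
  derivative at some intermediate point, depending on the order of the mean value steps. Continuity
  of both derivatives lets the points tend to \<open>x\<close>.\<close>

lemma second_derivative_symmetric_real:
  fixes f :: "'x::real_normed_vector \<Rightarrow> real"
  assumes "open S" "x \<in> S" and f: "smooth_on S f"
  shows "frechet_derivative (\<lambda>y. frechet_derivative f (at y) v) (at x) w
    = frechet_derivative (\<lambda>y. frechet_derivative f (at y) w) (at x) v"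
proof -
  define D where "D v w y = frechet_derivative (\<lambda>y. frechet_derivative f (at y) v) (at y) w" for v w y
  have cont: "isCont (D v w) x" for v w
    using smooth_on_imp_continuous_on[OF smooth_on_frechet_derivative[OF smooth_on_frechet_derivative[OF f]]]
      assms(1,2) unfolding D_def by (simp add: continuous_on_eq_continuous_at)
  obtain r where r: "r > 0" "ball x r \<subseteq> S" using assms(1,2) open_contains_ball by blast
  have near: "\<exists>h>0. \<forall>s t. 0 \<le> s \<and> s \<le> h \<and> 0 \<le> t \<and> t \<le> h \<longrightarrow> dist (x + s *\<^sub>R v + t *\<^sub>R w) x < e"
    if "e > 0" for e
  proof (intro exI conjI allI impI)
    define h where "h = e / (norm v + norm w + 1)"
    have pos: "norm v + norm w + 1 > 0" by (simp add: add_nonneg_pos)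
    show h: "h > 0" using that pos by (simp add: h_def)
    fix s t assume st: "0 \<le> s \<and> s \<le> h \<and> 0 \<le> t \<and> t \<le> h"
    have "dist (x + s *\<^sub>R v + t *\<^sub>R w) x \<le> norm (s *\<^sub>R v) + norm (t *\<^sub>R w)"
      using norm_triangle_ineq[of "s *\<^sub>R v" "t *\<^sub>R w"] by (simp add: dist_norm)
    also have "\<dots> \<le> h * norm v + h * norm w"
      using st by (auto intro!: add_mono mult_right_mono)
    also have "\<dots> < h * (norm v + norm w + 1)" using h by (simp add: algebra_simps)
    also have "\<dots> = e" using pos by (simp add: h_def)
    finally show "dist (x + s *\<^sub>R v + t *\<^sub>R w) x < e" .
  qed
  have "\<bar>D v w x - D w v x\<bar> < e" if "e > 0" for e
  proof -
    have c: "\<forall>\<^sub>F y in nhds x. dist (D a b y) (D a b x) < e / 2" for a b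
      using tendstoD[OF cont[of a b, unfolded isCont_def tendsto_at_iff_tendsto_nhds], of "e / 2"] that by simp
    have "\<forall>\<^sub>F y in nhds x. y \<in> ball x r" by (rule eventually_nhds_in_open) (use r in auto)
    then have "\<forall>\<^sub>F y in nhds x. y \<in> ball x r \<and> dist (D v w y) (D v w x) < e / 2 \<and> dist (D w v y) (D w v x) < e / 2"
      using c by (intro eventually_conj)
    then obtain d where d: "d > 0" "\<And>y. dist y x < d \<Longrightarrow>
        y \<in> ball x r \<and> dist (D v w y) (D v w x) < e / 2 \<and> dist (D w v y) (D w v x) < e / 2"
      unfolding eventually_nhds_metric by blast
    obtain h where h: "h > 0" "\<And>s t. 0 \<le> s \<Longrightarrow> s \<le> h \<Longrightarrow> 0 \<le> t \<Longrightarrow> t \<le> h \<Longrightarrow> dist (x + s *\<^sub>R v + t *\<^sub>R w) x < d"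
      using near[OF d(1)] by blast
    have S1: "x + s *\<^sub>R v + t *\<^sub>R w \<in> S" if "0 \<le> s" "s \<le> h" "0 \<le> t" "t \<le> h" for s t
      using d(2)[OF h(2)[OF that]] r(2) by auto
    have S2: "x + t *\<^sub>R w + s *\<^sub>R v \<in> S" if "0 \<le> t" "t \<le> h" "0 \<le> s" "s \<le> h" for s t
      using S1[OF that(3,4,1,2)] by (simp add: algebra_simps)
    obtain s t where st: "0 < s" "s < h" "0 < t" "t < h"
      "f (x + h *\<^sub>R v + h *\<^sub>R w) - f (x + h *\<^sub>R v) - f (x + h *\<^sub>R w) + f x = h * h * D v w (x + s *\<^sub>R v + t *\<^sub>R w)"
      using second_derivative_mean_value[OF f h(1) S1] unfolding D_def by blast
    obtain t' s' where st': "0 < t'" "t' < h" "0 < s'" "s' < h"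
      "f (x + h *\<^sub>R w + h *\<^sub>R v) - f (x + h *\<^sub>R w) - f (x + h *\<^sub>R v) + f x = h * h * D w v (x + t' *\<^sub>R w + s' *\<^sub>R v)"
      using second_derivative_mean_value[OF f h(1) S2]
      unfolding D_def by blast
    have eq: "x + t' *\<^sub>R w + s' *\<^sub>R v = x + s' *\<^sub>R v + t' *\<^sub>R w" "x + h *\<^sub>R w + h *\<^sub>R v = x + h *\<^sub>R v + h *\<^sub>R w"
      by (simp_all add: algebra_simps)
    have "h * h * D v w (x + s *\<^sub>R v + t *\<^sub>R w) = h * h * D w v (x + s' *\<^sub>R v + t' *\<^sub>R w)"
      using st(5) st'(5) unfolding eq by linarith
    then have "D v w (x + s *\<^sub>R v + t *\<^sub>R w) = D w v (x + s' *\<^sub>R v + t' *\<^sub>R w)" using h(1) by simp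
    moreover have "dist (D v w (x + s *\<^sub>R v + t *\<^sub>R w)) (D v w x) < e / 2"
      using st by (intro d(2)[THEN conjunct2, THEN conjunct1] h(2)) auto
    moreover have "dist (D w v (x + s' *\<^sub>R v + t' *\<^sub>R w)) (D w v x) < e / 2"
      using st' by (intro d(2)[THEN conjunct2, THEN conjunct2] h(2)) auto
    ultimately show ?thesis unfolding dist_real_def by linarith
  qed
  then have "D v w x = D w v x" using zero_less_abs_iff[of "D v w x - D w v x"] by (metis less_irrefl right_minus_eq)
  then show ?thesis by (simp add: D_def)
qed

lemma second_derivative_symmetric:
  fixes f :: "'x::real_normed_vector \<Rightarrow> 'y::euclidean_space"
  assumes S: "open S" "x \<in> S" and f: "smooth_on S f"
  shows "frechet_derivative (\<lambda>y. frechet_derivative f (at y) v) (at x) w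
    = frechet_derivative (\<lambda>y. frechet_derivative f (at y) w) (at x) v"
proof (rule euclidean_eqI)
  fix b :: 'y
  have comp: "frechet_derivative (\<lambda>y. g y \<bullet> b) (at y) v = frechet_derivative g (at y) v \<bullet> b"
    if "smooth_on S g" "y \<in> S" for g :: "'x \<Rightarrow> 'y" and y v
  proof -
    have "((\<lambda>y. g y \<bullet> b) has_derivative (\<lambda>v. frechet_derivative g (at y) v \<bullet> b)) (at y)"
      by (rule bounded_linear.has_derivative[OF bounded_linear_inner_left has_derivative_smooth_on[OF that]])
    then show ?thesis using frechet_derivative_at by metis
  qed
  have *: "frechet_derivative (\<lambda>y. frechet_derivative (\<lambda>y. f y \<bullet> b) (at y) v) (at x) w
      = frechet_derivative (\<lambda>y. frechet_derivative f (at y) v) (at x) w \<bullet> b" for v w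
  proof -
    note fv = smooth_on_frechet_derivative[OF f, of v]
    have "((\<lambda>y. frechet_derivative f (at y) v \<bullet> b) has_derivative
        (\<lambda>w. frechet_derivative (\<lambda>y. frechet_derivative f (at y) v) (at x) w \<bullet> b)) (at x)"
      by (rule bounded_linear.has_derivative[OF bounded_linear_inner_left has_derivative_smooth_on[OF fv S(2)]])
    then have "((\<lambda>y. frechet_derivative (\<lambda>y. f y \<bullet> b) (at y) v) has_derivative
        (\<lambda>w. frechet_derivative (\<lambda>y. frechet_derivative f (at y) v) (at x) w \<bullet> b)) (at x)"
      by (rule has_derivative_transform_within_open[OF _ S]) (simp add: comp[OF f])
    then show ?thesis using frechet_derivative_at by metis
  qed
  show "frechet_derivative (\<lambda>y. frechet_derivative f (at y) v) (at x) w \<bullet> b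
      = frechet_derivative (\<lambda>y. frechet_derivative f (at y) w) (at x) v \<bullet> b"
    using second_derivative_symmetric_real[OF S smooth_on_bounded_linear[OF bounded_linear_inner_left S(1) f, of b], of v w]
    by (simp only: *)
qed

section \<open>Derivatives in charts\<close>

lemma is_chartD:
  assumes "is_chart c"
  shows "open (fst c)" "\<And>p. p \<in> fst c \<Longrightarrow> inv_chart c (snd c p) = p"
    "\<And>p. p \<in> fst c \<Longrightarrow> inv_chart c (snd c p) \<in> fst c"
    "continuous_on (fst c) (snd c)"
    "\<And>W. open W \<Longrightarrow> open (snd c ` (fst c \<inter> W))"
proof -
  have hom: "homeomorphism (fst c) (snd c ` fst c) (snd c) (inv_chart c)" and "open (snd c ` fst c)"
    using assms by (auto simp: is_chart_def)
  show "open (fst c)" using assms by (auto simp: is_chart_def)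
  show inv: "inv_chart c (snd c p) = p" if "p \<in> fst c" for p
    using hom that by (auto simp: homeomorphism_def)
  then show "inv_chart c (snd c p) \<in> fst c" if "p \<in> fst c" for p using that by simp
  show "continuous_on (fst c) (snd c)" using hom by (auto simp: homeomorphism_def)
  show "open (snd c ` (fst c \<inter> W))" if "open W" for W
  proof -
    have "snd c ` (fst c \<inter> W) = snd c ` fst c \<inter> inv_chart c -` W"
      using inv by auto
    moreover have "continuous_on (snd c ` fst c) (inv_chart c)"
      using hom by (auto simp: homeomorphism_def)
    ultimately show ?thesis
      using continuous_open_preimage[OF _ \<open>open (snd c ` fst c)\<close> that] by simp
  qed
qed

lemma smooth_atlas_is_chart: "smooth_atlas A \<Longrightarrow> c \<in> A \<Longrightarrow> is_chart c"
  by (simp add: smooth_atlas_def)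

text \<open>A relation, because \<open>frechet_derivative\<close> returns an arbitrary value where
  no derivative exists; the rules below carry differentiability along with the value.\<close>

definition has_chart_deriv ::
    "('a, 'm::finite) chart \<Rightarrow> ('a \<Rightarrow> 'b::real_normed_vector) \<Rightarrow> 'a \<Rightarrow> (real ^ 'm \<Rightarrow> 'b) \<Rightarrow> bool" where
  "has_chart_deriv c F p D \<longleftrightarrow> ((F \<circ> inv_chart c) has_derivative D) (at (snd c p))"

lemma chart_deriv_eqI: "has_chart_deriv c F p D \<Longrightarrow> chart_deriv c F p = D"
  unfolding has_chart_deriv_def chart_deriv_def by (auto dest: frechet_derivative_at)

lemma has_chart_deriv_linear: "has_chart_deriv c F p D \<Longrightarrow> linear D"
  unfolding has_chart_deriv_def by (rule has_derivative_linear)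

lemma has_chart_deriv_cong:
  assumes c: "is_chart c" and W: "open W" "p \<in> fst c \<inter> W"
    and eq: "\<And>q. q \<in> fst c \<inter> W \<Longrightarrow> F q = G q" and F: "has_chart_deriv c F p D"
  shows "has_chart_deriv c G p D"
  unfolding has_chart_deriv_def
proof (rule has_derivative_transform_within_open)
  show "((F \<circ> inv_chart c) has_derivative D) (at (snd c p))" using F by (simp add: has_chart_deriv_def)
  show "open (snd c ` (fst c \<inter> W))" by (rule is_chartD[OF c]) fact
  show "snd c p \<in> snd c ` (fst c \<inter> W)" using W by blast
  show "(F \<circ> inv_chart c) y = (G \<circ> inv_chart c) y" if "y \<in> snd c ` (fst c \<inter> W)" for y
    using that eq by (auto simp: is_chartD[OF c])
qed

lemma smooth_has_chart_deriv:
  assumes "smooth_on (snd c ` (fst c \<inter> W)) (F \<circ> inv_chart c)" "p \<in> fst c \<inter> W"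
  shows "has_chart_deriv c F p (chart_deriv c F p)"
proof -
  have "snd c p \<in> snd c ` (fst c \<inter> W)" using assms(2) by blast
  from has_derivative_smooth_on[OF assms(1) this] show ?thesis
    unfolding has_chart_deriv_def chart_deriv_def[abs_def] .
qed

lemma has_chart_deriv_bilinear:
  assumes "bounded_bilinear B" and c: "is_chart c" "p \<in> fst c"
    and F: "has_chart_deriv c F p F'" and G: "has_chart_deriv c G p G'"
  shows "has_chart_deriv c (\<lambda>q. B (F q) (G q)) p (\<lambda>v. B (F p) (G' v) + B (F' v) (G p))"
  using bounded_bilinear.FDERIV[OF assms(1) F[unfolded has_chart_deriv_def] G[unfolded has_chart_deriv_def]]
  unfolding has_chart_deriv_def o_def by (simp add: is_chartD[OF c(1)] c(2))

lemma has_chart_deriv_bounded_linear: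
  assumes "bounded_linear L" "has_chart_deriv c F p F'"
  shows "has_chart_deriv c (\<lambda>q. L (F q)) p (\<lambda>v. L (F' v))"
  using bounded_linear.has_derivative[OF assms(1) assms(2)[unfolded has_chart_deriv_def]]
  unfolding has_chart_deriv_def o_def .

lemma has_chart_deriv_exp:
  assumes "is_chart c" "p \<in> fst c" "has_chart_deriv c \<phi> p D"
  shows "has_chart_deriv c (\<lambda>q. exp (2 * \<phi> q) :: real) p (\<lambda>v. 2 * exp (2 * \<phi> p) * D v)"
proof -
  have "((\<lambda>y. exp (2 * (\<phi> \<circ> inv_chart c) y)) has_derivative
      (\<lambda>v. exp (2 * (\<phi> \<circ> inv_chart c) (snd c p)) * (2 * D v))) (at (snd c p))"
    using assms(3)[unfolded has_chart_deriv_def o_def] unfolding o_def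
    by (auto intro!: derivative_eq_intros)
  then show ?thesis
    unfolding has_chart_deriv_def by (simp add: o_def is_chartD[OF assms(1)] assms(2) mult_ac)
qed

lemma transition_smooth:
  assumes "smooth_atlas A" "c \<in> A" "c' \<in> A"
  shows "smooth_on (snd c ` (fst c \<inter> fst c')) (snd c' \<circ> inv_chart c)"
  using assms by (auto simp: smooth_atlas_def)

lemma transition_has_derivative:
  assumes A: "smooth_atlas A" "c \<in> A" "c' \<in> A" and p: "p \<in> fst c \<inter> fst c'"
  shows "((snd c' \<circ> inv_chart c) has_derivative (*v) (jacobian c c' p)) (at (snd c p))"
proof -
  have *: "snd c p \<in> snd c ` (fst c \<inter> fst c')" using p by blast
  note d = has_derivative_smooth_on[OF transition_smooth[OF A] *]
  have "(*v) (jacobian c c' p) = frechet_derivative (snd c' \<circ> inv_chart c) (at (snd c p))"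
    unfolding jacobian_def by (rule ext) (simp add: matrix_works has_derivative_linear[OF d])
  with d show ?thesis by simp
qed

lemma has_chart_deriv_change:
  assumes A: "smooth_atlas A" "c \<in> A" "c' \<in> A" and p: "p \<in> fst c \<inter> fst c'"
    and F: "has_chart_deriv c' F p D"
  shows "has_chart_deriv c F p (\<lambda>v. D (jacobian c c' p *v v))"
proof -
  have ch: "is_chart c" "is_chart c'" using A smooth_atlas_is_chart by blast+
  have "(((F \<circ> inv_chart c') \<circ> (snd c' \<circ> inv_chart c)) has_derivative
      (D \<circ> (*v) (jacobian c c' p))) (at (snd c p))"
    by (rule diff_chain_at[OF transition_has_derivative[OF A p]])
      (use F p in \<open>simp add: has_chart_deriv_def is_chartD[OF ch(1)]\<close>)
  then have "((F \<circ> inv_chart c) has_derivative (D \<circ> (*v) (jacobian c c' p))) (at (snd c p))"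
  proof (rule has_derivative_transform_within_open)
    show "open (snd c ` (fst c \<inter> fst c'))" by (rule is_chartD(5)[OF ch(1) is_chartD(1)[OF ch(2)]])
  qed (use p in \<open>auto simp: is_chartD[OF ch(1)] is_chartD[OF ch(2)]\<close>)
  then show ?thesis by (simp add: has_chart_deriv_def o_def)
qed

lemma smooth_on_change:
  assumes A: "smooth_atlas A" "c \<in> A" "c' \<in> A" and W: "open W" "W \<subseteq> fst c'"
    and F: "smooth_on (snd c' ` (fst c' \<inter> W)) (F \<circ> inv_chart c')"
  shows "smooth_on (snd c ` (fst c \<inter> W)) (F \<circ> inv_chart c)"
proof -
  have ch: "is_chart c" "is_chart c'" using A smooth_atlas_is_chart by blast+
  note op = is_chartD(5)[OF ch(1) W(1)]
  have "smooth_on (snd c ` (fst c \<inter> W)) (\<lambda>y. (F \<circ> inv_chart c') ((snd c' \<circ> inv_chart c) y))"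
    by (rule smooth_on_compose[OF op F smooth_on_subset[OF transition_smooth[OF A]]])
      (use W(2) in \<open>auto simp: is_chartD[OF ch(1)]\<close>)
  then show ?thesis
    by (rule smooth_on_cong[OF op]) (use W(2) in \<open>auto simp: is_chartD[OF ch(1)] is_chartD[OF ch(2)]\<close>)
qed

lemma smooth_jacobian:
  assumes A: "smooth_atlas A" "c \<in> A" "c' \<in> A"
  shows "smooth_on (snd c ` (fst c \<inter> fst c')) (jacobian c c' \<circ> inv_chart c)"
proof -
  have ch: "is_chart c" "is_chart c'" using A smooth_atlas_is_chart by blast+
  note op = is_chartD(5)[OF ch(1) is_chartD(1)[OF ch(2)]]
  have "smooth_on (snd c ` (fst c \<inter> fst c'))
      (\<lambda>y. matrix (frechet_derivative (snd c' \<circ> inv_chart c) (at y)))"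
    by (intro smooth_on_matrix op smooth_on_frechet_derivative transition_smooth[OF A])
  then show ?thesis
    by (rule smooth_on_cong[OF op]) (auto simp: jacobian_def is_chartD[OF ch(1)])
qed

text \<open>The derivative of the Jacobian is the second derivative of the transition map, which is
  symmetric.\<close>

lemma chart_deriv_jacobian_symmetric:
  assumes A: "smooth_atlas A" "c \<in> A" "c' \<in> A" and p: "p \<in> fst c \<inter> fst c'"
  shows "chart_deriv c (jacobian c c') p v *v w = chart_deriv c (jacobian c c') p w *v v"
proof -
  have ch: "is_chart c" "is_chart c'" using A smooth_atlas_is_chart by blast+
  define S where "S = snd c ` (fst c \<inter> fst c')"
  have S: "open S" "snd c p \<in> S"
    using is_chartD(5)[OF ch(1) is_chartD(1)[OF ch(2)]] p by (auto simp: S_def)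
  define \<tau> where "\<tau> = snd c' \<circ> inv_chart c"
  have \<tau>: "smooth_on S \<tau>" unfolding \<tau>_def S_def by (rule transition_smooth[OF A])
  have J: "has_chart_deriv c (jacobian c c') p (chart_deriv c (jacobian c c') p)"
    by (rule smooth_has_chart_deriv[OF smooth_jacobian[OF A] p])
  have *: "chart_deriv c (jacobian c c') p v *v w
      = frechet_derivative (\<lambda>y. frechet_derivative \<tau> (at y) w) (at (snd c p)) v" for v w
  proof -
    have "((\<lambda>y. (jacobian c c' \<circ> inv_chart c) y *v w) has_derivative
        (\<lambda>v. chart_deriv c (jacobian c c') p v *v w)) (at (snd c p))"
      by (rule bounded_linear.has_derivative[OF bounded_bilinear.bounded_linear_left[OF
              bounded_bilinear_matrix_vector_mult] J[unfolded has_chart_deriv_def]])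
    then have "((\<lambda>y. frechet_derivative \<tau> (at y) w) has_derivative
        (\<lambda>v. chart_deriv c (jacobian c c') p v *v w)) (at (snd c p))"
    proof (rule has_derivative_transform_within_open[OF _ S])
      show "(jacobian c c' \<circ> inv_chart c) y *v w = frechet_derivative \<tau> (at y) w" if "y \<in> S" for y
        using that linear_frechet_derivative[OF smooth_on_imp_differentiable[OF \<tau> that]]
        by (auto simp: S_def jacobian_def is_chartD[OF ch(1)] \<tau>_def[symmetric] matrix_works)
    qed
    then show ?thesis using frechet_derivative_at by metis
  qed
  show ?thesis unfolding * by (rule second_derivative_symmetric[OF S \<tau>])
qed

section \<open>Divergence and acceleration in coordinates\<close>

lemma linear_eq_sum_axis:
  fixes f :: "real^'n \<Rightarrow> 'y::real_vector"
  assumes "linear f"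
  shows "f v = (\<Sum>i\<in>UNIV. v $ i *\<^sub>R f (axis i 1))"
proof -
  have "f (\<Sum>i\<in>UNIV. v $ i *\<^sub>R axis i 1) = (\<Sum>i\<in>UNIV. v $ i *\<^sub>R f (axis i 1))"
    using assms by (simp only: linear_sum linear_scale)
  moreover have "(\<Sum>i\<in>UNIV. v $ i *\<^sub>R axis i 1) = v"
    using basis_expansion[of v] by (simp add: scalar_mult_eq_scaleR)
  ultimately show ?thesis by simp
qed

lemma trace_matrix_scaleR:
  fixes X :: "real^'n"
  assumes "linear f"
  shows "trace (matrix (\<lambda>v. f v *\<^sub>R X)) = f X"
  using linear_eq_sum_axis[OF assms, of X] by (simp add: trace_def matrix_def mult.commute)

lemma matrix_add_fun: "matrix (\<lambda>v. f v + g v) = matrix f + matrix g"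
  and matrix_scaleR_fun: "matrix (\<lambda>v. r *\<^sub>R h v) = r *\<^sub>R (matrix h :: real^'n^'m)"
  by (simp_all add: matrix_def vec_eq_iff)

text \<open>Coordinate expressions at a point for the divergence of a vector field and for the one-form
  \<open>g(\<nabla>\<^sub>X X, \<sqdot>)\<close>, in terms of the components \<open>G\<close>, \<open>X\<close> of metric and field and of their
  derivatives \<open>DG\<close>, \<open>DX\<close>.\<close>

definition coord_div ::
    "real^'m^'m \<Rightarrow> (real^'m \<Rightarrow> real^'m^'m) \<Rightarrow> real^'m \<Rightarrow> (real^'m \<Rightarrow> real^'m) \<Rightarrow> real" where
  "coord_div G DG X DX = trace (matrix DX) + 1/2 * trace (matrix_inv G ** DG X)"

definition coord_accel ::
    "real^'m^'m \<Rightarrow> (real^'m \<Rightarrow> real^'m^'m) \<Rightarrow> real^'m \<Rightarrow> (real^'m \<Rightarrow> real^'m) \<Rightarrow> real^'m" where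
  "coord_accel G DG X DX = DG X *v X + G *v DX X - (1/2) *\<^sub>R (\<chi> a. ip (DG (axis a 1)) X X)"

text \<open>Lowering the upper index cancels the inverse metric and leaves the Christoffel symbols
  of the first kind.\<close>

lemma christoffel_lower:
  assumes "invertible (g c p)"
  shows "(\<Sum>l\<in>UNIV. g c p $ a $ l * christoffel g c p l i j) = 1/2 *
    (chart_deriv c (g c) p (axis i 1) $ j $ a + chart_deriv c (g c) p (axis j 1) $ i $ a
      - chart_deriv c (g c) p (axis a 1) $ i $ j)"
proof -
  define E where "E m = chart_deriv c (g c) p (axis i 1) $ j $ m + chart_deriv c (g c) p (axis j 1) $ i $ m
      - chart_deriv c (g c) p (axis m 1) $ i $ j" for m
  have one: "(\<Sum>l\<in>UNIV. g c p $ a $ l * matrix_inv (g c p) $ l $ m) = (if a = m then 1 else 0)" for m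
    using arg_cong[OF matrix_inv_right[OF assms], of "\<lambda>M. M $ a $ m"]
    by (simp add: matrix_matrix_mult_def mat_def)
  have "(\<Sum>l\<in>UNIV. g c p $ a $ l * christoffel g c p l i j)
      = (\<Sum>l\<in>UNIV. \<Sum>m\<in>UNIV. (g c p $ a $ l * matrix_inv (g c p) $ l $ m) * (1/2 * E m))"
    unfolding christoffel_def E_def by (intro sum.cong refl) (simp add: sum_distrib_left mult_ac)
  also have "\<dots> = (\<Sum>m\<in>UNIV. (\<Sum>l\<in>UNIV. g c p $ a $ l * matrix_inv (g c p) $ l $ m) * (1/2 * E m))"
    unfolding sum_distrib_right by (rule sum.swap)
  also have "\<dots> = (\<Sum>m\<in>UNIV. if a = m then 1/2 * E m else 0)"
    unfolding one by (intro sum.cong refl) simp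
  also have "\<dots> = 1/2 * E a" by simp
  finally show ?thesis unfolding E_def .
qed

context
  fixes g :: "('a, 'm::finite) metric" and X :: "('a, 'm, real ^ 'm) field" and c p
  assumes inv: "invertible (g c p)" and sym: "transpose (g c p) = g c p"
    and dsym: "\<And>v. transpose (chart_deriv c (g c) p v) = chart_deriv c (g c) p v"
    and lin: "linear (chart_deriv c (g c) p)"
begin

private lemma comp_sym: "g c p $ i $ j = g c p $ j $ i"
  "chart_deriv c (g c) p v $ i $ j = chart_deriv c (g c) p v $ j $ i"
  "matrix_inv (g c p) $ i $ j = matrix_inv (g c p) $ j $ i"
proof -
  have t: "M $ i $ j = M $ j $ i" if "transpose M = M" for M :: "real^'m^'m"
    using arg_cong[OF that, of "\<lambda>M. M $ j $ i"] by (simp add: transpose_def)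
  show "g c p $ i $ j = g c p $ j $ i" by (rule t[OF sym])
  show "chart_deriv c (g c) p v $ i $ j = chart_deriv c (g c) p v $ j $ i" by (rule t[OF dsym])
  show "matrix_inv (g c p) $ i $ j = matrix_inv (g c p) $ j $ i"
    by (rule t) (simp add: transpose_matrix_inv[OF inv] sym)
qed

text \<open>When the Christoffel symbol is contracted, two of its three derivative terms cancel by
  symmetry of the inverse metric after exchanging the summation indices; the remaining one is a
  trace.\<close>

lemma divergence_eq_coord_div:
  "divergence g X c p = coord_div (g c p) (chart_deriv c (g c) p) (X c p) (chart_deriv c (X c) p)"
proof -
  define D where "D j = chart_deriv c (g c) p (axis j 1)" for j
  define H where "H = matrix_inv (g c p)"
  have Hs: "H $ i $ j = H $ j $ i" for i j unfolding H_def by (rule comp_sym)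
  have Ds: "D k $ i $ j = D k $ j $ i" for k i j unfolding D_def by (rule comp_sym)
  have tr: "(\<Sum>i\<in>UNIV. christoffel g c p i i b) = 1/2 * trace (H ** D b)" for b
  proof -
    have "(\<Sum>i\<in>UNIV. \<Sum>l\<in>UNIV. H $ i $ l * D i $ b $ l) = (\<Sum>i\<in>UNIV. \<Sum>l\<in>UNIV. H $ l $ i * D l $ b $ i)"
      by (rule sum.swap)
    also have "\<dots> = (\<Sum>i\<in>UNIV. \<Sum>l\<in>UNIV. H $ i $ l * D l $ i $ b)"
      by (intro sum.cong refl) (simp only: Hs[of _ "_"] Ds[of _ b])
    finally have "(\<Sum>i\<in>UNIV. \<Sum>l\<in>UNIV. H $ i $ l * (D i $ b $ l + D b $ i $ l - D l $ i $ b))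
        = (\<Sum>i\<in>UNIV. \<Sum>l\<in>UNIV. H $ i $ l * D b $ i $ l)"
      by (simp add: algebra_simps sum.distrib sum_subtractf)
    also have "\<dots> = trace (H ** D b)"
      unfolding trace_def matrix_matrix_mult_def by (simp add: Ds[of b])
    finally show ?thesis
      unfolding christoffel_def D_def[symmetric] H_def[symmetric] by (simp only: sum_distrib_left[symmetric])
  qed
  have "linear (\<lambda>v. trace (H ** chart_deriv c (g c) p v))"
    using linear_compose[OF linear_compose[OF lin bounded_linear.linear[OF
          bounded_bilinear.bounded_linear_right[OF bounded_bilinear_matrix_matrix_mult, of H]]]
        bounded_linear.linear[OF bounded_linear_trace]] by (simp add: o_def)
  from linear_eq_sum_axis[OF this, of "X c p"]
  have X: "trace (H ** chart_deriv c (g c) p (X c p)) = (\<Sum>b\<in>UNIV. X c p $ b * trace (H ** D b))"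
    by (simp add: D_def)
  have "divergence g X c p = (\<Sum>i\<in>UNIV. chart_deriv c (X c) p (axis i 1) $ i
      + (\<Sum>a\<in>UNIV. \<Sum>b\<in>UNIV. christoffel g c p i a b * axis i 1 $ a * X c p $ b))"
    by (simp add: divergence_def trace_def matrix_def cov_deriv_def)
  also have "\<dots> = trace (matrix (chart_deriv c (X c) p))
      + (\<Sum>i\<in>UNIV. \<Sum>b\<in>UNIV. christoffel g c p i i b * X c p $ b)"
  proof -
    have "(\<Sum>a\<in>UNIV. \<Sum>b\<in>UNIV. christoffel g c p i a b * axis i 1 $ a * X c p $ b)
        = (\<Sum>b\<in>UNIV. christoffel g c p i i b * X c p $ b)" for i
    proof -
      have "(\<Sum>a\<in>UNIV. \<Sum>b\<in>UNIV. christoffel g c p i a b * axis i 1 $ a * X c p $ b)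
          = (\<Sum>a\<in>UNIV. if a = i then (\<Sum>b\<in>UNIV. christoffel g c p i a b * X c p $ b) else 0)"
        by (intro sum.cong refl) (simp add: axis_def)
      then show ?thesis by simp
    qed
    then show ?thesis by (simp add: sum.distrib trace_def matrix_def)
  qed
  also have "(\<Sum>i\<in>UNIV. \<Sum>b\<in>UNIV. christoffel g c p i i b * X c p $ b)
      = (\<Sum>b\<in>UNIV. (\<Sum>i\<in>UNIV. christoffel g c p i i b) * X c p $ b)"
    unfolding sum_distrib_right by (rule sum.swap)
  also have "\<dots> = 1/2 * trace (H ** chart_deriv c (g c) p (X c p))"
    unfolding tr X by (simp add: sum_distrib_left mult_ac)
  finally show ?thesis by (simp add: coord_div_def H_def)
qed

private lemma chart_deriv_metric_apply:
  "(chart_deriv c (g c) p v *v w) $ a = (\<Sum>i\<in>UNIV. \<Sum>j\<in>UNIV. v $ i * w $ j * chart_deriv c (g c) p (axis i 1) $ a $ j)"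
proof -
  have "linear (\<lambda>v. (chart_deriv c (g c) p v *v w) $ a)"
    using linear_compose[OF linear_compose[OF lin bounded_linear.linear[OF
          bounded_bilinear.bounded_linear_left[OF bounded_bilinear_matrix_vector_mult, of w]]]
        bounded_linear.linear[OF bounded_linear_vec_nth[of a]]] by (simp add: o_def)
  from linear_eq_sum_axis[OF this, of v] show ?thesis
    by (simp add: matrix_vector_mult_def sum_distrib_left mult_ac)
qed

text \<open>Contracted twice with the same vector, the first two derivative terms agree up to the
  order of summation and together use up the factor 1/2; only the third keeps it.\<close>

private lemma christoffel_quadratic:
  "(\<Sum>i\<in>UNIV. \<Sum>j\<in>UNIV. x $ i * x $ j * (\<Sum>l\<in>UNIV. g c p $ a $ l * christoffel g c p l i j))
    = (chart_deriv c (g c) p x *v x) $ a - 1/2 * ip (chart_deriv c (g c) p (axis a 1)) x x"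
proof -
  define D where "D j = chart_deriv c (g c) p (axis j 1)" for j
  have Ds: "D k $ i $ j = D k $ j $ i" for k i j unfolding D_def by (rule comp_sym)
  have 1: "(\<Sum>i\<in>UNIV. \<Sum>j\<in>UNIV. x $ i * x $ j * D i $ j $ a) = (chart_deriv c (g c) p x *v x) $ a"
    unfolding chart_deriv_metric_apply D_def[symmetric] by (simp only: Ds[of _ _ a])
  have 2: "(\<Sum>i\<in>UNIV. \<Sum>j\<in>UNIV. x $ i * x $ j * D j $ i $ a) = (\<Sum>i\<in>UNIV. \<Sum>j\<in>UNIV. x $ i * x $ j * D i $ j $ a)"
    by (subst sum.swap) (simp add: mult.commute)
  have 3: "(\<Sum>i\<in>UNIV. \<Sum>j\<in>UNIV. x $ i * x $ j * D a $ i $ j) = ip (D a) x x"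
    unfolding ip_def inner_vec_def matrix_vector_mult_def by (simp add: sum_distrib_left mult_ac)
  have "(\<Sum>i\<in>UNIV. \<Sum>j\<in>UNIV. x $ i * x $ j * (1/2 * (D i $ j $ a + D j $ i $ a - D a $ i $ j)))
      = 1/2 * ((\<Sum>i\<in>UNIV. \<Sum>j\<in>UNIV. x $ i * x $ j * D i $ j $ a)
        + (\<Sum>i\<in>UNIV. \<Sum>j\<in>UNIV. x $ i * x $ j * D j $ i $ a)
        - (\<Sum>i\<in>UNIV. \<Sum>j\<in>UNIV. x $ i * x $ j * D a $ i $ j))"
    by (simp add: sum.distrib[symmetric] sum_subtractf[symmetric] sum_distrib_left algebra_simps)
  then show ?thesis
    unfolding christoffel_lower[where g = g and c = c and p = p, OF inv] D_def[symmetric] 2 1 3 by simp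
qed

lemma metric_cov_deriv_eq_coord_accel:
  "g c p *v cov_deriv g X c p (X c p)
    = coord_accel (g c p) (chart_deriv c (g c) p) (X c p) (chart_deriv c (X c) p)"
proof (rule vec_eq_iff[THEN iffD2], rule allI)
  fix a
  let ?x = "X c p"
  have "(\<Sum>l\<in>UNIV. g c p $ a $ l * (\<Sum>i\<in>UNIV. \<Sum>j\<in>UNIV. christoffel g c p l i j * ?x $ i * ?x $ j))
      = (\<Sum>l\<in>UNIV. \<Sum>i\<in>UNIV. \<Sum>j\<in>UNIV. ?x $ i * ?x $ j * (g c p $ a $ l * christoffel g c p l i j))"
    by (simp add: sum_distrib_left mult_ac)
  also have "\<dots> = (\<Sum>i\<in>UNIV. \<Sum>l\<in>UNIV. \<Sum>j\<in>UNIV. ?x $ i * ?x $ j * (g c p $ a $ l * christoffel g c p l i j))"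
    by (rule sum.swap)
  also have "\<dots> = (\<Sum>i\<in>UNIV. \<Sum>j\<in>UNIV. \<Sum>l\<in>UNIV. ?x $ i * ?x $ j * (g c p $ a $ l * christoffel g c p l i j))"
    by (intro sum.cong refl sum.swap)
  also have "\<dots> = (\<Sum>i\<in>UNIV. \<Sum>j\<in>UNIV. ?x $ i * ?x $ j * (\<Sum>l\<in>UNIV. g c p $ a $ l * christoffel g c p l i j))"
    by (simp add: sum_distrib_left)
  finally show "(g c p *v cov_deriv g X c p ?x) $ a
      = coord_accel (g c p) (chart_deriv c (g c) p) ?x (chart_deriv c (X c) p) $ a"
    unfolding christoffel_quadratic
    by (simp add: cov_deriv_def coord_accel_def matrix_vector_right_distrib)
      (simp add: matrix_vector_mult_def)
qed

text \<open>Together with \<open>metric_cov_deriv_eq_coord_accel\<close> this says that covariant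
  differentiation along \<open>X\<close> commutes with lowering the index of \<open>X\<close>, read
  off from a common coordinate expression.\<close>

lemma cov_deriv_flat_eq_coord_accel:
  assumes \<kappa>: "chart_deriv c (flat g X c) p = (\<lambda>v. g c p *v chart_deriv c (X c) p v + chart_deriv c (g c) p v *v X c p)"
    and flat: "flat g X c p = g c p *v X c p"
  shows "cov_deriv_form g (flat g X) c p (X c p)
    = coord_accel (g c p) (chart_deriv c (g c) p) (X c p) (chart_deriv c (X c) p)"
proof (rule vec_eq_iff[THEN iffD2], rule allI)
  fix j
  let ?x = "X c p"
  define D where "D j = chart_deriv c (g c) p (axis j 1)" for j
  have Ds: "D k $ i $ j = D k $ j $ i" for k i j unfolding D_def by (rule comp_sym)
  have "(\<Sum>i\<in>UNIV. \<Sum>k\<in>UNIV. christoffel g c p k i j * ?x $ i * (g c p *v ?x) $ k)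
      = (\<Sum>i\<in>UNIV. \<Sum>k\<in>UNIV. \<Sum>a\<in>UNIV. ?x $ i * ?x $ a * (g c p $ a $ k * christoffel g c p k i j))"
    by (intro sum.cong refl) (simp add: matrix_vector_mult_def sum_distrib_left comp_sym(1)[of _ "_"] mult_ac)
  also have "\<dots> = (\<Sum>i\<in>UNIV. \<Sum>a\<in>UNIV. \<Sum>k\<in>UNIV. ?x $ i * ?x $ a * (g c p $ a $ k * christoffel g c p k i j))"
    by (intro sum.cong refl sum.swap)
  also have "\<dots> = (\<Sum>i\<in>UNIV. \<Sum>a\<in>UNIV. ?x $ i * ?x $ a * (1/2 * (D i $ j $ a + D j $ i $ a - D a $ i $ j)))"
    by (simp add: sum_distrib_left[symmetric] christoffel_lower[where g = g and c = c and p = p, OF inv] D_def)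
  also have "\<dots> = 1/2 * ((\<Sum>i\<in>UNIV. \<Sum>a\<in>UNIV. ?x $ i * ?x $ a * D i $ j $ a)
        + (\<Sum>i\<in>UNIV. \<Sum>a\<in>UNIV. ?x $ i * ?x $ a * D j $ i $ a)
        - (\<Sum>i\<in>UNIV. \<Sum>a\<in>UNIV. ?x $ i * ?x $ a * D a $ i $ j))"
    by (simp add: sum.distrib[symmetric] sum_subtractf[symmetric] sum_distrib_left algebra_simps)
  \<comment> \<open>This contraction equals the first one, so the two cancel, and half the
    derivative of the metric in direction \<open>j\<close> survives.\<close>
  also have "(\<Sum>i\<in>UNIV. \<Sum>a\<in>UNIV. ?x $ i * ?x $ a * D a $ i $ j)
      = (\<Sum>i\<in>UNIV. \<Sum>a\<in>UNIV. ?x $ i * ?x $ a * D i $ j $ a)"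
    by (subst sum.swap) (intro sum.cong refl, simp add: Ds[of _ j] mult.commute)
  also have "(\<Sum>i\<in>UNIV. \<Sum>a\<in>UNIV. ?x $ i * ?x $ a * D j $ i $ a) = ip (D j) ?x ?x"
    unfolding ip_def inner_vec_def matrix_vector_mult_def by (simp add: sum_distrib_left mult_ac)
  finally show "cov_deriv_form g (flat g X) c p ?x $ j
      = coord_accel (g c p) (chart_deriv c (g c) p) ?x (chart_deriv c (X c) p) $ j"
    by (simp add: cov_deriv_form_def \<kappa> flat coord_accel_def D_def)
qed

end

text \<open>Up to powers of \<open>e\<close> and \<open>f\<close>, the divergence gains
  \<open>CARD('m)\<close> times \<open>d\<phi> X\<close>, from the trace of the identity, and the
  derivative \<open>df X\<close>; the acceleration gains \<open>2 * d\<phi> X\<close> and the same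
  \<open>df X\<close>. In the difference \<open>df\<close> cancels. The gradient of \<phi> in the
  last term of \<open>coord_accel\<close> is multiplied by \<open>ip G X X\<close> and drops out
  because \<open>X\<close> is null.\<close>

lemma coord_expansion_rescale:
  fixes G :: "real^'m^'m"
  assumes inv: "invertible G" and e: "e \<noteq> 0" and null: "ip G X X = 0"
    and lin: "linear DG" "linear DX" "linear d\<phi>" "linear df"
    and DG': "\<And>v. DG' v = e *\<^sub>R ((2 * d\<phi> v) *\<^sub>R G + DG v)"
    and DX': "\<And>v. DX' v = df v *\<^sub>R X + f *\<^sub>R DX v"
  shows "coord_div (e *\<^sub>R G) DG' (f *\<^sub>R X) DX' *\<^sub>R (e *\<^sub>R G *v f *\<^sub>R X)
      - coord_accel (e *\<^sub>R G) DG' (f *\<^sub>R X) DX'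
    = (e * f\<^sup>2) *\<^sub>R ((coord_div G DG X DX + (real CARD('m) - 2) * d\<phi> X) *\<^sub>R (G *v X)
      - coord_accel G DG X DX)"
proof -
  note mv = bounded_bilinear.add_left[OF bounded_bilinear_matrix_vector_mult]
    bounded_bilinear.scaleR_left[OF bounded_bilinear_matrix_vector_mult]
    bounded_bilinear.add_right[OF bounded_bilinear_matrix_vector_mult]
    bounded_bilinear.scaleR_right[OF bounded_bilinear_matrix_vector_mult]
  note mm = bounded_bilinear.add_left[OF bounded_bilinear_matrix_matrix_mult]
    bounded_bilinear.scaleR_left[OF bounded_bilinear_matrix_matrix_mult]
    bounded_bilinear.add_right[OF bounded_bilinear_matrix_matrix_mult]
    bounded_bilinear.scaleR_right[OF bounded_bilinear_matrix_matrix_mult]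
  interpret tr: bounded_linear "trace :: real^'m^'m \<Rightarrow> real" by (rule bounded_linear_trace)
  have invG: "matrix_inv (e *\<^sub>R G) = (1/e) *\<^sub>R matrix_inv G"
    by (rule matrix_inv_unique) (simp add: mm matrix_inv_right[OF inv] e)
  have "trace (matrix DX') = df X + f * trace (matrix DX)"
  proof -
    have "matrix DX' = matrix (\<lambda>v. df v *\<^sub>R X) + f *\<^sub>R matrix DX"
      unfolding matrix_scaleR_fun[symmetric] matrix_add_fun[symmetric] DX' ..
    then show ?thesis by (simp add: tr.add tr.scale trace_matrix_scaleR[OF lin(4)])
  qed
  moreover have "matrix_inv (e *\<^sub>R G) ** DG' (f *\<^sub>R X)
      = f *\<^sub>R ((2 * d\<phi> X) *\<^sub>R mat 1 + matrix_inv G ** DG X)"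
    unfolding invG DG' using e
    by (simp add: mm matrix_inv_left[OF inv] linear_scale[OF lin(1)] linear_scale[OF lin(3)] scaleR_add_right mult_ac)
  then have "trace (matrix_inv (e *\<^sub>R G) ** DG' (f *\<^sub>R X))
      = f * (2 * d\<phi> X * real CARD('m) + trace (matrix_inv G ** DG X))"
    by (simp add: tr.add tr.scale trace_I)
  ultimately have div: "coord_div (e *\<^sub>R G) DG' (f *\<^sub>R X) DX'
      = df X + f * (coord_div G DG X DX + real CARD('m) * d\<phi> X)"
    by (simp add: coord_div_def algebra_simps)
  have ipa: "ip (DG' (axis a 1)) (f *\<^sub>R X) (f *\<^sub>R X) = e * f\<^sup>2 * ip (DG (axis a 1)) X X" for a
    using null by (simp add: ip_def DG' mv inner_add_right power2_eq_square)
  have "(\<chi> a. ip (DG' (axis a 1)) (f *\<^sub>R X) (f *\<^sub>R X)) = (e * f\<^sup>2) *\<^sub>R (\<chi> a. ip (DG (axis a 1)) X X)"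
    by (simp add: vec_eq_iff ipa)
  then have acc: "coord_accel (e *\<^sub>R G) DG' (f *\<^sub>R X) DX'
      = (e * f\<^sup>2) *\<^sub>R coord_accel G DG X DX + (2 * e * f\<^sup>2 * d\<phi> X + e * f * df X) *\<^sub>R (G *v X)"
    unfolding coord_accel_def DG' DX'
    by (simp add: mv linear_scale[OF lin(1)] linear_scale[OF lin(2)] linear_scale[OF lin(3)]
        linear_scale[OF lin(4)] scaleR_add_right scaleR_diff_right scaleR_add_left power2_eq_square mult_ac)
  show ?thesis
    unfolding div acc
    by (simp add: mv scaleR_diff_right scaleR_add_left scaleR_diff_left scaleR_add_right power2_eq_square algebra_simps)
qed

text \<open>The trace of \<open>matrix_inv J ** DJ X\<close>, a second derivative of the coordinate
  change, appears once on each side: on the left in the metric term, on the right in the trace of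
  \<open>DX'\<close>.\<close>

lemma coord_div_change:
  fixes J :: "real^'m^'m"
  assumes J: "invertible J" and G': "invertible G'"
    and G: "G = transpose J ** G' ** J"
    and DG: "\<And>v. DG v = transpose (DJ v) ** G' ** J + transpose J ** DG' (J *v v) ** J + transpose J ** G' ** DJ v"
    and DX: "\<And>v. DX' (J *v v) = DJ v *v X + J *v DX v" and lin: "linear DX'" "linear DX"
    and sym: "\<And>v w. DJ v *v w = DJ w *v v"
  shows "coord_div G DG X DX = coord_div G' DG' (J *v X) DX'"
proof -
  interpret tr: bounded_linear "trace :: real^'m^'m \<Rightarrow> real" by (rule bounded_linear_trace)
  define I where "I = matrix_inv J"
  have I: "J ** I = mat 1" "I ** J = mat 1"
    unfolding I_def by (rule matrix_inv_right[OF J], rule matrix_inv_left[OF J])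
  have It: "transpose I ** transpose J = mat 1" "transpose J ** transpose I = mat 1"
    unfolding matrix_transpose_mul[symmetric] I by simp_all
  define H where "H = matrix_inv G'"
  have H: "G' ** H = mat 1" "H ** G' = mat 1"
    unfolding H_def by (rule matrix_inv_right[OF G'], rule matrix_inv_left[OF G'])
  have c1: "A ** (J ** (I ** B)) = A ** B" "A ** (I ** (J ** B)) = A ** B"
      "A ** (G' ** (H ** B)) = A ** B" "A ** (H ** (G' ** B)) = A ** B"
      "A ** (transpose I ** (transpose J ** B)) = A ** B" "A ** (transpose J ** (transpose I ** B)) = A ** B"
    for A B :: "real^'m^'m"
    by (metis I H It matrix_mul_assoc matrix_mul_lid)+
  note assoc = matrix_mul_assoc[symmetric]
  have "matrix_inv G = I ** H ** transpose I"
    by (rule matrix_inv_unique) (simp add: G assoc c1 It)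
  then have "matrix_inv G ** DG X = I ** (H ** (transpose I ** (transpose (DJ X) ** (G' ** J))))
      + I ** (H ** (DG' (J *v X) ** J)) + I ** DJ X"
    by (simp add: DG matrix_add_ldistrib assoc c1)
  then have "trace (matrix_inv G ** DG X) = trace (I ** (H ** (transpose I ** (transpose (DJ X) ** (G' ** J)))))
      + trace (I ** (H ** (DG' (J *v X) ** J))) + trace (I ** DJ X)"
    by (simp add: tr.add)
  also have "trace (I ** (H ** (transpose I ** (transpose (DJ X) ** (G' ** J)))))
      = trace (((H ** (transpose I ** (transpose (DJ X) ** G'))) ** J) ** I)"
    by (subst trace_mul_sym) (simp add: assoc)
  also have "\<dots> = trace (H ** ((transpose I ** transpose (DJ X)) ** G'))"
    by (simp add: assoc I)
  also have "\<dots> = trace ((transpose I ** transpose (DJ X)) ** (G' ** H))"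
    by (subst trace_mul_sym) (simp add: assoc)
  also have "\<dots> = trace (transpose (DJ X ** I))"
    by (simp add: H matrix_transpose_mul)
  also have "\<dots> = trace (DJ X ** I)" by (simp add: trace_def transpose_def)
  also have "\<dots> = trace (I ** DJ X)" by (rule trace_mul_sym)
  also have "trace (I ** (H ** (DG' (J *v X) ** J))) = trace ((H ** DG' (J *v X)) ** (J ** I))"
    by (subst trace_mul_sym) (simp add: assoc)
  finally have 1: "trace (matrix_inv G ** DG X) = 2 * trace (I ** DJ X) + trace (H ** DG' (J *v X))"
    by (simp add: I)
  \<comment> \<open>Symmetry of the second derivative turns \<open>DJ v *v X\<close>, with
    \<open>v\<close> as direction of differentiation, into the fixed matrix \<open>DJ X\<close>
    applied to \<open>v\<close>.\<close>
  have "matrix DX' ** J = DJ X + J ** matrix DX"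
  proof (rule matrix_eq[THEN iffD2], rule allI)
    fix v
    have "(matrix DX' ** J) *v v = DX' (J *v v)"
      using lin by (simp add: matrix_vector_mul_assoc[symmetric] matrix_works)
    also have "\<dots> = (DJ X + J ** matrix DX) *v v"
      using lin by (simp add: DX sym[of v] matrix_vector_mult_add_rdistrib matrix_vector_mul_assoc[symmetric] matrix_works)
    finally show "(matrix DX' ** J) *v v = (DJ X + J ** matrix DX) *v v" .
  qed
  then have "matrix DX' = (DJ X + J ** matrix DX) ** I"
    by (metis I(1) matrix_mul_assoc matrix_mul_rid)
  then have "trace (matrix DX') = trace (I ** (DJ X + J ** matrix DX))"
    using trace_mul_sym by metis
  also have "\<dots> = trace (I ** DJ X) + trace (matrix DX)"
    by (simp add: matrix_add_ldistrib tr.add matrix_mul_assoc I)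
  finally show ?thesis unfolding coord_div_def 1 by (simp add: H_def)
qed

section \<open>Lorentzian metrics\<close>

lemma bounded_bilinear_ip: "bounded_bilinear (ip G)"
proof -
  have "bilinear (ip G)"
    unfolding bilinear_def ip_def
    by (auto intro!: linearI simp: inner_add_left inner_add_right matrix_vector_right_distrib matrix_vector_mult_scaleR)
  then show ?thesis by (simp add: bilinear_conv_bounded_bilinear)
qed

lemmas ip_simps = bounded_bilinear.add_left[OF bounded_bilinear_ip] bounded_bilinear.add_right[OF bounded_bilinear_ip]
  bounded_bilinear.diff_left[OF bounded_bilinear_ip] bounded_bilinear.diff_right[OF bounded_bilinear_ip]
  bounded_bilinear.scaleR_left[OF bounded_bilinear_ip] bounded_bilinear.scaleR_right[OF bounded_bilinear_ip]

lemma ip_congruence: "ip (transpose P ** G ** P) v w = ip G (P *v v) (P *v w)"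
  using dot_lmul_matrix[of v "transpose P" "G *v (P *v w)"]
  by (simp add: ip_def matrix_vector_mul_assoc[symmetric])

lemma ip_commute: "transpose G = G \<Longrightarrow> ip G v w = ip G w v"
  unfolding ip_def by (metis dot_lmul_matrix inner_commute transpose_matrix_vector)

lemma ip_scaleR_metric: "ip (r *\<^sub>R G) v w = r * ip G v w"
  by (simp add: ip_def scaleR_matrix_vector_assoc[symmetric])

lemma ip_axis: "ip G (axis i 1) (axis j 1) = G $ i $ j"
  by (simp add: ip_def matrix_vector_mult_basis column_def inner_axis')

text \<open>The columns of \<open>P\<close> form a pseudo-orthonormal frame. The congruent matrix is
  diagonal with entries 1 and -1, so its determinant, a product of determinants of \<open>P\<close>
  and \<open>G\<close>, is not zero.\<close>

lemma lorentzian_frame: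
  fixes G :: "real^'m^'m"
  assumes "lorentzian_form G"
  obtains P :: "real^'m^'m" and i0 :: 'm where "invertible P" "invertible G"
    "\<And>v w. ip G (P *v v) (P *v w) = (\<Sum>i\<in>UNIV - {i0}. v $ i * w $ i) - v $ i0 * w $ i0"
proof -
  obtain e and i0 :: 'm where e: "\<forall>i j. ip G (e i) (e j) = (if i \<noteq> j then 0 else if i = i0 then - 1 else 1)"
    using assms unfolding lorentzian_form_def by blast
  define P where "P = (\<chi> a i. e i $ a)"
  define M where "M = transpose P ** G ** P"
  have P: "P *v axis i 1 = e i" for i
    by (simp add: P_def matrix_vector_mult_basis column_def vec_eq_iff)
  have M: "M $ i $ j = (if i \<noteq> j then 0 else if i = i0 then - 1 else 1)" for i j
    unfolding ip_axis[symmetric] M_def ip_congruence P using e by simp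
  have "det M = (\<Prod>i\<in>UNIV. M $ i $ i)" by (rule det_diagonal) (simp add: M)
  then have "det M \<noteq> 0" by (simp add: M)
  then have inv: "invertible P" "invertible G" by (simp_all add: M_def det_mul invertible_det_nz)
  have "ip G (P *v v) (P *v w) = (\<Sum>i\<in>UNIV - {i0}. v $ i * w $ i) - v $ i0 * w $ i0" for v w
  proof -
    have "(M *v w) $ i = (if i = i0 then - 1 else 1) * w $ i" for i
    proof -
      have "(M *v w) $ i = (\<Sum>j\<in>UNIV. M $ i $ j * w $ j)"
        by (simp add: matrix_vector_mult_def)
      also have "\<dots> = (\<Sum>j\<in>UNIV. if j = i then (if i = i0 then - 1 else 1) * w $ i else 0)"
        by (intro sum.cong refl) (simp add: M)
      finally show ?thesis by simp
    qed
    then have "ip M v w = (\<Sum>i\<in>UNIV. v $ i * ((if i = i0 then - 1 else 1) * w $ i))"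
      by (simp add: ip_def inner_vec_def)
    also have "\<dots> = (\<Sum>i\<in>UNIV - {i0}. v $ i * w $ i) - v $ i0 * w $ i0"
      by (subst sum.remove[of _ i0]) auto
    finally show ?thesis by (simp add: M_def ip_congruence)
  qed
  then show ?thesis by (rule that[OF inv])
qed

lemma lorentzian_invertible: "lorentzian_form G \<Longrightarrow> invertible (G :: real^'m^'m)"
  by (erule lorentzian_frame)

lemma lorentzian_symmetric: "lorentzian_form G \<Longrightarrow> transpose G = G"
  by (simp add: lorentzian_form_def)

text \<open>If the time component of \<open>k\<close> in frame coordinates were not zero, the
  Cauchy-Schwarz inequality for the spatial parts would contradict that \<open>t\<close> is
  timelike. A null vector without time component is zero.\<close>

lemma null_orthogonal_timelike:
  fixes G :: "real^'m^'m"
  assumes G: "lorentzian_form G" and t: "ip G t t < 0" and k: "ip G k k = 0" and kt: "ip G k t = 0"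
  shows "k = 0"
proof -
  obtain P :: "real^'m^'m" and i0 :: 'm where P: "invertible P" and
    ip: "\<And>v w. ip G (P *v v) (P *v w) = (\<Sum>i\<in>UNIV - {i0}. v $ i * w $ i) - v $ i0 * w $ i0"
    using lorentzian_frame[OF G] by metis
  obtain a b where a: "k = P *v a" and b: "t = P *v b"
    by (metis P matrix_inv_right matrix_vector_mul_assoc matrix_vector_mul_lid)
  let ?I = "UNIV - {i0}"
  have aa: "(\<Sum>i\<in>?I. (a $ i)\<^sup>2) = (a $ i0)\<^sup>2" and bb: "(\<Sum>i\<in>?I. (b $ i)\<^sup>2) < (b $ i0)\<^sup>2"
    and ab: "(\<Sum>i\<in>?I. a $ i * b $ i) = a $ i0 * b $ i0"
    using k t kt unfolding a b ip by (simp_all add: power2_eq_square)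
  have "(a $ i0 * b $ i0)\<^sup>2 \<le> (a $ i0)\<^sup>2 * (\<Sum>i\<in>?I. (b $ i)\<^sup>2)"
    using Cauchy_Schwarz_ineq_sum[of "\<lambda>i. a $ i" "\<lambda>i. b $ i" ?I] unfolding aa ab .
  then have "a $ i0 = 0"
    using bb by (auto simp: power_mult_distrib mult_le_cancel_left)
  moreover have "\<forall>i\<in>?I. (a $ i)\<^sup>2 = 0"
    using aa \<open>a $ i0 = 0\<close> sum_nonneg_eq_0_iff[of ?I "\<lambda>i. (a $ i)\<^sup>2"] by simp
  ultimately have "a = 0" by (auto simp: vec_eq_iff)
  then show ?thesis by (simp add: a)
qed

lemma lorentzian_form_scaleR:
  fixes G :: "real^'m^'m"
  assumes "lorentzian_form G" "r > 0"
  shows "lorentzian_form (r *\<^sub>R G)"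
proof -
  obtain e and i0 :: 'm where e: "\<forall>i j. ip G (e i) (e j) = (if i \<noteq> j then 0 else if i = i0 then - 1 else 1)"
    and s: "transpose G = G"
    using assms(1) unfolding lorentzian_form_def by blast
  define q where "q = inverse (sqrt r)"
  have q: "r * (q * q) = 1" using assms(2) by (simp add: q_def field_simps)
  have "ip (r *\<^sub>R G) (q *\<^sub>R e i) (q *\<^sub>R e j) = (r * (q * q)) * ip G (e i) (e j)" for i j
    by (simp add: ip_scaleR_metric ip_simps)
  then have "ip (r *\<^sub>R G) (q *\<^sub>R e i) (q *\<^sub>R e j) = (if i \<noteq> j then 0 else if i = i0 then - 1 else 1)" for i j
    using e by (simp add: q)
  moreover have "transpose (r *\<^sub>R G) = r *\<^sub>R G" using s by (simp add: transpose_def vec_eq_iff)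
  ultimately show ?thesis
    unfolding lorentzian_form_def by (intro conjI exI[of _ "\<lambda>i. q *\<^sub>R e i"] exI[of _ i0] allI)
qed

section \<open>Smooth fields and metrics over an atlas\<close>

lemma smooth_components_subset:
  "smooth_components A W F \<Longrightarrow> V \<subseteq> W \<Longrightarrow> smooth_components A V F"
  unfolding smooth_components_def by (blast intro: smooth_on_subset)

lemma smooth_components_has_chart_deriv:
  "smooth_components A W F \<Longrightarrow> c \<in> A \<Longrightarrow> p \<in> fst c \<inter> W \<Longrightarrow>
    has_chart_deriv c (F c) p (chart_deriv c (F c) p)"
  unfolding smooth_components_def by (blast intro: smooth_has_chart_deriv)

lemma smooth_components_bilinear:
  assumes "smooth_atlas A" "open W" "bounded_bilinear B" "smooth_components A W F" "smooth_components A W G"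
  shows "smooth_components A W (\<lambda>c p. B (F c p) (G c p))"
  unfolding smooth_components_def
proof
  fix c assume c: "c \<in> A"
  show "smooth_on (snd c ` (fst c \<inter> W)) ((\<lambda>p. B (F c p) (G c p)) \<circ> inv_chart c)"
    using smooth_on_bounded_bilinear[OF assms(3) is_chartD(5)[OF smooth_atlas_is_chart[OF assms(1) c] assms(2)]]
      assms(4,5) c unfolding smooth_components_def o_def by blast
qed

lemma smooth_components_linear:
  assumes "smooth_atlas A" "open W" "bounded_linear L" "smooth_components A W F"
  shows "smooth_components A W (\<lambda>c p. L (F c p))"
  unfolding smooth_components_def
proof
  fix c assume c: "c \<in> A"
  show "smooth_on (snd c ` (fst c \<inter> W)) ((\<lambda>p. L (F c p)) \<circ> inv_chart c)"
    using smooth_on_bounded_linear[OF assms(3) is_chartD(5)[OF smooth_atlas_is_chart[OF assms(1) c] assms(2)]]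
      assms(4) c unfolding smooth_components_def o_def by blast
qed

lemma smooth_components_cong:
  assumes "smooth_atlas A" "open W" "\<And>c p. c \<in> A \<Longrightarrow> p \<in> fst c \<inter> W \<Longrightarrow> F c p = G c p" "smooth_components A W F"
  shows "smooth_components A W G"
  unfolding smooth_components_def
proof
  fix c assume c: "c \<in> A"
  note ch = smooth_atlas_is_chart[OF assms(1) c]
  show "smooth_on (snd c ` (fst c \<inter> W)) (G c \<circ> inv_chart c)"
  proof (rule smooth_on_cong[OF is_chartD(5)[OF ch assms(2)]])
    show "smooth_on (snd c ` (fst c \<inter> W)) (F c \<circ> inv_chart c)"
      using assms(4) c by (simp add: smooth_components_def)
  qed (use assms(3)[OF c] in \<open>auto simp: is_chartD[OF ch]\<close>)
qed

lemma smooth_components_ip: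
  assumes "smooth_atlas A" "open W" "smooth_components A W g" "smooth_components A W X" "smooth_components A W Y"
  shows "smooth_components A W (\<lambda>c p. ip (g c p) (X c p) (Y c p))"
  unfolding ip_def
  by (intro smooth_components_bilinear[OF assms(1,2) bounded_bilinear_inner]
      smooth_components_bilinear[OF assms(1,2) bounded_bilinear_matrix_vector_mult] assms)

lemma smooth_fun_lincomb:
  assumes "smooth_atlas A" "open W" "smooth_fun A W \<phi>" "smooth_fun A W \<psi>"
  shows "smooth_fun A W (\<lambda>p. a * \<phi> p + b * \<psi> p)"
  unfolding smooth_fun_def smooth_components_def
proof
  fix c assume c: "c \<in> A"
  note op = is_chartD(5)[OF smooth_atlas_is_chart[OF assms(1) c] assms(2)]
  show "smooth_on (snd c ` (fst c \<inter> W)) ((\<lambda>p. a * \<phi> p + b * \<psi> p) \<circ> inv_chart c)"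
    using assms(3,4) c unfolding o_def smooth_fun_def smooth_components_def
    by (intro smooth_on_add smooth_on_mult smooth_on_const op) auto
qed

lemma smooth_fun_exp:
  assumes "smooth_atlas A" "open W" "smooth_fun A W \<phi>"
  shows "smooth_fun A W (\<lambda>p. exp (2 * \<phi> p))"
  unfolding smooth_fun_def smooth_components_def
proof
  fix c assume c: "c \<in> A"
  note op = is_chartD(5)[OF smooth_atlas_is_chart[OF assms(1) c] assms(2)]
  show "smooth_on (snd c ` (fst c \<inter> W)) ((\<lambda>p. exp (2 * \<phi> p)) \<circ> inv_chart c)"
    using assms(3) c unfolding o_def smooth_fun_def smooth_components_def
    by (intro smooth_on_exp smooth_on_mult smooth_on_const op) auto
qed

lemma lorentz_metric_subset: "lorentz_metric A W g \<Longrightarrow> V \<subseteq> W \<Longrightarrow> lorentz_metric A V g"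
  unfolding lorentz_metric_def by (blast intro: smooth_components_subset)

lemma vector_field_subset: "vector_field A W X \<Longrightarrow> V \<subseteq> W \<Longrightarrow> vector_field A V X"
  unfolding vector_field_def by (blast intro: smooth_components_subset)

lemma sections_subset: "k \<in> sections A W K \<Longrightarrow> V \<subseteq> W \<Longrightarrow> k \<in> sections A V K"
  unfolding sections_def by (blast intro: vector_field_subset)

lemma lorentz_metric_conf_class:
  assumes A: "smooth_atlas A" and W: "open W" and g: "lorentz_metric A W g" and g': "g' \<in> conf_class A W g"
  shows "lorentz_metric A W g'"
proof -
  obtain \<phi> where \<phi>: "smooth_fun A W \<phi>" "\<And>c p. c \<in> A \<Longrightarrow> p \<in> fst c \<inter> W \<Longrightarrow> g' c p = exp (2 * \<phi> p) *\<^sub>R g c p"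
    using g' by (auto simp: conf_class_def)
  note mm = bounded_bilinear.scaleR_left[OF bounded_bilinear_matrix_matrix_mult]
    bounded_bilinear.scaleR_right[OF bounded_bilinear_matrix_matrix_mult]
  have gs: "smooth_components A W g" using g by (simp add: lorentz_metric_def)
  have "smooth_components A W (\<lambda>c p. exp (2 * \<phi> p) *\<^sub>R g c p)"
    by (rule smooth_components_bilinear[OF A W bounded_bilinear_scaleR
          smooth_fun_exp[OF A W \<phi>(1), unfolded smooth_fun_def] gs])
  then have "smooth_components A W g'" by (rule smooth_components_cong[OF A W, rotated]) (simp add: \<phi>(2))
  moreover have "lorentzian_form (g' c p)" if "c \<in> A" "p \<in> fst c \<inter> W" for c p
  proof -
    have "lorentzian_form (g c p)" using g that unfolding lorentz_metric_def by blast
    then show ?thesis unfolding \<phi>(2)[OF that] by (rule lorentzian_form_scaleR) simp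
  qed
  moreover have "g' c p = transpose (jacobian c c' p) ** g' c' p ** jacobian c c' p"
    if "c \<in> A" "c' \<in> A" "p \<in> fst c \<inter> fst c' \<inter> W" for c c' p
  proof -
    have "g c p = transpose (jacobian c c' p) ** g c' p ** jacobian c c' p"
      using g that unfolding lorentz_metric_def by blast
    then show ?thesis using that by (simp add: \<phi>(2) mm)
  qed
  ultimately show ?thesis unfolding lorentz_metric_def by blast
qed

lemma lorentz_metricD:
  assumes g: "lorentz_metric A W g" and c: "c \<in> A" "p \<in> fst c \<inter> W"
  shows "lorentzian_form (g c p)" "invertible (g c p)" "transpose (g c p) = g c p"
    "has_chart_deriv c (g c) p (chart_deriv c (g c) p)"
    "c' \<in> A \<Longrightarrow> p \<in> fst c' \<Longrightarrow> g c p = transpose (jacobian c c' p) ** g c' p ** jacobian c c' p"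
proof -
  show L: "lorentzian_form (g c p)" using g c unfolding lorentz_metric_def by blast
  show "invertible (g c p)" by (rule lorentzian_invertible[OF L])
  show "transpose (g c p) = g c p" by (rule lorentzian_symmetric[OF L])
  show "has_chart_deriv c (g c) p (chart_deriv c (g c) p)"
    using g c unfolding lorentz_metric_def by (blast intro: smooth_components_has_chart_deriv)
  show "c' \<in> A \<Longrightarrow> p \<in> fst c' \<Longrightarrow> g c p = transpose (jacobian c c' p) ** g c' p ** jacobian c c' p"
    using g c unfolding lorentz_metric_def by blast
qed

lemma ip_change:
  assumes "lorentz_metric A W g" "c \<in> A" "c' \<in> A" "p \<in> fst c \<inter> fst c' \<inter> W"
  shows "ip (g c' p) (jacobian c c' p *v v) (jacobian c c' p *v w) = ip (g c p) v w"
  using lorentz_metricD(5)[OF assms(1,2), of p c'] assms(3,4) ip_congruence[of "jacobian c c' p" "g c' p" v w] by simp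

lemma chart_deriv_metric_symmetric:
  assumes A: "smooth_atlas A" and W: "open W" and g: "lorentz_metric A W g" and c: "c \<in> A" "p \<in> fst c \<inter> W"
  shows "transpose (chart_deriv c (g c) p v) = chart_deriv c (g c) p v"
proof -
  note ch = smooth_atlas_is_chart[OF A c(1)]
  have "has_chart_deriv c (\<lambda>q. transpose (g c q)) p (\<lambda>v. transpose (chart_deriv c (g c) p v))"
    by (rule has_chart_deriv_bounded_linear[OF bounded_linear_transpose lorentz_metricD(4)[OF g c]])
  then have "has_chart_deriv c (g c) p (\<lambda>v. transpose (chart_deriv c (g c) p v))"
    by (rule has_chart_deriv_cong[OF ch W c(2), rotated]) (rule lorentz_metricD(3)[OF g c(1)])
  from chart_deriv_eqI[OF this] show ?thesis by metis
qed

section \<open>Divergence and expansion of vector fields in charts\<close>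

lemma divergence_coord:
  assumes A: "smooth_atlas A" and W: "open W" and g: "lorentz_metric A W g" and c: "c \<in> A" "p \<in> fst c \<inter> W"
  shows "divergence g X c p = coord_div (g c p) (chart_deriv c (g c) p) (X c p) (chart_deriv c (X c) p)"
  using lorentz_metricD[OF g c] chart_deriv_metric_symmetric[OF A W g c]
  by (intro divergence_eq_coord_div) (auto intro: has_chart_deriv_linear)

lemma metric_cov_deriv_coord:
  assumes A: "smooth_atlas A" and W: "open W" and g: "lorentz_metric A W g" and c: "c \<in> A" "p \<in> fst c \<inter> W"
  shows "g c p *v cov_deriv g X c p (X c p)
    = coord_accel (g c p) (chart_deriv c (g c) p) (X c p) (chart_deriv c (X c) p)"
  using lorentz_metricD[OF g c] chart_deriv_metric_symmetric[OF A W g c]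
  by (intro metric_cov_deriv_eq_coord_accel) (auto intro: has_chart_deriv_linear)

lemma flat_eq:
  assumes "transpose (g c p) = g c p"
  shows "flat g X c p = g c p *v X c p"
  using ip_commute[OF assms, of "X c p"]
  by (simp add: flat_def vec_eq_iff ip_def inner_axis')

lemma expansion_coord:
  assumes A: "smooth_atlas A" and W: "open W" and g: "lorentz_metric A W g" and c: "c \<in> A" "p \<in> fst c \<inter> W"
    and X: "has_chart_deriv c (X c) p (chart_deriv c (X c) p)"
  shows "divergence g X c p *\<^sub>R flat g X c p - cov_deriv_form g (flat g X) c p (X c p)
    = coord_div (g c p) (chart_deriv c (g c) p) (X c p) (chart_deriv c (X c) p) *\<^sub>R (g c p *v X c p)
      - coord_accel (g c p) (chart_deriv c (g c) p) (X c p) (chart_deriv c (X c) p)"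
proof -
  note ch = smooth_atlas_is_chart[OF A c(1)] and gD = lorentz_metricD[OF g c]
  have "has_chart_deriv c (\<lambda>q. g c q *v X c q) p
      (\<lambda>v. g c p *v chart_deriv c (X c) p v + chart_deriv c (g c) p v *v X c p)"
    using c by (intro has_chart_deriv_bilinear[OF bounded_bilinear_matrix_vector_mult ch _ gD(4) X]) simp
  then have "has_chart_deriv c (flat g X c) p
      (\<lambda>v. g c p *v chart_deriv c (X c) p v + chart_deriv c (g c) p v *v X c p)"
    by (rule has_chart_deriv_cong[OF ch W c(2), rotated])
      (rule flat_eq[where g = g and c = c and X = X, OF lorentz_metricD(3)[OF g c(1)], symmetric])
  note d = chart_deriv_eqI[OF this]
  have "cov_deriv_form g (flat g X) c p (X c p)
      = coord_accel (g c p) (chart_deriv c (g c) p) (X c p) (chart_deriv c (X c) p)"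
    by (rule cov_deriv_flat_eq_coord_accel[OF gD(2,3) chart_deriv_metric_symmetric[OF A W g c]
          has_chart_deriv_linear[OF gD(4)] d flat_eq[where g = g and c = c and p = p and X = X, OF gD(3)]])
  then show ?thesis by (simp add: divergence_coord[OF A W g c] flat_eq[where g = g and c = c and p = p and X = X, OF gD(3)])
qed

text \<open>\<open>divergence\<close> is defined chart by chart. Its independence of the chart makes
  the right-hand side of the transport equation a function on the manifold, so that solving in one
  chart solves it in all.\<close>

lemma divergence_change:
  assumes A: "smooth_atlas A" and W: "open W" and g: "lorentz_metric A W g" and X: "vector_field A W X"
    and c: "c \<in> A" "c' \<in> A" and p: "p \<in> fst c \<inter> fst c' \<inter> W"
  shows "divergence g X c p = divergence g X c' p"
proof -
  have p1: "p \<in> fst c \<inter> W" and p2: "p \<in> fst c' \<inter> W" and p3: "p \<in> fst c \<inter> fst c'" using p by auto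
  note ch = smooth_atlas_is_chart[OF A c(1)] and ch' = smooth_atlas_is_chart[OF A c(2)]
  note gc = lorentz_metricD[OF g c(1) p1] and gc' = lorentz_metricD[OF g c(2) p2]
  define J where "J = jacobian c c'"
  define DJ where "DJ = chart_deriv c J p"
  have J: "has_chart_deriv c J p DJ"
    unfolding J_def DJ_def by (rule smooth_has_chart_deriv[OF smooth_jacobian[OF A c] p3])
  have Gp: "g c p = transpose (J p) ** g c' p ** J p"
    unfolding J_def using c p by (intro gc(5)) auto
  have Xs: "smooth_components A W X" using X by (simp add: vector_field_def)
  have Xc: "has_chart_deriv c (X c) p (chart_deriv c (X c) p)"
    and Xc': "has_chart_deriv c' (X c') p (chart_deriv c' (X c') p)"
    using smooth_components_has_chart_deriv[OF Xs] c p1 p2 by blast+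
  note opW = open_Int[OF is_chartD(1)[OF ch'] W]
  have pW: "p \<in> fst c \<inter> (fst c' \<inter> W)" using p by auto
  have XJ: "X c' q = J q *v X c q" if "q \<in> fst c \<inter> (fst c' \<inter> W)" for q
    using X c that unfolding vector_field_def J_def by blast
  have "has_chart_deriv c (\<lambda>q. J q *v X c q) p (\<lambda>v. J p *v chart_deriv c (X c) p v + DJ v *v X c p)"
    using p by (intro has_chart_deriv_bilinear[OF bounded_bilinear_matrix_vector_mult ch _ J Xc]) simp
  then have "has_chart_deriv c (X c') p (\<lambda>v. J p *v chart_deriv c (X c) p v + DJ v *v X c p)"
    by (rule has_chart_deriv_cong[OF ch opW pW XJ[symmetric], rotated])
  note e1 = fun_cong[OF chart_deriv_eqI[OF this]]
    and e2 = fun_cong[OF chart_deriv_eqI[OF has_chart_deriv_change[OF A c p3 Xc']]]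
  have DX: "chart_deriv c' (X c') p (J p *v v) = DJ v *v X c p + J p *v chart_deriv c (X c) p v" for v
    unfolding J_def using trans[OF e2[symmetric] e1] by (simp add: J_def add.commute)
  have gc'c: "has_chart_deriv c (g c') p (\<lambda>v. chart_deriv c' (g c') p (J p *v v))"
    unfolding J_def by (rule has_chart_deriv_change[OF A c p3 gc'(4)])
  have Jt: "has_chart_deriv c (\<lambda>q. transpose (J q)) p (\<lambda>v. transpose (DJ v))"
    by (rule has_chart_deriv_bounded_linear[OF bounded_linear_transpose J])
  have pc: "p \<in> fst c" using p by simp
  have "has_chart_deriv c (\<lambda>q. transpose (J q) ** g c' q ** J q) p
      (\<lambda>v. (transpose (J p) ** g c' p) ** DJ v
        + (transpose (J p) ** chart_deriv c' (g c') p (J p *v v) + transpose (DJ v) ** g c' p) ** J p)"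
    by (intro has_chart_deriv_bilinear[OF bounded_bilinear_matrix_matrix_mult ch pc] J Jt gc'c)
  then have "has_chart_deriv c (g c) p
      (\<lambda>v. (transpose (J p) ** g c' p) ** DJ v
        + (transpose (J p) ** chart_deriv c' (g c') p (J p *v v) + transpose (DJ v) ** g c' p) ** J p)"
  proof (rule has_chart_deriv_cong[OF ch opW pW, rotated])
    show "transpose (J q) ** g c' q ** J q = g c q" if "q \<in> fst c \<inter> (fst c' \<inter> W)" for q
      using lorentz_metricD(5)[OF g c(1) _ c(2), of q] that by (simp add: J_def)
  qed
  from chart_deriv_eqI[OF this]
  have DG: "chart_deriv c (g c) p v = transpose (DJ v) ** g c' p ** J p
      + transpose (J p) ** chart_deriv c' (g c') p (J p *v v) ** J p + transpose (J p) ** g c' p ** DJ v" for v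
    by (simp add: bounded_bilinear.add_left[OF bounded_bilinear_matrix_matrix_mult])
  have "invertible (J p)"
    using gc(2) Gp by (simp add: invertible_det_nz det_mul)
  then have "coord_div (g c p) (chart_deriv c (g c) p) (X c p) (chart_deriv c (X c) p)
      = coord_div (g c' p) (chart_deriv c' (g c') p) (J p *v X c p) (chart_deriv c' (X c') p)"
    by (rule coord_div_change[OF _ gc'(2) Gp DG DX has_chart_deriv_linear[OF Xc'] has_chart_deriv_linear[OF Xc]])
      (simp add: DJ_def J_def chart_deriv_jacobian_symmetric[OF A c p3])
  moreover have "X c' p = J p *v X c p" by (rule XJ[OF pW])
  ultimately show ?thesis
    by (simp add: divergence_coord[OF A W g c(1) p1] divergence_coord[OF A W g c(2) p2])
qed

section \<open>Conformal rescaling\<close>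

lemma open_carrier: "smooth_atlas A \<Longrightarrow> open (carrier A)"
  unfolding carrier_def smooth_atlas_def by (blast intro: is_chartD(1))

text \<open>Each fibre of \<open>K\<close> contains exactly one vector with the required product
  with \<open>T\<close>. Uniqueness yields the transformation law between charts; smoothness holds
  because near each point \<open>k\<close> is a smooth spanning field divided by minus its product
  with \<open>T\<close>.\<close>

lemma normalized_section:
  assumes A: "smooth_atlas A" and g: "lorentz_metric A (carrier A) g" and K: "line_distribution A K"
    and T: "vector_field A (carrier A) T"
    and timelike: "\<And>c p. c \<in> A \<Longrightarrow> p \<in> fst c \<Longrightarrow> ip (g c p) (T c p) (T c p) < 0"
    and null: "\<And>c p v. c \<in> A \<Longrightarrow> p \<in> fst c \<Longrightarrow> v \<in> K c p \<Longrightarrow> ip (g c p) v v = 0"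
  obtains k where "k \<in> sections A (carrier A) K"
    "\<And>c p. c \<in> A \<Longrightarrow> p \<in> fst c \<Longrightarrow> ip (g c p) (k c p) (T c p) = - 1"
    "\<And>c p v. c \<in> A \<Longrightarrow> p \<in> fst c \<Longrightarrow> v \<in> K c p \<Longrightarrow> v = (- ip (g c p) v (T c p)) *\<^sub>R k c p"
proof -
  have car: "p \<in> fst c \<Longrightarrow> c \<in> A \<Longrightarrow> p \<in> carrier A" for c p by (auto simp: carrier_def)
  have sub: "subspace (K c p)" "dim (K c p) = 1" if "c \<in> A" "p \<in> fst c" for c p
    using K that unfolding line_distribution_def by blast+
  have L: "lorentzian_form (g c p)" if "c \<in> A" "p \<in> fst c" for c p
    using lorentz_metricD(1)[OF g that(1)] that car by blast
  have nz: "ip (g c p) v (T c p) \<noteq> 0" if "c \<in> A" "p \<in> fst c" "v \<in> K c p" "v \<noteq> 0" for c p v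
    using null_orthogonal_timelike[OF L timelike null] that by blast
  \<comment> \<open>The difference of two such vectors lies in \<open>K\<close> and is orthogonal to
    the timelike \<open>T\<close>, hence zero.\<close>
  have uniq: "v = w" if "c \<in> A" "p \<in> fst c" "v \<in> K c p" "w \<in> K c p"
    "ip (g c p) v (T c p) = ip (g c p) w (T c p)" for c p v w
    using nz[OF that(1,2) subspace_diff[OF sub(1)[OF that(1,2)] that(3,4)]] that(5) by (auto simp: ip_simps)
  have "\<exists>v\<in>K c p. ip (g c p) v (T c p) = - 1" if c: "c \<in> A" "p \<in> fst c" for c p
  proof -
    have "\<exists>v\<in>K c p. v \<noteq> 0"
    proof (rule ccontr)
      assume "\<not> ?thesis"
      then have "K c p \<subseteq> {0}" by blast
      then have "dim (K c p) = 0" by (simp add: dim_eq_0)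
      then show False using sub(2)[OF c] by simp
    qed
    then obtain v where v: "v \<in> K c p" "v \<noteq> 0" by blast
    let ?r = "ip (g c p) v (T c p)"
    have "(- 1 / ?r) *\<^sub>R v \<in> K c p" by (rule subspace_scale[OF sub(1)[OF c] v(1)])
    moreover have "ip (g c p) ((- 1 / ?r) *\<^sub>R v) (T c p) = - 1"
      using nz[OF c v] unfolding ip_simps by simp
    ultimately show ?thesis by blast
  qed
  then obtain k where kK: "\<And>c p. c \<in> A \<Longrightarrow> p \<in> fst c \<Longrightarrow> k c p \<in> K c p"
    and kT: "\<And>c p. c \<in> A \<Longrightarrow> p \<in> fst c \<Longrightarrow> ip (g c p) (k c p) (T c p) = - 1"
    by metis
  have eq: "v = (- ip (g c p) v (T c p)) *\<^sub>R k c p" if c: "c \<in> A" "p \<in> fst c" and v: "v \<in> K c p" for c p v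
    by (rule uniq[OF c v subspace_scale[OF sub(1)[OF c] kK[OF c]]])
      (simp only: ip_simps kT[OF c], simp)
  have "smooth_on (snd c ` (fst c \<inter> carrier A)) (k c \<circ> inv_chart c)" if c: "c \<in> A" for c
  proof (rule smooth_on_local)
    fix y assume "y \<in> snd c ` (fst c \<inter> carrier A)"
    then obtain p where p: "p \<in> fst c" "p \<in> carrier A" "y = snd c p" by blast
    note ch = smooth_atlas_is_chart[OF A c]
    obtain V l where V: "open V" "p \<in> V" "V \<subseteq> carrier A" and l: "vector_field A V l"
        and span: "\<And>c q. c \<in> A \<Longrightarrow> q \<in> fst c \<inter> V \<Longrightarrow> K c q = span {l c q}"
      using K p(2) unfolding line_distribution_def by meson
    note op = is_chartD(5)[OF ch V(1)]
    have lK: "l c q \<in> K c q" if "q \<in> fst c \<inter> V" for q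
      using span[OF c that] by (simp add: span_base)
    have l0: "l c q \<noteq> 0" if "q \<in> fst c \<inter> V" for q
      using sub(2)[OF c, of q] that unfolding span[OF c that] by auto
    define r where "r q = ip (g c q) (l c q) (T c q)" for q
    have "smooth_components A V (\<lambda>c p. ip (g c p) (l c p) (T c p))"
      using l g T V(3) unfolding vector_field_def lorentz_metric_def
      by (intro smooth_components_ip[OF A V(1)]) (auto intro: smooth_components_subset)
    then have r: "smooth_on (snd c ` (fst c \<inter> V)) (r \<circ> inv_chart c)"
      using c unfolding smooth_components_def r_def[abs_def] by blast
    have lc: "smooth_on (snd c ` (fst c \<inter> V)) (l c \<circ> inv_chart c)"
      using l c unfolding vector_field_def smooth_components_def by blast
    have rnz: "r q \<noteq> 0" if "q \<in> fst c \<inter> V" for q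
      unfolding r_def using that lK[OF that] l0[OF that] by (intro nz[OF c]) auto
    have "smooth_on (snd c ` (fst c \<inter> V)) (\<lambda>y. (- inverse ((r \<circ> inv_chart c) y)) *\<^sub>R (l c \<circ> inv_chart c) y)"
      by (intro smooth_on_scaleR smooth_on_minus smooth_on_inverse op r lc)
        (auto simp: is_chartD[OF ch] rnz)
    then have "smooth_on (snd c ` (fst c \<inter> V)) (k c \<circ> inv_chart c)"
    proof (rule smooth_on_cong[OF op])
      fix y assume "y \<in> snd c ` (fst c \<inter> V)"
      then obtain q where q: "q \<in> fst c \<inter> V" "y = snd c q" by blast
      have "l c q = (- r q) *\<^sub>R k c q" unfolding r_def using q lK by (intro eq[OF c]) auto
      then have "(- inverse (r q)) *\<^sub>R l c q = k c q" using rnz[OF q(1)] by (simp add: scaleR_scaleR[symmetric] del: scaleR_scaleR) simp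
      then show "(- inverse ((r \<circ> inv_chart c) y)) *\<^sub>R (l c \<circ> inv_chart c) y = (k c \<circ> inv_chart c) y"
        using q by (simp add: is_chartD[OF ch])
    qed
    then show "\<exists>S. open S \<and> y \<in> S \<and> smooth_on S (k c \<circ> inv_chart c)"
      using op p V by blast
  qed
  moreover have "k c' p = jacobian c c' p *v k c p" if c: "c \<in> A" "c' \<in> A" and p: "p \<in> fst c \<inter> fst c' \<inter> carrier A" for c c' p
  proof (rule uniq[OF c(2)])
    show "p \<in> fst c'" using p by simp
    then show "k c' p \<in> K c' p" by (rule kK[OF c(2)])
    have "K c' p = (*v) (jacobian c c' p) ` K c p"
      using K c p unfolding line_distribution_def by blast
    then show "jacobian c c' p *v k c p \<in> K c' p" using kK[OF c(1)] p by blast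
    have "T c' p = jacobian c c' p *v T c p" using T c p unfolding vector_field_def by blast
    then have "ip (g c' p) (jacobian c c' p *v k c p) (T c' p) = - 1"
      using ip_change[OF g c p] kT[OF c(1)] p by simp
    then show "ip (g c' p) (k c' p) (T c' p) = ip (g c' p) (jacobian c c' p *v k c p) (T c' p)"
      using kT[OF c(2)] p by simp
  qed
  ultimately have "k \<in> sections A (carrier A) K"
    using kK unfolding sections_def vector_field_def smooth_components_def by blast
  then show ?thesis using kT eq by (rule that)
qed

text \<open>Geodesicity turns the acceleration covector into \<gamma> times
  \<open>g c p *v k c p\<close>, so that the whole expansion becomes a multiple of this one
  covector.\<close>

lemma expansion_rescale:
  fixes A :: "('a::{t2_space,second_countable_topology}, 'm::finite) chart set"
  assumes A: "smooth_atlas A" and W: "open W" and g: "lorentz_metric A W g"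
    and \<phi>: "smooth_fun A W \<phi>" and g': "\<And>c p. c \<in> A \<Longrightarrow> p \<in> fst c \<inter> W \<Longrightarrow> g' c p = exp (2 * \<phi> p) *\<^sub>R g c p"
    and k: "vector_field A W k" and c: "c \<in> A" "p \<in> fst c \<inter> W"
    and f: "has_chart_deriv c f p df" and k': "\<And>q. q \<in> fst c \<inter> W \<Longrightarrow> k' c q = f q *\<^sub>R k c q"
    and null: "ip (g c p) (k c p) (k c p) = 0"
    and geod: "cov_deriv g k c p (k c p) = \<gamma> *\<^sub>R k c p"
  shows "divergence g' k' c p *\<^sub>R flat g' k' c p - cov_deriv_form g' (flat g' k') c p (k' c p)
    = (exp (2 * \<phi> p) * (f p)\<^sup>2) *\<^sub>R ((divergence g k c p + (real CARD('m) - 2) * chart_deriv c \<phi> p (k c p) - \<gamma>)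
        *\<^sub>R (g c p *v k c p))"
proof -
  note ch = smooth_atlas_is_chart[OF A c(1)] and gD = lorentz_metricD[OF g c]
  have pc: "p \<in> fst c" using c by simp
  have g'L: "lorentz_metric A W g'"
    by (rule lorentz_metric_conf_class[OF A W g]) (use \<phi> g' in \<open>auto simp: conf_class_def\<close>)
  have \<phi>d: "has_chart_deriv c \<phi> p (chart_deriv c \<phi> p)"
    using \<phi> unfolding smooth_fun_def by (rule smooth_components_has_chart_deriv[OF _ c])
  have kd: "has_chart_deriv c (k c) p (chart_deriv c (k c) p)"
    using k unfolding vector_field_def by (blast intro: smooth_components_has_chart_deriv[OF _ c])
  have "has_chart_deriv c (\<lambda>q. f q *\<^sub>R k c q) p (\<lambda>v. f p *\<^sub>R chart_deriv c (k c) p v + df v *\<^sub>R k c p)"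
    by (rule has_chart_deriv_bilinear[OF bounded_bilinear_scaleR ch pc f kd])
  then have k'd: "has_chart_deriv c (k' c) p (\<lambda>v. f p *\<^sub>R chart_deriv c (k c) p v + df v *\<^sub>R k c p)"
    by (rule has_chart_deriv_cong[OF ch W c(2) k'[symmetric], rotated])
  have "has_chart_deriv c (\<lambda>q. exp (2 * \<phi> q) *\<^sub>R g c q) p
      (\<lambda>v. exp (2 * \<phi> p) *\<^sub>R chart_deriv c (g c) p v + (2 * exp (2 * \<phi> p) * chart_deriv c \<phi> p v) *\<^sub>R g c p)"
    by (rule has_chart_deriv_bilinear[OF bounded_bilinear_scaleR ch pc has_chart_deriv_exp[OF ch pc \<phi>d] gD(4)])
  then have g'd: "has_chart_deriv c (g' c) p
      (\<lambda>v. exp (2 * \<phi> p) *\<^sub>R chart_deriv c (g c) p v + (2 * exp (2 * \<phi> p) * chart_deriv c \<phi> p v) *\<^sub>R g c p)"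
    by (rule has_chart_deriv_cong[OF ch W c(2) g'[OF c(1), symmetric], rotated])
  have "divergence g' k' c p *\<^sub>R flat g' k' c p - cov_deriv_form g' (flat g' k') c p (k' c p)
    = coord_div (g' c p) (chart_deriv c (g' c) p) (k' c p) (chart_deriv c (k' c) p) *\<^sub>R (g' c p *v k' c p)
      - coord_accel (g' c p) (chart_deriv c (g' c) p) (k' c p) (chart_deriv c (k' c) p)"
    by (rule expansion_coord[OF A W g'L c]) (use k'd chart_deriv_eqI[OF k'd] in simp)
  also have "\<dots> = (exp (2 * \<phi> p) * (f p)\<^sup>2) *\<^sub>R ((coord_div (g c p) (chart_deriv c (g c) p) (k c p) (chart_deriv c (k c) p)
      + (real CARD('m) - 2) * chart_deriv c \<phi> p (k c p)) *\<^sub>R (g c p *v k c p)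
      - coord_accel (g c p) (chart_deriv c (g c) p) (k c p) (chart_deriv c (k c) p))"
    unfolding g'[OF c] k'[OF c(2)]
  proof (rule coord_expansion_rescale[OF gD(2) _ null has_chart_deriv_linear[OF gD(4)] has_chart_deriv_linear[OF kd]
        has_chart_deriv_linear[OF \<phi>d] has_chart_deriv_linear[OF f]])
    show "chart_deriv c (g' c) p v = exp (2 * \<phi> p) *\<^sub>R ((2 * chart_deriv c \<phi> p v) *\<^sub>R g c p + chart_deriv c (g c) p v)" for v
      unfolding chart_deriv_eqI[OF g'd] by (simp add: scaleR_add_right mult_ac)
    show "chart_deriv c (k' c) p v = df v *\<^sub>R k c p + f p *\<^sub>R chart_deriv c (k c) p v" for v
      unfolding chart_deriv_eqI[OF k'd] by simp
  qed simp
  also have "coord_accel (g c p) (chart_deriv c (g c) p) (k c p) (chart_deriv c (k c) p) = \<gamma> *\<^sub>R (g c p *v k c p)"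
    using metric_cov_deriv_coord[OF A W g c, of k] geod by (simp add: matrix_vector_mult_scaleR)
  finally show ?thesis
    by (simp add: divergence_coord[OF A W g c] scaleR_diff_left)
qed

section \<open>The induced metric on the screen bundle\<close>

lemma induced_screen_metric_eq:
  assumes "subspace (K c p)" and sym: "transpose (g c p) = g c p"
    and null: "\<And>v. v \<in> K c p \<Longrightarrow> ip (g c p) v v = 0"
    and vw: "v \<in> perp g K c p" "w \<in> perp g K c p"
  shows "induced_screen_metric K g c p ((+) v ` K c p) ((+) w ` K c p) = ip (g c p) v w"
proof -
  \<comment> \<open>Polarisation: a subspace of null vectors is totally isotropic.\<close>
  have KK: "ip (g c p) x y = 0" if "x \<in> K c p" "y \<in> K c p" for x y
    using null[OF subspace_add[OF assms(1) that]] null[OF that(1)] null[OF that(2)] ip_commute[OF sym, of x y]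
    by (simp add: ip_simps)
  have *: "ip (g c p) (v + x) (w + y) = ip (g c p) v w" if "x \<in> K c p" "y \<in> K c p" for x y
    using vw that KK ip_commute[OF sym, of x w] by (simp add: perp_def ip_simps)
  \<comment> \<open>Both cosets are nonempty because \<open>K c p\<close> contains 0, so exactly one
    \<open>r\<close> qualifies and the definite description can be evaluated.\<close>
  have "(\<forall>x\<in>(+) v ` K c p. \<forall>y\<in>(+) w ` K c p. r = ip (g c p) x y) \<longleftrightarrow> r = ip (g c p) v w" for r
    using * subspace_0[OF assms(1)] by force
  moreover have "(+) v ` K c p \<in> screen g K c p" "(+) w ` K c p \<in> screen g K c p"
    using vw by (auto simp: screen_def)
  ultimately show ?thesis by (simp add: induced_screen_metric_def)
qed

text \<open>Proportional forms have the same orthogonal complement and hence the same screen space;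
  off it both metrics take the default value 0, so the relation holds for arbitrary sets
  \<open>a\<close> and \<open>b\<close>.\<close>

lemma induced_screen_metric_rescale:
  assumes sub: "subspace (K c p)" and sym: "transpose (g c p) = g c p"
    and null: "\<And>v. v \<in> K c p \<Longrightarrow> ip (g c p) v v = 0"
    and g': "g' c p = r *\<^sub>R g c p" and r: "r \<noteq> 0"
  shows "induced_screen_metric K g' c p a b = r * induced_screen_metric K g c p a b"
proof -
  have perp: "perp g' K c p = perp g K c p" using r by (simp add: perp_def g' ip_scaleR_metric)
  then have scr: "screen g' K c p = screen g K c p" by (simp add: screen_def)
  show ?thesis
  proof (cases "a \<in> screen g K c p \<and> b \<in> screen g K c p")
    case True
    then obtain v w where vw: "v \<in> perp g K c p" "w \<in> perp g K c p"
      and ab: "a = (+) v ` K c p" "b = (+) w ` K c p" unfolding screen_def by blast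
    have "transpose (g' c p) = g' c p" using sym by (simp add: g' transpose_def vec_eq_iff)
    then have "induced_screen_metric K g' c p a b = ip (g' c p) v w"
      unfolding ab using null vw perp
      by (intro induced_screen_metric_eq[where K = K and c = c and p = p, OF sub]) (simp_all add: g' ip_scaleR_metric)
    moreover have "induced_screen_metric K g c p a b = ip (g c p) v w"
      unfolding ab by (rule induced_screen_metric_eq[where K = K and c = c and p = p and g = g, OF sub sym null vw])
    ultimately show ?thesis by (simp add: g' ip_scaleR_metric)
  next
    case False
    then show ?thesis by (auto simp: induced_screen_metric_def scr)
  qed
qed

text \<open>One direction tests the condition on \<open>k\<close> itself; the other writes a given
  section as a function times \<open>k\<close> and lets the square of that function factor
  out.\<close>

lemma non_expanding_rescale_iff:
  fixes A :: "('a::{t2_space,second_countable_topology}, 'm::finite) chart set"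
  assumes A: "smooth_atlas A" and U: "open U" "U \<subseteq> carrier A" and g: "lorentz_metric A (carrier A) g"
    and T: "vector_field A (carrier A) T" and k: "k \<in> sections A (carrier A) K"
    and kT: "\<And>c p. c \<in> A \<Longrightarrow> p \<in> fst c \<Longrightarrow> ip (g c p) (k c p) (T c p) = - 1"
    and Kk: "\<And>c p v. c \<in> A \<Longrightarrow> p \<in> fst c \<Longrightarrow> v \<in> K c p \<Longrightarrow> v = (- ip (g c p) v (T c p)) *\<^sub>R k c p"
    and null: "\<And>c p. c \<in> A \<Longrightarrow> p \<in> fst c \<Longrightarrow> ip (g c p) (k c p) (k c p) = 0"
    and geod: "\<And>c p. c \<in> A \<Longrightarrow> p \<in> fst c \<Longrightarrow> cov_deriv g k c p (k c p) = \<gamma> c p *\<^sub>R k c p"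
    and \<phi>: "smooth_fun A U \<phi>" and g': "\<And>c p. c \<in> A \<Longrightarrow> p \<in> fst c \<inter> U \<Longrightarrow> g' c p = exp (2 * \<phi> p) *\<^sub>R g c p"
  shows "non_expanding A U K g' \<longleftrightarrow> (\<forall>c\<in>A. \<forall>p\<in>fst c \<inter> U.
    (real CARD('m) - 2) * chart_deriv c \<phi> p (k c p) = \<gamma> c p - divergence g k c p)"
proof -
  have gU: "lorentz_metric A U g" by (rule lorentz_metric_subset[OF g U(2)])
  have kU: "k \<in> sections A U K" by (rule sections_subset[OF k U(2)])
  then have kv: "vector_field A U k" by (simp add: sections_def)
  have E: "divergence g' l c p *\<^sub>R flat g' l c p - cov_deriv_form g' (flat g' l) c p (l c p)
      = (exp (2 * \<phi> p) * (f p)\<^sup>2) *\<^sub>R ((divergence g k c p + (real CARD('m) - 2) * chart_deriv c \<phi> p (k c p) - \<gamma> c p)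
        *\<^sub>R (g c p *v k c p))"
    if c: "c \<in> A" "p \<in> fst c \<inter> U" and f: "has_chart_deriv c f p df"
      and l: "\<And>q. q \<in> fst c \<inter> U \<Longrightarrow> l c q = f q *\<^sub>R k c q" for l f df c p
  proof -
    have pc: "p \<in> fst c" using c by simp
    show ?thesis
      by (rule expansion_rescale[where f = f and k = k and k' = l and g = g and g' = g' and c = c and p = p,
            OF A U(1) gU \<phi> g' kv c f l null[OF c(1) pc] geod[OF c(1) pc]])
  qed
  show ?thesis
  proof
    assume ne: "non_expanding A U K g'"
    show "\<forall>c\<in>A. \<forall>p\<in>fst c \<inter> U. (real CARD('m) - 2) * chart_deriv c \<phi> p (k c p) = \<gamma> c p - divergence g k c p"
    proof (intro ballI)
      fix c p assume c: "c \<in> A" "p \<in> fst c \<inter> U"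
      have "has_chart_deriv c (\<lambda>q. 1 :: real) p (\<lambda>v. 0)"
        by (simp add: has_chart_deriv_def o_def)
      note E1 = E[where l = k, OF c this]
      have "divergence g' k c p *\<^sub>R flat g' k c p - cov_deriv_form g' (flat g' k) c p (k c p) = 0"
        using ne kU c unfolding non_expanding_def by blast
      \<comment> \<open>Pairing this covector with \<open>T\<close> gives -1, so its scalar
        coefficient can be isolated.\<close>
      moreover have "g c p *v k c p \<noteq> 0"
      proof
        assume "g c p *v k c p = 0"
        then have "ip (g c p) (T c p) (k c p) = 0" by (simp add: ip_def)
        then show False
          using kT[of c p] c ip_commute[OF lorentz_metricD(3)[OF gU c], of "k c p" "T c p"] by simp
      qed
      ultimately show "(real CARD('m) - 2) * chart_deriv c \<phi> p (k c p) = \<gamma> c p - divergence g k c p"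
        using E1 by simp
    qed
  next
    assume eq: "\<forall>c\<in>A. \<forall>p\<in>fst c \<inter> U. (real CARD('m) - 2) * chart_deriv c \<phi> p (k c p) = \<gamma> c p - divergence g k c p"
    show "non_expanding A U K g'"
      unfolding non_expanding_def
    proof (intro ballI)
      fix l c p assume l: "l \<in> sections A U K" and c: "c \<in> A" "p \<in> fst c \<inter> U"
      \<comment> \<open>The coefficient of \<open>l\<close> relative to \<open>k\<close>, read off
        by pairing with \<open>T\<close>; it may have zeros.\<close>
      define f where "f c q = - ip (g c q) (l c q) (T c q)" for c q
      have "smooth_components A U (\<lambda>c q. ip (g c q) (l c q) (T c q))"
        using l gU vector_field_subset[OF T U(2)] unfolding sections_def vector_field_def lorentz_metric_def
        by (intro smooth_components_ip[OF A U(1)]) auto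
      then have "smooth_components A U f"
        unfolding f_def by (rule smooth_components_linear[OF A U(1) bounded_linear_minus[OF bounded_linear_ident]])
      note fd = smooth_components_has_chart_deriv[OF this c]
      have "l c q = f c q *\<^sub>R k c q" if "q \<in> fst c \<inter> U" for q
        unfolding f_def using l c that unfolding sections_def by (intro Kk) auto
      from E[where l = l, OF c fd this] eq c
      show "divergence g' l c p *\<^sub>R flat g' l c p - cov_deriv_form g' (flat g' l) c p (l c p) = 0"
        by simp
    qed
  qed
qed

theorem proposition5p6:
  fixes A :: "('a::{t2_space,second_countable_topology}, 'm::finite) chart set"
    and s :: "('a, 'm, real) field"
    and T :: "('a, 'm, real ^ 'm) field"
    and C :: "('a, 'm) metric set"
    and K :: "('a, 'm) distribution"
    and n :: nat
  assumes dimension: "CARD('m) = n + 2" "n \<ge> 1"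
    and optical: "conformal_optical_geometry A s T C K"
    and geodesic: "null_geodesic_congruence A C K"
  shows "\<forall>x\<in>carrier A. \<exists>U Cne. open U \<and> x \<in> U \<and> U \<subseteq> carrier A \<and>
    Cne = {g \<in> restrict_class A U C. non_expanding A U K g} \<and> Cne \<noteq> {} \<and>
    (\<forall>g\<in>Cne. \<forall>g'\<in>Cne. \<exists>f. constant_along A U K f \<and> (\<forall>p\<in>U. f p > 0) \<and>
       (\<forall>c\<in>A. \<forall>p\<in>fst c \<inter> U. g' c p = f p *\<^sub>R g c p)) \<and>
    induced_screen_metric K ` Cne \<noteq> {} \<and>
    induced_screen_metric K ` Cne \<subseteq> induced_screen_metric K ` restrict_class A U C \<and>
    (\<forall>h\<in>induced_screen_metric K ` Cne. \<forall>h'\<in>induced_screen_metric K ` Cne.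
       \<exists>f. constant_along A U K f \<and> (\<forall>p\<in>U. f p > 0) \<and>
         (\<forall>c\<in>A. \<forall>p\<in>fst c \<inter> U. \<forall>a b. h' c p a b = f p * h c p a b))"
proof
  fix x assume x: "x \<in> carrier A"
  let ?M = "carrier A"
  have A: "smooth_atlas A" and K: "line_distribution A K" and TC: "time_orientation A C T"
    and nullC: "\<And>g c p v. g \<in> C \<Longrightarrow> c \<in> A \<Longrightarrow> p \<in> fst c \<Longrightarrow> v \<in> K c p \<Longrightarrow> ip (g c p) v v = 0"
    using optical unfolding conformal_optical_geometry_def by blast+
  obtain g0 where g0: "lorentz_metric A ?M g0" and C: "C = conf_class A ?M g0"
    using optical unfolding conformal_optical_geometry_def lorentz_conformal_structure_def by blast
  \<comment> \<open>Geodesicity is given for some metric of the class only, so this one rather than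
    \<open>g0\<close> serves as reference metric.\<close>
  obtain g1 where g1C: "g1 \<in> C" and geod: "\<And>k. k \<in> sections A ?M K \<Longrightarrow>
      (\<lambda>c p. cov_deriv g1 k c p (k c p)) \<in> sections A ?M K"
    using geodesic unfolding null_geodesic_congruence_def by blast
  have M: "open ?M" by (rule open_carrier[OF A])
  have g1: "lorentz_metric A ?M g1"
    by (rule lorentz_metric_conf_class[OF A M g0]) (use g1C C in simp)
  have T: "vector_field A ?M T" using TC by (simp add: time_orientation_def)
  have timelike: "ip (g1 c p) (T c p) (T c p) < 0" if "c \<in> A" "p \<in> fst c" for c p
    using TC g1C that unfolding time_orientation_def by blast
  have car: "p \<in> ?M" if "c \<in> A" "p \<in> fst c" for c p using that by (auto simp: carrier_def)
  obtain k where k: "k \<in> sections A ?M K"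
    and kT: "\<And>c p. c \<in> A \<Longrightarrow> p \<in> fst c \<Longrightarrow> ip (g1 c p) (k c p) (T c p) = - 1"
    and Kk: "\<And>c p v. c \<in> A \<Longrightarrow> p \<in> fst c \<Longrightarrow> v \<in> K c p \<Longrightarrow> v = (- ip (g1 c p) v (T c p)) *\<^sub>R k c p"
    using normalized_section[OF A g1 K T timelike nullC[OF g1C]] by blast
  have kv: "vector_field A ?M k" and kK: "\<And>c p. c \<in> A \<Longrightarrow> p \<in> fst c \<Longrightarrow> k c p \<in> K c p"
    using k car unfolding sections_def by blast+
  define a where "a c p = cov_deriv g1 k c p (k c p)" for c p
  have a: "vector_field A ?M a" and aK: "\<And>c p. c \<in> A \<Longrightarrow> p \<in> fst c \<Longrightarrow> a c p \<in> K c p"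
    using geod[OF k] car unfolding sections_def a_def by blast+
  define \<gamma> where "\<gamma> c p = - ip (g1 c p) (a c p) (T c p)" for c p
  have acc: "cov_deriv g1 k c p (k c p) = \<gamma> c p *\<^sub>R k c p" if "c \<in> A" "p \<in> fst c" for c p
    using Kk[OF that aK[OF that]] by (simp add: \<gamma>_def a_def)
  have knull: "ip (g1 c p) (k c p) (k c p) = 0" if "c \<in> A" "p \<in> fst c" for c p
    by (rule nullC[OF g1C that kK[OF that]])
  \<comment> \<open>The value that the derivative of \<phi> along \<open>k\<close> must have;
    \<open>n \<ge> 1\<close> permits the division.\<close>
  define R where "R c p = (\<gamma> c p - divergence g1 k c p) / n" for c p
  have n: "real n \<noteq> 0" "real CARD('m) - 2 = real n" using dimension by simp_all
  have R_change: "R c p = R c' p" if c: "c \<in> A" "c' \<in> A" and p: "p \<in> fst c \<inter> fst c'" for c c' p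
  proof -
    have pM: "p \<in> fst c \<inter> fst c' \<inter> ?M" using p car[OF c(1)] by blast
    have "a c' p = jacobian c c' p *v a c p" "T c' p = jacobian c c' p *v T c p"
      using a T c pM unfolding vector_field_def by blast+
    then have "\<gamma> c p = \<gamma> c' p" using ip_change[OF g1 c pM] by (simp add: \<gamma>_def)
    then show ?thesis using divergence_change[OF A M g1 kv c pM] by (simp add: R_def)
  qed
  have restrict: "g \<in> restrict_class A U C \<longleftrightarrow>
      (\<exists>\<phi>. smooth_fun A U \<phi> \<and> (\<forall>c\<in>A. \<forall>p\<in>fst c \<inter> U. g c p = exp (2 * \<phi> p) *\<^sub>R g1 c p))"
    if U: "open U" "U \<subseteq> ?M" for U g
  proof
    assume "g \<in> restrict_class A U C"
    then obtain g2 \<psi> where "g2 \<in> C" and \<psi>: "smooth_fun A U \<psi>"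
        "\<And>c p. c \<in> A \<Longrightarrow> p \<in> fst c \<inter> U \<Longrightarrow> g c p = exp (2 * \<psi> p) *\<^sub>R g2 c p"
      unfolding restrict_class_def conf_class_def by blast
    then obtain \<phi>2 where \<phi>2: "smooth_fun A ?M \<phi>2"
        "\<And>c p. c \<in> A \<Longrightarrow> p \<in> fst c \<inter> ?M \<Longrightarrow> g2 c p = exp (2 * \<phi>2 p) *\<^sub>R g0 c p"
      unfolding C conf_class_def by blast
    obtain \<phi>1 where \<phi>1: "smooth_fun A ?M \<phi>1"
        "\<And>c p. c \<in> A \<Longrightarrow> p \<in> fst c \<inter> ?M \<Longrightarrow> g1 c p = exp (2 * \<phi>1 p) *\<^sub>R g0 c p"
      using g1C unfolding C conf_class_def by blast
    \<comment> \<open>The exponents of the steps from \<open>g1\<close> back to \<open>g0\<close>,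
      on to \<open>g2\<close> and then to \<open>g\<close> add up; the coefficients 1 and -1 fit the
      shape of \<open>smooth_fun_lincomb\<close>.\<close>
    define \<phi> where "\<phi> p = 1 * \<psi> p + 1 * (1 * \<phi>2 p + (- 1) * \<phi>1 p)" for p
    have "smooth_fun A U \<phi>"
      unfolding \<phi>_def using \<psi>(1) \<phi>1(1) \<phi>2(1) smooth_components_subset[OF _ U(2)]
      by (intro smooth_fun_lincomb[OF A U(1)]) (auto simp: smooth_fun_def)
    moreover have "g c p = exp (2 * \<phi> p) *\<^sub>R g1 c p" if "c \<in> A" "p \<in> fst c \<inter> U" for c p
    proof -
      have pM: "p \<in> fst c \<inter> ?M" using that U(2) by blast
      have "exp (2 * \<psi> p) * exp (2 * \<phi>2 p) = exp (2 * \<phi> p) * exp (2 * \<phi>1 p)"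
        unfolding exp_add[symmetric] by (simp add: \<phi>_def algebra_simps)
      then show ?thesis
        unfolding \<psi>(2)[OF that] \<phi>2(2)[OF that(1) pM] \<phi>1(2)[OF that(1) pM] by simp
    qed
    ultimately show "\<exists>\<phi>. smooth_fun A U \<phi> \<and> (\<forall>c\<in>A. \<forall>p\<in>fst c \<inter> U. g c p = exp (2 * \<phi> p) *\<^sub>R g1 c p)"
      by blast
  next
    assume "\<exists>\<phi>. smooth_fun A U \<phi> \<and> (\<forall>c\<in>A. \<forall>p\<in>fst c \<inter> U. g c p = exp (2 * \<phi> p) *\<^sub>R g1 c p)"
    then show "g \<in> restrict_class A U C"
      using g1C unfolding restrict_class_def conf_class_def by blast
  qed
  have non_exp: "non_expanding A U K g \<longleftrightarrow> (\<forall>c\<in>A. \<forall>p\<in>fst c \<inter> U. chart_deriv c \<phi> p (k c p) = R c p)"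
    if U: "open U" "U \<subseteq> ?M" and \<phi>: "smooth_fun A U \<phi>"
      and g: "\<And>c p. c \<in> A \<Longrightarrow> p \<in> fst c \<inter> U \<Longrightarrow> g c p = exp (2 * \<phi> p) *\<^sub>R g1 c p" for U g \<phi>
  proof -
    have "real n * d = r \<longleftrightarrow> d = r / real n" for d r using n(1) by (auto simp: field_simps)
    then show ?thesis
      using non_expanding_rescale_iff[OF A U g1 T k kT Kk knull acc \<phi> g] unfolding n(2) R_def by simp
  qed
  obtain c0 where c0: "c0 \<in> A" "x \<in> fst c0" using x by (auto simp: carrier_def)
  note ch0 = smooth_atlas_is_chart[OF A c0(1)]
  define D where "D = snd c0 ` (fst c0 \<inter> ?M)"
  have D: "open D" "snd c0 x \<in> D" "D = snd c0 ` fst c0"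
    unfolding D_def using is_chartD(5)[OF ch0 M] c0 x car[OF c0(1)] by auto
  have inv0: "inv_chart c0 y \<in> fst c0 \<inter> ?M" "snd c0 (inv_chart c0 y) = y" if "y \<in> D" for y
    using that unfolding D_def by (auto simp: is_chartD[OF ch0])
  have ks: "smooth_on D (k c0 \<circ> inv_chart c0)" and gs: "smooth_on D (g1 c0 \<circ> inv_chart c0)"
    using kv g1 c0(1) unfolding D_def vector_field_def lorentz_metric_def smooth_components_def by blast+
  have "smooth_components A ?M (\<lambda>c p. ip (g1 c p) (a c p) (T c p))"
    using a T g1 unfolding vector_field_def lorentz_metric_def by (intro smooth_components_ip[OF A M]) auto
  then have "smooth_on D ((\<lambda>p. ip (g1 c0 p) (a c0 p) (T c0 p)) \<circ> inv_chart c0)"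
    using c0(1) unfolding smooth_components_def D_def by blast
  then have \<gamma>s: "smooth_on D (\<gamma> c0 \<circ> inv_chart c0)"
    using smooth_on_minus[OF D(1)] by (simp add: \<gamma>_def[abs_def] o_def)
  \<comment> \<open>The definition through covariant derivatives is replaced by
    \<open>coord_div\<close>, whose ingredients are known to be smooth.\<close>
  have divs: "smooth_on D (divergence g1 k c0 \<circ> inv_chart c0)"
  proof (rule smooth_on_cong[OF D(1)])
    show "smooth_on D (\<lambda>y. trace (matrix (frechet_derivative (k c0 \<circ> inv_chart c0) (at y)))
        + 1/2 * trace (matrix_inv ((g1 c0 \<circ> inv_chart c0) y)
          ** frechet_derivative (g1 c0 \<circ> inv_chart c0) (at y) ((k c0 \<circ> inv_chart c0) y)))"
    proof (intro smooth_on_add smooth_on_mult smooth_on_const D(1) smooth_on_matrix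
        smooth_on_bounded_linear[OF bounded_linear_trace] smooth_on_frechet_derivative[OF ks]
        smooth_on_bounded_bilinear[OF bounded_bilinear_matrix_matrix_mult]
        smooth_on_matrix_inv gs smooth_on_frechet_derivative_apply ks)
      show "invertible ((g1 c0 \<circ> inv_chart c0) y)" if "y \<in> D" for y
        using lorentz_metricD(2)[OF g1 c0(1) inv0(1)[OF that]] by simp
    qed
    show "trace (matrix (frechet_derivative (k c0 \<circ> inv_chart c0) (at y)))
        + 1/2 * trace (matrix_inv ((g1 c0 \<circ> inv_chart c0) y)
          ** frechet_derivative (g1 c0 \<circ> inv_chart c0) (at y) ((k c0 \<circ> inv_chart c0) y))
        = (divergence g1 k c0 \<circ> inv_chart c0) y" if "y \<in> D" for y
      using divergence_coord[OF A M g1 c0(1) inv0(1)[OF that], of k] inv0(2)[OF that]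
      by (simp add: coord_div_def chart_deriv_def[abs_def])
  qed
  have Rs: "smooth_on D (R c0 \<circ> inv_chart c0)"
    using smooth_on_mult[OF D(1) smooth_on_diff[OF D(1) \<gamma>s divs] smooth_on_const[OF D(1), of "1 / real n"]]
    by (simp add: R_def[abs_def] o_def)
  have "k c0 x \<noteq> 0" using kT[OF c0] by (auto simp: ip_def)
  then have "(k c0 \<circ> inv_chart c0) (snd c0 x) \<noteq> 0" by (simp add: is_chartD[OF ch0] c0)
  then obtain W \<psi> where W: "open W" "snd c0 x \<in> W" "W \<subseteq> D" and \<psi>: "smooth_on W \<psi>"
      "\<And>y. y \<in> W \<Longrightarrow> frechet_derivative \<psi> (at y) ((k c0 \<circ> inv_chart c0) y) = (R c0 \<circ> inv_chart c0) y"
    using transport_equation[OF D(1,2) ks Rs] by blast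
  define U where "U = fst c0 \<inter> snd c0 -` W"
  have U0: "open U" unfolding U_def
    by (rule continuous_open_preimage[OF is_chartD(4,1)[OF ch0] W(1)])
  have U1: "x \<in> U" "U \<subseteq> fst c0" using c0 W by (auto simp: U_def)
  have U2: "U \<subseteq> ?M" using U1(2) car[OF c0(1)] by blast
  have img: "snd c0 ` (fst c0 \<inter> U) = W" using W(3) D(3) by (auto simp: U_def)
  define \<phi> where "\<phi> p = \<psi> (snd c0 p)" for p
  have \<phi>\<psi>: "(\<phi> \<circ> inv_chart c0) y = \<psi> y" if "y \<in> W" for y
    using inv0(2)[of y] that W(3) by (auto simp: \<phi>_def)
  have \<phi>0: "smooth_on (snd c0 ` (fst c0 \<inter> U)) (\<phi> \<circ> inv_chart c0)"
    unfolding img by (rule smooth_on_cong[OF W(1) \<psi>(1)]) (simp only: \<phi>\<psi>)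
  \<comment> \<open>\<open>U\<close> lies in the domain of \<open>c0\<close>, so smoothness in this
    chart passes to all others.\<close>
  have \<phi>: "smooth_fun A U \<phi>"
    unfolding smooth_fun_def smooth_components_def
    by (intro ballI smooth_on_change[OF A _ c0(1) U0 U1(2) \<phi>0])
  \<comment> \<open>Neither the derivative of a function along \<open>k\<close> nor \<open>R\<close>
    depends on the chart, so the equation solved in \<open>c0\<close> holds in every chart.\<close>
  have \<phi>R: "chart_deriv c \<phi> p (k c p) = R c p" if c: "c \<in> A" "p \<in> fst c \<inter> U" for c p
  proof -
    have p0: "p \<in> fst c0 \<inter> U" and pc: "p \<in> fst c \<inter> fst c0" using c U1(2) by auto
    have pW: "snd c0 p \<in> W" using p0 by (simp add: U_def)
    have "chart_deriv c0 \<phi> p = frechet_derivative \<psi> (at (snd c0 p))"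
      unfolding chart_deriv_def[abs_def]
      by (rule sym, rule frechet_derivative_transform_within_open[OF _ W(1) pW])
        (use smooth_on_imp_differentiable[OF \<psi>(1) pW] \<phi>\<psi> in simp_all)
    then have "chart_deriv c0 \<phi> p (k c0 p) = R c0 p"
      using \<psi>(2)[OF pW] p0 by (simp add: is_chartD[OF ch0])
    moreover have "has_chart_deriv c0 \<phi> p (chart_deriv c0 \<phi> p)"
      by (rule smooth_has_chart_deriv[OF \<phi>0 p0])
    from chart_deriv_eqI[OF has_chart_deriv_change[OF A c(1) c0(1) pc this]]
    have "chart_deriv c \<phi> p (k c p) = chart_deriv c0 \<phi> p (jacobian c c0 p *v k c p)" by simp
    moreover have "k c0 p = jacobian c c0 p *v k c p"
      using kv c c0(1) pc U2 unfolding vector_field_def by blast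
    ultimately show ?thesis using R_change[OF c(1) c0(1) pc] by simp
  qed
  define Cne where "Cne = {g \<in> restrict_class A U C. non_expanding A U K g}"
  have CneD: "\<exists>\<phi>. smooth_fun A U \<phi> \<and> (\<forall>c\<in>A. \<forall>p\<in>fst c \<inter> U. g c p = exp (2 * \<phi> p) *\<^sub>R g1 c p
      \<and> chart_deriv c \<phi> p (k c p) = R c p)" if "g \<in> Cne" for g
    using that restrict[OF U0 U2, of g] non_exp[OF U0 U2, of _ g] unfolding Cne_def by blast
  define g where "g c p = exp (2 * \<phi> p) *\<^sub>R g1 c p" for c p
  have "g \<in> restrict_class A U C" unfolding restrict[OF U0 U2] using \<phi> g_def by blast
  moreover have "non_expanding A U K g" unfolding non_exp[OF U0 U2 \<phi> g_def] using \<phi>R by blast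
  ultimately have "g \<in> Cne" by (simp add: Cne_def)
  then have ne: "Cne \<noteq> {}" by blast
  have ratio: "\<exists>f. constant_along A U K f \<and> (\<forall>p\<in>U. f p > 0) \<and>
      (\<forall>c\<in>A. \<forall>p\<in>fst c \<inter> U. g' c p = f p *\<^sub>R g c p)" if gg': "g \<in> Cne" "g' \<in> Cne" for g g'
  proof -
    obtain \<alpha> where \<alpha>: "smooth_fun A U \<alpha>" "\<And>c p. c \<in> A \<Longrightarrow> p \<in> fst c \<inter> U \<Longrightarrow> g c p = exp (2 * \<alpha> p) *\<^sub>R g1 c p"
        "\<And>c p. c \<in> A \<Longrightarrow> p \<in> fst c \<inter> U \<Longrightarrow> chart_deriv c \<alpha> p (k c p) = R c p"
      using CneD[OF gg'(1)] by blast
    obtain \<beta> where \<beta>: "smooth_fun A U \<beta>" "\<And>c p. c \<in> A \<Longrightarrow> p \<in> fst c \<inter> U \<Longrightarrow> g' c p = exp (2 * \<beta> p) *\<^sub>R g1 c p"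
        "\<And>c p. c \<in> A \<Longrightarrow> p \<in> fst c \<inter> U \<Longrightarrow> chart_deriv c \<beta> p (k c p) = R c p"
      using CneD[OF gg'(2)] by blast
    define \<delta> where "\<delta> p = 1 * \<beta> p + (- 1) * \<alpha> p" for p
    have \<delta>: "smooth_fun A U \<delta>" unfolding \<delta>_def by (rule smooth_fun_lincomb[OF A U0 \<beta>(1) \<alpha>(1)])
    define f where "f p = exp (2 * \<delta> p)" for p
    have "chart_deriv c f p v = 0" if c: "c \<in> A" "p \<in> fst c \<inter> U" and v: "v \<in> K c p" for c p v
    proof -
      note chc = smooth_atlas_is_chart[OF A c(1)]
      have pc: "p \<in> fst c" using c by simp
      have d: "has_chart_deriv c h p (chart_deriv c h p)" if "smooth_fun A U h" for h
        by (rule smooth_components_has_chart_deriv[OF that[unfolded smooth_fun_def] c])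
      have "has_chart_deriv c \<delta> p (\<lambda>v. chart_deriv c \<beta> p v - chart_deriv c \<alpha> p v)"
        using has_derivative_diff[OF d[OF \<beta>(1), unfolded has_chart_deriv_def] d[OF \<alpha>(1), unfolded has_chart_deriv_def]]
        by (simp add: has_chart_deriv_def \<delta>_def[abs_def] o_def)
      note fd = has_chart_deriv_exp[OF chc pc this]
      have "chart_deriv c f p = (\<lambda>v. 2 * exp (2 * \<delta> p) * (chart_deriv c \<beta> p v - chart_deriv c \<alpha> p v))"
        unfolding f_def[abs_def] by (rule chart_deriv_eqI[OF fd])
      \<comment> \<open>Both exponents solve the same transport equation along \<open>k\<close>, and
        \<open>v\<close> is a multiple of \<open>k c p\<close>.\<close>
      moreover have "chart_deriv c \<beta> p v = chart_deriv c \<alpha> p v"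
      proof -
        obtain r where r: "v = r *\<^sub>R k c p" using Kk[OF c(1) pc v] by blast
        show ?thesis
          unfolding r linear_scale[OF has_chart_deriv_linear[OF d[OF \<beta>(1)]]]
            linear_scale[OF has_chart_deriv_linear[OF d[OF \<alpha>(1)]]] \<alpha>(3)[OF c] \<beta>(3)[OF c] ..
      qed
      ultimately show ?thesis by simp
    qed
    then have "constant_along A U K f"
      using smooth_fun_exp[OF A U0 \<delta>] unfolding constant_along_def f_def[abs_def] by blast
    moreover have "g' c p = f p *\<^sub>R g c p" if "c \<in> A" "p \<in> fst c \<inter> U" for c p
    proof -
      have "exp (2 * \<beta> p) = f p * exp (2 * \<alpha> p)"
        unfolding f_def exp_add[symmetric] by (simp add: \<delta>_def)
      then show ?thesis by (simp add: \<alpha>(2)[OF that] \<beta>(2)[OF that])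
    qed
    ultimately show ?thesis by (intro exI[of _ f]) (simp add: f_def)
  qed
  have screen: "\<exists>f. constant_along A U K f \<and> (\<forall>p\<in>U. f p > 0) \<and>
      (\<forall>c\<in>A. \<forall>p\<in>fst c \<inter> U. \<forall>a b. h' c p a b = f p * h c p a b)"
    if hh': "h \<in> induced_screen_metric K ` Cne" "h' \<in> induced_screen_metric K ` Cne" for h h'
  proof -
    obtain g g' where gg': "g \<in> Cne" "g' \<in> Cne" and h: "h = induced_screen_metric K g" "h' = induced_screen_metric K g'"
      using hh' by blast
    obtain f where f: "constant_along A U K f" "\<And>p. p \<in> U \<Longrightarrow> f p > 0"
        "\<And>c p. c \<in> A \<Longrightarrow> p \<in> fst c \<inter> U \<Longrightarrow> g' c p = f p *\<^sub>R g c p"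
      using ratio[OF gg'] by blast
    obtain \<alpha> where \<alpha>: "\<And>c p. c \<in> A \<Longrightarrow> p \<in> fst c \<inter> U \<Longrightarrow> g c p = exp (2 * \<alpha> p) *\<^sub>R g1 c p"
      using CneD[OF gg'(1)] by blast
    have "h' c p a b = f p * h c p a b" if c: "c \<in> A" "p \<in> fst c \<inter> U" for c p a b
      unfolding h
    proof (rule induced_screen_metric_rescale)
      have pc: "p \<in> fst c" "p \<in> fst c \<inter> ?M" using c U2 by auto
      show "subspace (K c p)" using K c pc unfolding line_distribution_def by blast
      show "transpose (g c p) = g c p"
        using lorentz_metricD(3)[OF g1 c(1) pc(2)] by (simp add: \<alpha>[OF c] transpose_def vec_eq_iff)
      show "ip (g c p) v v = 0" if "v \<in> K c p" for v
        using nullC[OF g1C c(1) pc(1) that] by (simp add: \<alpha>[OF c] ip_scaleR_metric)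
      show "g' c p = f p *\<^sub>R g c p" by (rule f(3)[OF c])
      show "f p \<noteq> 0" using f(2)[of p] c by auto
    qed
    then show ?thesis using f(1,2) by blast
  qed
  have sub: "induced_screen_metric K ` Cne \<subseteq> induced_screen_metric K ` restrict_class A U C"
    by (rule image_mono) (auto simp: Cne_def)
  show "\<exists>U Cne. open U \<and> x \<in> U \<and> U \<subseteq> carrier A \<and>
    Cne = {g \<in> restrict_class A U C. non_expanding A U K g} \<and> Cne \<noteq> {} \<and>
    (\<forall>g\<in>Cne. \<forall>g'\<in>Cne. \<exists>f. constant_along A U K f \<and> (\<forall>p\<in>U. f p > 0) \<and>
       (\<forall>c\<in>A. \<forall>p\<in>fst c \<inter> U. g' c p = f p *\<^sub>R g c p)) \<and>
    induced_screen_metric K ` Cne \<noteq> {} \<and>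
    induced_screen_metric K ` Cne \<subseteq> induced_screen_metric K ` restrict_class A U C \<and>
    (\<forall>h\<in>induced_screen_metric K ` Cne. \<forall>h'\<in>induced_screen_metric K ` Cne.
       \<exists>f. constant_along A U K f \<and> (\<forall>p\<in>U. f p > 0) \<and>
         (\<forall>c\<in>A. \<forall>p\<in>fst c \<inter> U. \<forall>a b. h' c p a b = f p * h c p a b))"
    by (rule exI[of _ U], rule exI[of _ Cne], intro conjI ballI)
      (use U0 U1(1) U2 Cne_def ne ratio sub screen in \<open>blast+\<close>)
qed

end
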